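(* Let $\kappa$ be an infinite cardinal and let $\mathbb{B}(\kappa)$ be the measure algebra of the product probability measure on $2^\kappa$ (Borel sets modulo null sets), viewed as a forcing notion. Let $\mathcal{A}\in V$ be an infinite $\sigma$-complete Boolean algebra and let $G$ be a $\mathbb{B}(\kappa)$-generic filter over $V$. Then, in $V[G]$, there is no weak* null sequence $(\mu_n)_{n\in\omega}$ of finitely supported measures on $St(\mathcal{A})$ such that $\|\mu_n\|=1$ for every $n\in\omega$ and for which there exists $M\in\omega$ with $|\operatorname{supp}(\mu_n)|\le M$ for every $n\in\omega$.
   Context: A finitely supported measure on a compact space $K$ is $\sum_{i=1}^k\alpha_i\delta_{x_i}$ with pairwise distinct $x_i\in K$, real $\alpha_i$, and support $\{x_1,\dots,x_k\}$; $\|\cdot\|$ denotes total variation norm. A sequence of measures on $K$ is weak* null if $\int f\,d\mu_n\to0$ for every continuous $f\colon K\to\mathbb{R}$. $St(\mathcal{A})$ is the Stone space of $\mathcal{A}$ computed in $V[G]$. *)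

theory Defs
  imports "HOL-Probability.Probability"
begin

section \<open>The measure algebra of $2^\kappa$\<close>

text \<open>
  The type \<open>'k\<close> plays the role of \<open>\<kappa>\<close>. The space \<open>'k \<Rightarrow> bool\<close> carries the product topology, and
  \<open>borel\<close> is its Borel \<open>\<sigma>\<close>-algebra. For uncountable \<open>'k\<close> the product \<open>\<sigma>\<close>-algebra of
  \<open>coin_space\<close> is smaller than \<open>borel\<close>; every Borel set is measurable for the completion
  (Kakutani), so the null Borel sets are those in the null ideal of the completion.
\<close>

definition coin_space :: "('k \<Rightarrow> bool) measure" where
  "coin_space = Pi\<^sub>M UNIV (\<lambda>_. measure_pmf (bernoulli_pmf (1/2)))"

abbreviation coin_null :: "('k \<Rightarrow> bool) set \<Rightarrow> bool" where
  "coin_null N \<equiv> N \<in> null_sets (completion coin_space)"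

lemma coin_null_subset: "coin_null N \<Longrightarrow> M \<subseteq> N \<Longrightarrow> coin_null M"
  by (rule null_sets_completion_subset)

lemma coin_null_subset2: "coin_null N \<Longrightarrow> coin_null N' \<Longrightarrow> M \<subseteq> N \<union> N' \<Longrightarrow> coin_null M"
  by (rule coin_null_subset[of "N \<union> N'"]) auto

definition ae_eq :: "('k \<Rightarrow> bool) set \<Rightarrow> ('k \<Rightarrow> bool) set \<Rightarrow> bool" where
  "ae_eq X Y \<longleftrightarrow> X \<in> sets borel \<and> Y \<in> sets borel \<and> coin_null ((X - Y) \<union> (Y - X))"

quotient_type 'k measure_algebra = "('k \<Rightarrow> bool) set" / partial: ae_eq
proof (rule part_equivpI)
  show "\<exists>X::('k \<Rightarrow> bool) set. ae_eq X X"
    by (rule exI[of _ "{}"]) (simp add: ae_eq_def)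
  show "symp (ae_eq :: ('k \<Rightarrow> bool) set \<Rightarrow> _)"
    by (rule sympI) (simp add: ae_eq_def Un_commute)
  show "transp (ae_eq :: ('k \<Rightarrow> bool) set \<Rightarrow> _)"
    by (rule transpI) (unfold ae_eq_def, blast intro: coin_null_subset2)
qed

instantiation measure_algebra :: (type) boolean_algebra
begin

lift_definition less_eq_measure_algebra :: "'a measure_algebra \<Rightarrow> 'a measure_algebra \<Rightarrow> bool"
  is "\<lambda>X Y. coin_null (X - Y)"
proof -
  have *: "coin_null (X' - Y')"
    if "ae_eq X X'" "ae_eq Y Y'" "coin_null (X - Y)" for X X' Y Y' :: "('a \<Rightarrow> bool) set"
  proof -
    have "coin_null (((X - X') \<union> (X' - X)) \<union> ((Y - Y') \<union> (Y' - Y)))"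
      using that(1,2) by (auto simp: ae_eq_def intro: null_sets.Un)
    then show ?thesis using that(3) by (rule coin_null_subset2) auto
  qed
  have sym: "ae_eq X' X" if "ae_eq X X'" for X X' :: "('a \<Rightarrow> bool) set"
    using that by (simp add: ae_eq_def Un_commute)
  show "\<And>X X' Y Y' :: ('a \<Rightarrow> bool) set. ae_eq X X' \<Longrightarrow> ae_eq Y Y' \<Longrightarrow>
      coin_null (X - Y) = coin_null (X' - Y')"
    using * sym by blast
qed

definition less_measure_algebra :: "'a measure_algebra \<Rightarrow> 'a measure_algebra \<Rightarrow> bool" where
  "less_measure_algebra x y \<longleftrightarrow> x \<le> y \<and> \<not> y \<le> x"

lift_definition inf_measure_algebra :: "'a measure_algebra \<Rightarrow> 'a measure_algebra \<Rightarrow> 'a measure_algebra"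
  is "(\<inter>)"
  by (unfold ae_eq_def) (blast intro: coin_null_subset2 sets.Int)

lift_definition sup_measure_algebra :: "'a measure_algebra \<Rightarrow> 'a measure_algebra \<Rightarrow> 'a measure_algebra"
  is "(\<union>)"
  by (unfold ae_eq_def) (blast intro: coin_null_subset2 sets.Un)

lift_definition uminus_measure_algebra :: "'a measure_algebra \<Rightarrow> 'a measure_algebra"
  is "uminus"
  by (unfold ae_eq_def) (auto intro: coin_null_subset)

lift_definition minus_measure_algebra :: "'a measure_algebra \<Rightarrow> 'a measure_algebra \<Rightarrow> 'a measure_algebra"
  is "(-)"
  by (unfold ae_eq_def) (blast intro: coin_null_subset2 sets.Diff)

lift_definition bot_measure_algebra :: "'a measure_algebra" is "{}"
  by (simp add: ae_eq_def)

lift_definition top_measure_algebra :: "'a measure_algebra" is "UNIV"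
  by (simp add: ae_eq_def)

instance
proof
  fix x y z :: "'a measure_algebra"
  show "x < y \<longleftrightarrow> x \<le> y \<and> \<not> y \<le> x" by (fact less_measure_algebra_def)
  show "x \<le> x" by transfer simp
  show "x \<le> y \<Longrightarrow> y \<le> z \<Longrightarrow> x \<le> z" by transfer (erule (1) coin_null_subset2, auto)
  show "x \<le> y \<Longrightarrow> y \<le> x \<Longrightarrow> x = y" by transfer (auto simp: ae_eq_def)
  show "inf x y \<le> x" by transfer (auto intro: coin_null_subset[of "{}"])
  show "inf x y \<le> y" by transfer (auto intro: coin_null_subset[of "{}"])
  show "x \<le> y \<Longrightarrow> x \<le> z \<Longrightarrow> x \<le> inf y z" by transfer (erule (1) coin_null_subset2, auto)
  show "x \<le> sup x y" by transfer (auto intro: coin_null_subset[of "{}"])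
  show "y \<le> sup x y" by transfer (auto intro: coin_null_subset[of "{}"])
  show "y \<le> x \<Longrightarrow> z \<le> x \<Longrightarrow> sup y z \<le> x" by transfer (erule (1) coin_null_subset2, auto)
  show "bot \<le> x" by transfer simp
  show "x \<le> top" by transfer simp
  show "sup x (inf y z) = inf (sup x y) (sup x z)"
    by transfer (auto simp: ae_eq_def Un_Int_distrib)
  show "inf x (- x) = bot" by transfer (auto simp: ae_eq_def)
  show "sup x (- x) = top" by transfer (auto simp: ae_eq_def)
  show "x - y = inf x (- y)" by transfer (auto simp: ae_eq_def Diff_eq)
qed

end

lemma coin_not_null_UNIV: "\<not> coin_null (UNIV :: ('k \<Rightarrow> bool) set)"
proof -
  interpret P: product_prob_space "\<lambda>_::'k. measure_pmf (bernoulli_pmf (1/2))" UNIV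
    by unfold_locales
  have sp: "space (coin_space :: ('k \<Rightarrow> bool) measure) = UNIV"
    by (simp add: coin_space_def space_PiM)
  have "emeasure (coin_space :: ('k \<Rightarrow> bool) measure) UNIV = 1"
    using P.P.emeasure_space_1 sp by (simp add: coin_space_def)
  moreover have "UNIV \<in> sets (coin_space :: ('k \<Rightarrow> bool) measure)"
    using sets.top[of "coin_space :: ('k \<Rightarrow> bool) measure"] sp by simp
  ultimately show ?thesis
    by (auto simp: null_sets_completion_iff)
qed

lemma measure_algebra_top_neq_bot: "(top :: 'k measure_algebra) \<noteq> bot"
  by transfer (simp add: ae_eq_def coin_not_null_UNIV)

text \<open>The forcing notion: the nonzero elements, with smaller elements being stronger conditions.\<close>

typedef 'k random = "{b :: 'k measure_algebra. b \<noteq> bot}"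
  using measure_algebra_top_neq_bot by blast

setup_lifting type_definition_random

instantiation random :: (type) order_top
begin

lift_definition less_eq_random :: "'a random \<Rightarrow> 'a random \<Rightarrow> bool" is "(\<le>)" .
lift_definition less_random :: "'a random \<Rightarrow> 'a random \<Rightarrow> bool" is "(<)" .
lift_definition top_random :: "'a random" is top by (rule measure_algebra_top_neq_bot)

instance
  by (standard; transfer) auto

end


section \<open>Names and the forcing relation\<close>

text \<open>
  A name is a set of pairs (name, condition) indexed by a subset of \<open>'i\<close>. So \<open>('i, 'p) name\<close> is the
  class of \<open>'p\<close>-names that are hereditarily of size at most the cardinality of \<open>'i\<close>; the ground
  model $V$ is the universe of HOL types. There is no type of all names, so \<open>'i\<close> has to be chosen
  large: once the double power set of \<open>'a \<times> 'p\<close> embeds into \<open>'i\<close>, every ultrafilter on a Boolean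
  algebra \<open>'a\<close>, every real, every real function on the Stone space and every sequence of
  finitely supported measures in $V[G]$ has a name of this type.
\<close>

datatype ('i, 'p) name = Name (branches: "'i \<Rightarrow> (('i, 'p) name \<times> 'p) option")

definition elts :: "('i, 'p) name \<Rightarrow> (('i, 'p) name \<times> 'p) set" where
  "elts \<tau> = ran (branches \<tau>)"

definition set_name :: "(('i, 'p) name \<times> 'p) set \<Rightarrow> ('i, 'p) name" where
  "set_name S = (SOME \<tau>. elts \<tau> = S)"

lemma elts_set_name:
  fixes S :: "(('i, 'p) name \<times> 'p) set" and h :: "('i, 'p) name \<times> 'p \<Rightarrow> 'i"
  assumes "inj_on h S"
  shows "elts (set_name S) = S"
proof -
  define F where "F = (\<lambda>i. if i \<in> h ` S then Some (inv_into S h i) else None)"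
  have "ran F = S"
  proof (intro set_eqI iffI)
    fix x assume "x \<in> ran F"
    then show "x \<in> S" by (auto simp: F_def ran_def inv_into_into split: if_splits)
  next
    fix x assume "x \<in> S"
    then have "F (h x) = Some x" using assms by (simp add: F_def)
    then show "x \<in> ran F" by (rule ranI)
  qed
  then have "elts (Name F) = S" by (simp add: elts_def)
  then show ?thesis unfolding set_name_def by (rule someI)
qed

lemma wf_elts: "wf {(\<sigma>, \<tau>). \<exists>s. (\<sigma>, s) \<in> elts \<tau>}"
proof (rule wfUNIVI)
  fix P :: "('i, 'p) name \<Rightarrow> bool" and \<tau>
  assume IH: "\<forall>\<tau>. (\<forall>\<sigma>. (\<sigma>, \<tau>) \<in> {(\<sigma>, \<tau>). \<exists>s. (\<sigma>, s) \<in> elts \<tau>} \<longrightarrow> P \<sigma>) \<longrightarrow> P \<tau>"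
  show "P \<tau>"
  proof (induction \<tau>)
    case (Name F)
    have "P \<sigma>" if "(\<sigma>, s) \<in> elts (Name F)" for \<sigma> s
    proof -
      from that obtain i where "F i = Some (\<sigma>, s)" by (auto simp: elts_def ran_def)
      then have "Some (\<sigma>, s) \<in> range F" by (metis rangeI)
      then show ?thesis
        by (rule Name[of _ "(\<sigma>, s)" \<sigma>]) (auto simp: fsts.simps)
    qed
    then show ?case using IH by blast
  qed
qed

text \<open>
  Formulas of the forcing language are shallowly embedded: a formula is identified with the set of
  conditions forcing it. The clauses are the usual ones of the recursive definition of the forcing
  relation for atomic formulas, conjunction, negation and universal quantification; the other
  connectives are classical abbreviations.
\<close>

type_synonym 'p formula = "'p \<Rightarrow> bool"

function forces_eq :: "('i, 'p::order) name \<Rightarrow> ('i, 'p) name \<Rightarrow> 'p formula" (infix "\<^bold>=" 70) where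
  "(\<sigma> \<^bold>= \<tau>) p \<longleftrightarrow>
     (\<forall>(\<sigma>', s) \<in> elts \<sigma>. \<forall>q. q \<le> p \<and> q \<le> s \<longrightarrow>
        (\<exists>r. r \<le> q \<and> (\<exists>(\<tau>', t) \<in> elts \<tau>. r \<le> t \<and> (\<sigma>' \<^bold>= \<tau>') r))) \<and>
     (\<forall>(\<tau>', t) \<in> elts \<tau>. \<forall>q. q \<le> p \<and> q \<le> t \<longrightarrow>
        (\<exists>r. r \<le> q \<and> (\<exists>(\<sigma>', s) \<in> elts \<sigma>. r \<le> s \<and> (\<sigma>' \<^bold>= \<tau>') r)))"
  by pat_completeness auto
termination
  by (relation "inv_image {(\<sigma>, \<tau>). \<exists>s. (\<sigma>, s) \<in> elts \<tau>} fst") (auto intro: wf_elts)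

declare forces_eq.simps [simp del]

definition forces_mem :: "('i, 'p::order) name \<Rightarrow> ('i, 'p) name \<Rightarrow> 'p formula" (infix "\<^bold>\<in>" 70) where
  "(\<sigma> \<^bold>\<in> \<tau>) p \<longleftrightarrow>
     (\<forall>q \<le> p. \<exists>r \<le> q. \<exists>(\<tau>', t) \<in> elts \<tau>. r \<le> t \<and> (\<sigma> \<^bold>= \<tau>') r)"

definition forces_and :: "'p formula \<Rightarrow> 'p formula \<Rightarrow> 'p formula" (infixr "\<^bold>\<and>" 35) where
  "(\<phi> \<^bold>\<and> \<psi>) p \<longleftrightarrow> \<phi> p \<and> \<psi> p"

definition forces_not :: "'p::order formula \<Rightarrow> 'p formula" ("\<^bold>\<not> _" [40] 40) where
  "(\<^bold>\<not> \<phi>) p \<longleftrightarrow> (\<forall>q \<le> p. \<not> \<phi> q)"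

text \<open>
  Quantifiers are polymorphic. At type \<open>name\<close> they range over $V[G]$. At a ground type such as
  \<open>nat\<close>, \<open>rat\<close> or the Boolean algebra \<open>'a\<close> they are the bounded quantifiers over the corresponding
  set of $V$. At type \<open>(name \<times> name) list\<close> they range over the finite sequences of pairs in $V[G]$.
\<close>

definition forces_all :: "('x \<Rightarrow> 'p formula) \<Rightarrow> 'p formula" (binder "\<^bold>\<forall>" 10) where
  "(\<^bold>\<forall>x. \<phi> x) p \<longleftrightarrow> (\<forall>x. \<phi> x p)"

abbreviation forces_or :: "'p::order formula \<Rightarrow> 'p formula \<Rightarrow> 'p formula" (infixr "\<^bold>\<or>" 30) where
  "\<phi> \<^bold>\<or> \<psi> \<equiv> \<^bold>\<not> ((\<^bold>\<not> \<phi>) \<^bold>\<and> (\<^bold>\<not> \<psi>))"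

abbreviation forces_imp :: "'p::order formula \<Rightarrow> 'p formula \<Rightarrow> 'p formula" (infixr "\<^bold>\<longrightarrow>" 25) where
  "\<phi> \<^bold>\<longrightarrow> \<psi> \<equiv> \<^bold>\<not> (\<phi> \<^bold>\<and> (\<^bold>\<not> \<psi>))"

abbreviation forces_iff :: "'p::order formula \<Rightarrow> 'p formula \<Rightarrow> 'p formula" (infixr "\<^bold>\<longleftrightarrow>" 25) where
  "\<phi> \<^bold>\<longleftrightarrow> \<psi> \<equiv> (\<phi> \<^bold>\<longrightarrow> \<psi>) \<^bold>\<and> (\<psi> \<^bold>\<longrightarrow> \<phi>)"

abbreviation forces_ex :: "('x \<Rightarrow> 'p::order formula) \<Rightarrow> 'p formula" (binder "\<^bold>\<exists>" 10) where
  "\<^bold>\<exists>x. \<phi> x \<equiv> \<^bold>\<not> (\<^bold>\<forall>x. \<^bold>\<not> \<phi> x)"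

text \<open>A fact about objects of the ground model, absolute between $V$ and $V[G]$.\<close>

definition ground :: "bool \<Rightarrow> 'p formula" where
  "ground P p \<longleftrightarrow> P"

text \<open>
  Truth in $V[G]$ for every generic $G$ is being forced by every condition.
\<close>

definition forced :: "'p formula \<Rightarrow> bool" where
  "forced \<phi> \<longleftrightarrow> (\<forall>p. \<phi> p)"

text \<open>The canonical (check) names of the sets of the ground model.\<close>

inductive check_name :: "('i, 'p::order_top) name \<Rightarrow> bool" where
  "(\<And>\<sigma> s. (\<sigma>, s) \<in> elts \<tau> \<Longrightarrow> s = top) \<Longrightarrow> (\<And>\<sigma> s. (\<sigma>, s) \<in> elts \<tau> \<Longrightarrow> check_name \<sigma>)
    \<Longrightarrow> check_name \<tau>"

text \<open>
  An injection of a ground type into $V$, each value being given by its check name.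
\<close>

definition ground_coding :: "('a \<Rightarrow> ('i, 'p::order_top) name) \<Rightarrow> bool" where
  "ground_coding e \<longleftrightarrow> (\<forall>a. check_name (e a)) \<and> (\<forall>a b. forced (e a \<^bold>= e b) \<longrightarrow> a = b)"


section \<open>Set theory in the forcing language\<close>

primrec nat_name :: "nat \<Rightarrow> ('i, 'p::order_top) name" where
  "nat_name 0 = set_name {}"
| "nat_name (Suc n) = set_name (insert (nat_name n, top) (elts (nat_name n)))"

definition is_nat :: "('i, 'p::order_top) name \<Rightarrow> 'p formula" where
  "is_nat x = (\<^bold>\<exists>n. x \<^bold>= nat_name n)"

definition is_upair :: "('i, 'p::order) name \<Rightarrow> ('i, 'p) name \<Rightarrow> ('i, 'p) name \<Rightarrow> 'p formula" where
  "is_upair z x y = (\<^bold>\<forall>w. w \<^bold>\<in> z \<^bold>\<longleftrightarrow> w \<^bold>= x \<^bold>\<or> w \<^bold>= y)"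

definition is_pair :: "('i, 'p::order) name \<Rightarrow> ('i, 'p) name \<Rightarrow> ('i, 'p) name \<Rightarrow> 'p formula" where
  "is_pair z x y = (\<^bold>\<exists>u v. is_upair u x x \<^bold>\<and> is_upair v x y \<^bold>\<and> is_upair z u v)"

definition app :: "('i, 'p::order) name \<Rightarrow> ('i, 'p) name \<Rightarrow> ('i, 'p) name \<Rightarrow> 'p formula" where
  "app f x y = (\<^bold>\<exists>z. is_pair z x y \<^bold>\<and> z \<^bold>\<in> f)"

definition is_function ::
  "('i, 'p::order) name \<Rightarrow> (('i, 'p) name \<Rightarrow> 'p formula) \<Rightarrow> (('i, 'p) name \<Rightarrow> 'p formula) \<Rightarrow> 'p formula"
where
  "is_function f X Y =
     ((\<^bold>\<forall>z. z \<^bold>\<in> f \<^bold>\<longrightarrow> (\<^bold>\<exists>x y. X x \<^bold>\<and> Y y \<^bold>\<and> is_pair z x y)) \<^bold>\<and>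
      (\<^bold>\<forall>x. X x \<^bold>\<longrightarrow> (\<^bold>\<exists>y. app f x y)) \<^bold>\<and>
      (\<^bold>\<forall>x y y'. app f x y \<^bold>\<and> app f x y' \<^bold>\<longrightarrow> y \<^bold>= y'))"


subsection \<open>Real numbers\<close>

text \<open>
  The rationals are the ground model copy of $\mathbf{Q}$ on $\omega$ given by an enumeration. Reals
  are lower Dedekind cuts, so \<open>rat_name q \<^bold>\<in> x\<close> says $q < x$.
\<close>

definition rat_name :: "rat \<Rightarrow> ('i, 'p::order_top) name" where
  "rat_name q = nat_name (to_nat q)"

definition is_real :: "('i, 'p::order_top) name \<Rightarrow> 'p formula" where
  "is_real x =
     ((\<^bold>\<forall>y. y \<^bold>\<in> x \<^bold>\<longrightarrow> (\<^bold>\<exists>q. y \<^bold>= rat_name q)) \<^bold>\<and>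
      (\<^bold>\<exists>q. rat_name q \<^bold>\<in> x) \<^bold>\<and>
      (\<^bold>\<exists>q. \<^bold>\<not> (rat_name q \<^bold>\<in> x)) \<^bold>\<and>
      (\<^bold>\<forall>q r. rat_name r \<^bold>\<in> x \<^bold>\<and> ground (q < r) \<^bold>\<longrightarrow> rat_name q \<^bold>\<in> x) \<^bold>\<and>
      (\<^bold>\<forall>q. rat_name q \<^bold>\<in> x \<^bold>\<longrightarrow> (\<^bold>\<exists>r. ground (q < r) \<^bold>\<and> rat_name r \<^bold>\<in> x)))"

definition less_rat :: "('i, 'p::order_top) name \<Rightarrow> rat \<Rightarrow> 'p formula" where
  "less_rat x q = (\<^bold>\<exists>r. ground (r < q) \<^bold>\<and> (\<^bold>\<not> (rat_name r \<^bold>\<in> x)))"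

definition eq_rat :: "('i, 'p::order_top) name \<Rightarrow> rat \<Rightarrow> 'p formula" where
  "eq_rat x q = (is_real x \<^bold>\<and> (\<^bold>\<forall>r. rat_name r \<^bold>\<in> x \<^bold>\<longleftrightarrow> ground (r < q)))"

definition is_add :: "('i, 'p::order_top) name \<Rightarrow> ('i, 'p) name \<Rightarrow> ('i, 'p) name \<Rightarrow> 'p formula" where
  "is_add z x y = (is_real z \<^bold>\<and>
     (\<^bold>\<forall>q. rat_name q \<^bold>\<in> z \<^bold>\<longleftrightarrow>
        (\<^bold>\<exists>r s. rat_name r \<^bold>\<in> x \<^bold>\<and> rat_name s \<^bold>\<in> y \<^bold>\<and> ground (q = r + s))))"

text \<open>
  Multiplication by interval arithmetic: $q < xy$ iff there are rationals $a < x < b$ and $c < y < d$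
  with $q < \min(ac, ad, bc, bd)$.
\<close>

definition is_mult :: "('i, 'p::order_top) name \<Rightarrow> ('i, 'p) name \<Rightarrow> ('i, 'p) name \<Rightarrow> 'p formula" where
  "is_mult z x y = (is_real z \<^bold>\<and>
     (\<^bold>\<forall>q. rat_name q \<^bold>\<in> z \<^bold>\<longleftrightarrow>
        (\<^bold>\<exists>a b c d. rat_name a \<^bold>\<in> x \<^bold>\<and> less_rat x b \<^bold>\<and> rat_name c \<^bold>\<in> y \<^bold>\<and> less_rat y d \<^bold>\<and>
           ground (q < Min {a * c, a * d, b * c, b * d}))))"

text \<open>As a lower cut, $|x| = \max(x, -x)$ is the union of $x$ and $-x$.\<close>

definition is_abs :: "('i, 'p::order_top) name \<Rightarrow> ('i, 'p) name \<Rightarrow> 'p formula" where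
  "is_abs z x = (is_real z \<^bold>\<and>
     (\<^bold>\<forall>q. rat_name q \<^bold>\<in> z \<^bold>\<longleftrightarrow> rat_name q \<^bold>\<in> x \<^bold>\<or> less_rat x (- q)))"

definition dist_less :: "('i, 'p::order_top) name \<Rightarrow> ('i, 'p) name \<Rightarrow> rat \<Rightarrow> 'p formula" where
  "dist_less x y \<epsilon> = (\<^bold>\<exists>d m. is_real d \<^bold>\<and> is_add x y d \<^bold>\<and> is_abs m d \<^bold>\<and> less_rat m \<epsilon>)"


section \<open>The Stone space computed in the extension\<close>

definition sigma_complete :: "'a::boolean_algebra itself \<Rightarrow> bool" where
  "sigma_complete _ \<longleftrightarrow>
     (\<forall>X :: 'a set. countable X \<longrightarrow> (\<exists>s. (\<forall>x\<in>X. x \<le> s) \<and> (\<forall>t. (\<forall>x\<in>X. x \<le> t) \<longrightarrow> s \<le> t)))"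

text \<open>
  The Boolean algebra is a ground model type \<open>'a\<close>, realised as a set of $V$ by a coding \<open>e\<close>. The
  points of its Stone space are the ultrafilters in the extension; the sets of points containing a
  given \<open>a :: 'a\<close> form the base of the topology.
\<close>

definition is_point :: "('a::boolean_algebra \<Rightarrow> ('i, 'p::order_top) name) \<Rightarrow> ('i, 'p) name \<Rightarrow> 'p formula"
where
  "is_point e U =
     ((\<^bold>\<forall>x. x \<^bold>\<in> U \<^bold>\<longrightarrow> (\<^bold>\<exists>a. x \<^bold>= e a)) \<^bold>\<and>
      e top \<^bold>\<in> U \<^bold>\<and>
      (\<^bold>\<not> (e bot \<^bold>\<in> U)) \<^bold>\<and>
      (\<^bold>\<forall>a b. e a \<^bold>\<in> U \<^bold>\<and> e b \<^bold>\<in> U \<^bold>\<longrightarrow> e (inf a b) \<^bold>\<in> U) \<^bold>\<and>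
      (\<^bold>\<forall>a b. e a \<^bold>\<in> U \<^bold>\<and> ground (a \<le> b) \<^bold>\<longrightarrow> e b \<^bold>\<in> U) \<^bold>\<and>
      (\<^bold>\<forall>a. e a \<^bold>\<in> U \<^bold>\<or> e (- a) \<^bold>\<in> U))"

definition is_continuous ::
  "('a::boolean_algebra \<Rightarrow> ('i, 'p::order_top) name) \<Rightarrow> ('i, 'p) name \<Rightarrow> 'p formula"
where
  "is_continuous e f =
     (is_function f (is_point e) is_real \<^bold>\<and>
      (\<^bold>\<forall>x u \<epsilon>. is_point e x \<^bold>\<and> app f x u \<^bold>\<and> ground (0 < \<epsilon>) \<^bold>\<longrightarrow>
         (\<^bold>\<exists>a. e a \<^bold>\<in> x \<^bold>\<and>
            (\<^bold>\<forall>y v. is_point e y \<^bold>\<and> e a \<^bold>\<in> y \<^bold>\<and> app f y v \<^bold>\<longrightarrow> dist_less v u \<epsilon>))))"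


section \<open>Finitely supported measures in the extension\<close>

text \<open>
  The measure $\sum_{i} \alpha_i \delta_{x_i}$ with distinct $x_i$ and nonzero $\alpha_i$ is
  the finite function $\{(x_i, \alpha_i)\}$, whose domain is the support. The formula
  \<open>is_measure_list e m l\<close> says that \<open>l\<close> lists the pairs $(x_i, \alpha_i)$ without repetition.
\<close>

primrec is_pair_in :: "('i, 'p::order) name \<Rightarrow> (('i, 'p) name \<times> ('i, 'p) name) list \<Rightarrow> 'p formula" where
  "is_pair_in z [] = ground False"
| "is_pair_in z (xa # l) = (is_pair z (fst xa) (snd xa) \<^bold>\<or> is_pair_in z l)"

primrec not_among :: "('i, 'p::order) name \<Rightarrow> (('i, 'p) name \<times> ('i, 'p) name) list \<Rightarrow> 'p formula" where
  "not_among x [] = ground True"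
| "not_among x (yb # l) = ((\<^bold>\<not> (x \<^bold>= fst yb)) \<^bold>\<and> not_among x l)"

primrec is_weight_list ::
  "('a::boolean_algebra \<Rightarrow> ('i, 'p::order_top) name) \<Rightarrow> (('i, 'p) name \<times> ('i, 'p) name) list \<Rightarrow> 'p formula"
where
  "is_weight_list e [] = ground True"
| "is_weight_list e (xa # l) =
     (is_point e (fst xa) \<^bold>\<and> is_real (snd xa) \<^bold>\<and> (\<^bold>\<not> eq_rat (snd xa) 0) \<^bold>\<and>
      not_among (fst xa) l \<^bold>\<and> is_weight_list e l)"

definition is_measure_list ::
  "('a::boolean_algebra \<Rightarrow> ('i, 'p::order_top) name) \<Rightarrow> ('i, 'p) name \<Rightarrow>
   (('i, 'p) name \<times> ('i, 'p) name) list \<Rightarrow> 'p formula"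
where
  "is_measure_list e m l = (is_weight_list e l \<^bold>\<and> (\<^bold>\<forall>z. z \<^bold>\<in> m \<^bold>\<longleftrightarrow> is_pair_in z l))"

definition is_fs_measure ::
  "('a::boolean_algebra \<Rightarrow> ('i, 'p::order_top) name) \<Rightarrow> ('i, 'p) name \<Rightarrow> 'p formula"
where
  "is_fs_measure e m = (\<^bold>\<exists>l. is_measure_list e m l)"

definition supp_card_le ::
  "('a::boolean_algebra \<Rightarrow> ('i, 'p::order_top) name) \<Rightarrow> ('i, 'p) name \<Rightarrow> nat \<Rightarrow> 'p formula"
where
  "supp_card_le e m M = (\<^bold>\<exists>l. is_measure_list e m l \<^bold>\<and> ground (length l \<le> M))"

primrec is_abs_sum :: "(('i, 'p::order_top) name \<times> ('i, 'p) name) list \<Rightarrow> ('i, 'p) name \<Rightarrow> 'p formula" where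
  "is_abs_sum [] r = eq_rat r 0"
| "is_abs_sum (xa # l) r = (\<^bold>\<exists>t s. is_abs t (snd xa) \<^bold>\<and> is_abs_sum l s \<^bold>\<and> is_add r t s)"

text \<open>The total variation norm $\sum_i |\alpha_i|$.\<close>

definition is_norm ::
  "('a::boolean_algebra \<Rightarrow> ('i, 'p::order_top) name) \<Rightarrow> ('i, 'p) name \<Rightarrow> ('i, 'p) name \<Rightarrow> 'p formula"
where
  "is_norm e m r = (\<^bold>\<exists>l. is_measure_list e m l \<^bold>\<and> is_abs_sum l r)"

primrec is_weighted_sum ::
  "('i, 'p::order_top) name \<Rightarrow> (('i, 'p) name \<times> ('i, 'p) name) list \<Rightarrow> ('i, 'p) name \<Rightarrow> 'p formula"
where
  "is_weighted_sum f [] r = eq_rat r 0"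
| "is_weighted_sum f (xa # l) r =
     (\<^bold>\<exists>y t s. app f (fst xa) y \<^bold>\<and> is_mult t (snd xa) y \<^bold>\<and> is_weighted_sum f l s \<^bold>\<and> is_add r t s)"

text \<open>The integral $\int f \, dm = \sum_i \alpha_i f(x_i)$.\<close>

definition is_integral ::
  "('a::boolean_algebra \<Rightarrow> ('i, 'p::order_top) name) \<Rightarrow> ('i, 'p) name \<Rightarrow> ('i, 'p) name \<Rightarrow> ('i, 'p) name \<Rightarrow>
   'p formula"
where
  "is_integral e f m r = (\<^bold>\<exists>l. is_measure_list e m l \<^bold>\<and> is_weighted_sum f l r)"

definition is_measure_seq ::
  "('a::boolean_algebra \<Rightarrow> ('i, 'p::order_top) name) \<Rightarrow> ('i, 'p) name \<Rightarrow> 'p formula"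
where
  "is_measure_seq e \<mu> = is_function \<mu> is_nat (is_fs_measure e)"

definition weak_star_null ::
  "('a::boolean_algebra \<Rightarrow> ('i, 'p::order_top) name) \<Rightarrow> ('i, 'p) name \<Rightarrow> 'p formula"
where
  "weak_star_null e \<mu> =
     (\<^bold>\<forall>f \<epsilon>. is_continuous e f \<^bold>\<and> ground (0 < \<epsilon>) \<^bold>\<longrightarrow>
        (\<^bold>\<exists>N. \<^bold>\<forall>n. ground (N \<le> n) \<^bold>\<longrightarrow>
           (\<^bold>\<exists>m r s. app \<mu> (nat_name n) m \<^bold>\<and> is_integral e f m r \<^bold>\<and> is_abs s r \<^bold>\<and> less_rat s \<epsilon>)))"

definition all_norm_one ::
  "('a::boolean_algebra \<Rightarrow> ('i, 'p::order_top) name) \<Rightarrow> ('i, 'p) name \<Rightarrow> 'p formula"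
where
  "all_norm_one e \<mu> =
     (\<^bold>\<forall>n. \<^bold>\<exists>m r. app \<mu> (nat_name n) m \<^bold>\<and> is_norm e m r \<^bold>\<and> eq_rat r 1)"

definition bounded_supports ::
  "('a::boolean_algebra \<Rightarrow> ('i, 'p::order_top) name) \<Rightarrow> ('i, 'p) name \<Rightarrow> 'p formula"
where
  "bounded_supports e \<mu> =
     (\<^bold>\<exists>M. \<^bold>\<forall>n. \<^bold>\<exists>m. app \<mu> (nat_name n) m \<^bold>\<and> supp_card_le e m M)"

end

theory Submission
  imports Defs
begin

text \<open>
  A point of the Stone space in the extension is an a.e. homomorphism of the algebra into the measure
  algebra, so a sequence of measures forced to be a counterexample becomes, in the ground model, a sequence
  of random measures with at most \<open>M\<close> atoms and norm one that tends to zero almost surely on every element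
  of the algebra. Countably many elements separate the atoms of each measure, which places the atoms in the
  Cantor space. A random clopen set \<open>E\<close> containing every short cylinder independently with small probability
  \<open>\<epsilon>\<close> has two properties: it is unlikely to meet the supports of almost all measures, but since infinitely
  many different points carry weight bounded below, it is likely to contain exactly one atom, and a heavy
  one, of some later measure. Hence one finds clopen sets \<open>E\<^sub>k\<close> such that, with probability bounded below, some
  measure of index at least \<open>k\<close> lives off \<open>E\<^sub>0, \<dots>, E\<^sub>k\<^sub>-\<^sub>1\<close> and has large absolute value on \<open>E\<^sub>k\<close>. Make the \<open>E\<^sub>k\<close>
  disjoint and thin out the sequence so that the supremum of the later ones is negligible for the earlier
  measures. Then the supremum of the remaining \<open>E\<^sub>k\<close>, which exists by \<open>\<sigma>\<close>-completeness, contradicts the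
  almost sure convergence.
\<close>

section \<open>Borel sets and the completed product measure\<close>

text \<open>Only countably many null sets can be discarded, while names and elements of the algebra
  form uncountable families. So a formula is evaluated pointwise only where its quantifiers run over
  countable types; everything else is argued at conditions, by density, and made countable by
  \<open>countable_exhaustion\<close>, the countable chain condition of the measure algebra. The
  same obstacle shapes the combinatorics: the null set off which the integrals of \<open>a\<close>
  converge depends on \<open>a\<close>, so the element that refutes convergence must be one fixed
  element of the ground model and cannot be picked from the random sequence point by point. Hence
  the clopen sets are deterministic and succeed only with probability bounded below. The constants
  record what is left of that probability: a random set succeeds with chance 1/8 at each good point,
  good points have probability at least 1/2, half of the resulting 1/16 pays for keeping the trap
  small, and half of the remaining 1/32 pays for the supremum of the later sets, leaving
  1/64.\<close>

lemma (in finite_measure) countable_exhaustion: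
  assumes f: "\<And>i. i \<in> I \<Longrightarrow> f i \<in> sets M"
  shows "\<exists>J\<subseteq>I. countable J \<and> (\<forall>i\<in>I. f i - (\<Union>j\<in>J. f j) \<in> null_sets M)"
proof -
  define S where "S = {measure M (\<Union>j\<in>J. f j) | J. J \<subseteq> I \<and> countable J}"
  define s where "s = Sup S"
  have ne: "S \<noteq> {}" unfolding S_def by blast
  have bdd: "bdd_above S"
    by (rule bdd_aboveI[of _ "measure M (space M)"]) (auto simp: S_def bounded_measure)
  have "\<exists>J\<subseteq>I. countable J \<and> s - 1 / real (Suc n) < measure M (\<Union>j\<in>J. f j)" for n
  proof -
    have "\<exists>y\<in>S. s - 1 / real (Suc n) < y"
      using less_cSup_iff[OF ne bdd, of "s - 1 / real (Suc n)"] by (simp add: s_def)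
    then show ?thesis unfolding S_def by blast
  qed
  then obtain Js where Js: "\<And>n. Js n \<subseteq> I" "\<And>n. countable (Js n)"
    "\<And>n. s - 1 / real (Suc n) < measure M (\<Union>j\<in>Js n. f j)" by metis
  define J where "J = (\<Union>n. Js n)"
  have J: "J \<subseteq> I" "countable J" using Js by (auto simp: J_def)
  have meas: "(\<Union>j\<in>K. f j) \<in> sets M" if "K \<subseteq> I" "countable K" for K
    using that f by (intro sets.countable_UN'') auto
  \<comment> \<open>The union over \<open>Js n\<close> comes within 1/(n+1) of the supremum
    \<open>s\<close>, so the union over all of them attains it. A set \<open>f i\<close> with a part
    of positive measure outside that union would push some countable union above
    \<open>s\<close>.\<close>
  have ge: "s \<le> measure M (\<Union>j\<in>J. f j)"
  proof (rule field_le_epsilon)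
    fix e :: real assume "e > 0"
    then obtain n where n: "1 / real (Suc n) < e" using nat_approx_posE by blast
    have "s < measure M (\<Union>j\<in>Js n. f j) + 1 / real (Suc n)" using Js(3)[of n] by simp
    also have "measure M (\<Union>j\<in>Js n. f j) \<le> measure M (\<Union>j\<in>J. f j)"
      by (rule finite_measure_mono[OF _ meas[OF J]]) (auto simp: J_def)
    finally show "s \<le> measure M (\<Union>j\<in>J. f j) + e" using n by simp
  qed
  have "f i - (\<Union>j\<in>J. f j) \<in> null_sets M" if i: "i \<in> I" for i
  proof -
    let ?U = "\<Union>j\<in>J. f j"
    have "measure M (\<Union>j\<in>insert i J. f j) \<in> S" unfolding S_def using J i by blast
    then have le: "measure M (\<Union>j\<in>insert i J. f j) \<le> s" unfolding s_def by (rule cSup_upper[OF _ bdd])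
    have eq: "(\<Union>j\<in>insert i J. f j) = ?U \<union> (f i - ?U)" by auto
    have "measure M (\<Union>j\<in>insert i J. f j) = measure M ?U + measure M (f i - ?U)"
      unfolding eq by (rule finite_measure_Union) (use meas[OF J] f[OF i] in auto)
    then have "measure M (f i - ?U) = 0" using le ge measure_nonneg[of M "f i - ?U"] by linarith
    then show ?thesis using meas[OF J] f[OF i] by (simp add: null_setsI emeasure_eq_measure)
  qed
  then show ?thesis using J by blast
qed

interpretation coin: product_prob_space "\<lambda>_::'k. measure_pmf (bernoulli_pmf (1/2))" UNIV
  by unfold_locales

lemma prob_space_coin: "prob_space (coin_space :: ('k \<Rightarrow> bool) measure)"
  unfolding coin_space_def by (rule prob_space_PiM) (rule measure_pmf.prob_space_axioms)

lemma space_coin [simp]: "space (coin_space :: ('k \<Rightarrow> bool) measure) = UNIV"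
  by (simp add: coin_space_def space_PiM)

section \<open>Coordinate flips preserve the coin-tossing measure\<close>

definition flip :: "'k \<Rightarrow> ('k \<Rightarrow> bool) \<Rightarrow> ('k \<Rightarrow> bool)" where
  "flip i w = w(i := \<not> w i)"

lemma measurable_flip [measurable]: "flip i \<in> measurable coin_space coin_space"
proof -
  have "(\<lambda>w j. if j = i then \<not> w j else w j) \<in> measurable coin_space (coin_space :: ('a \<Rightarrow> bool) measure)"
    unfolding coin_space_def
  proof (rule measurable_PiM_single')
    fix j :: 'a
    have "(\<lambda>w. w j) \<in> measurable (Pi\<^sub>M UNIV (\<lambda>_. measure_pmf (bernoulli_pmf (1 / 2)))) (count_space UNIV)"
      using measurable_component_singleton[of j UNIV "\<lambda>_. measure_pmf (bernoulli_pmf (1 / 2))"] by simp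
    from measurable_compose[OF this, of "\<lambda>b. if j = i then \<not> b else b"]
    show "(\<lambda>w. if j = i then \<not> w j else w j) \<in> Pi\<^sub>M UNIV (\<lambda>_. measure_pmf (bernoulli_pmf (1 / 2))) \<rightarrow>\<^sub>M measure_pmf (bernoulli_pmf (1 / 2))"
      by simp
  qed auto
  moreover have "flip i = (\<lambda>w j. if j = i then \<not> w j else w j)" by (auto simp: flip_def fun_eq_iff)
  ultimately show ?thesis by simp
qed

lemma bernoulli_half_not:
  "emeasure (measure_pmf (bernoulli_pmf (1/2))) (Not -` F) = emeasure (measure_pmf (bernoulli_pmf (1/2))) F"
proof -
  have "map_pmf Not (bernoulli_pmf (1/2)) = bernoulli_pmf (1/2)"
  proof (rule pmf_eqI)
    fix b
    have "Not -` {b} = {\<not> b}" by auto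
    then show "pmf (map_pmf Not (bernoulli_pmf (1/2))) b = pmf (bernoulli_pmf (1/2)) b"
      by (cases b) (simp_all add: pmf_map measure_pmf_single)
  qed
  then show ?thesis by (metis emeasure_map_pmf)
qed

text \<open>A measure on the product is determined by finite-dimensional boxes. The preimage of a
  box under \<open>flip i\<close> is the box whose side at \<open>i\<close> is negated, and negation
  preserves the fair coin.\<close>

lemma distr_flip: "distr coin_space coin_space (flip i) = coin_space"
  unfolding coin_space_def
proof (rule coin.PiM_eq)
  fix J :: "'a set" and F :: "'a \<Rightarrow> bool set"
  assume J: "finite J"
  let ?M = "\<lambda>_::'a. measure_pmf (bernoulli_pmf (1/2))"
  define G where "G = (\<lambda>j. if j = i then Not -` F j else F j)"
  have eq: "flip i -` prod_emb UNIV ?M J (Pi\<^sub>E J F) = prod_emb UNIV ?M J (Pi\<^sub>E J G)"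
    by (fastforce simp: prod_emb_def flip_def G_def PiE_iff split: if_splits)
  have "emeasure (distr (Pi\<^sub>M UNIV ?M) (Pi\<^sub>M UNIV ?M) (flip i)) (prod_emb UNIV ?M J (Pi\<^sub>E J F))
     = emeasure (Pi\<^sub>M UNIV ?M) (flip i -` prod_emb UNIV ?M J (Pi\<^sub>E J F) \<inter> space (Pi\<^sub>M UNIV ?M))"
    by (rule emeasure_distr) (use measurable_flip[of i] J in \<open>auto simp: coin_space_def intro!: sets_PiM_I\<close>)
  also have "\<dots> = emeasure (Pi\<^sub>M UNIV ?M) (prod_emb UNIV ?M J (Pi\<^sub>E J G))"
    unfolding eq by (simp add: space_PiM)
  also have "\<dots> = (\<Prod>j\<in>J. emeasure (?M j) (G j))"
    by (rule coin.emeasure_PiM_emb) (use J in auto)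
  also have "\<dots> = (\<Prod>j\<in>J. emeasure (?M j) (F j))"
    by (rule prod.cong) (auto simp: G_def bernoulli_half_not)
  finally show "emeasure (distr (Pi\<^sub>M UNIV ?M) (Pi\<^sub>M UNIV ?M) (flip i)) (prod_emb UNIV ?M J (Pi\<^sub>E J F))
     = (\<Prod>j\<in>J. emeasure (?M j) (F j))" .
qed simp

section \<open>Open sets are measurable for the completed product measure\<close>

definition cyl :: "'k set \<Rightarrow> ('k \<Rightarrow> bool) \<Rightarrow> ('k \<Rightarrow> bool) set" where
  "cyl D x = {y. \<forall>i\<in>D. y i = x i}"

lemma cyl_sets: "finite D \<Longrightarrow> cyl D x \<in> sets coin_space"
proof -
  assume "finite D"
  moreover have "{w. w i = x i} \<in> sets coin_space" for i
  proof -
    have "(\<lambda>w. w i) \<in> measurable (coin_space) (count_space UNIV)"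
      using measurable_component_singleton[of i UNIV "\<lambda>_. measure_pmf (bernoulli_pmf (1 / 2))"]
      by (simp add: coin_space_def)
    from measurable_sets[OF this, of "{x i}"] show ?thesis by (simp add: vimage_def)
  qed
  moreover have "cyl D x = (\<Inter>i\<in>D. {w. w i = x i}) \<inter> space coin_space" by (auto simp: cyl_def)
  ultimately show ?thesis
    using sets.top[of coin_space] by (cases "D = {}") (auto intro!: sets.finite_INT)
qed

lemma open_contains_cyl:
  assumes "open (U :: ('k \<Rightarrow> bool) set)" "x \<in> U"
  shows "\<exists>D. finite D \<and> cyl D x \<subseteq> U"
proof -
  have "openin (product_topology (\<lambda>i. euclidean) UNIV) U" using assms by (simp add: open_fun_def)
  from product_topology_open_contains_basis[OF this assms(2)] obtain X
    where X: "x \<in> (\<Pi>\<^sub>E i\<in>UNIV. X i)" "finite {i. X i \<noteq> (UNIV::bool set)}" "(\<Pi>\<^sub>E i\<in>UNIV. X i) \<subseteq> U" by auto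
  have "cyl {i. X i \<noteq> UNIV} x \<subseteq> (\<Pi>\<^sub>E i\<in>UNIV. X i)"
  proof
    fix y assume y: "y \<in> cyl {i. X i \<noteq> UNIV} x"
    have "y i \<in> X i" for i
      using X(1) y by (cases "X i = UNIV") (auto simp: cyl_def PiE_iff)
    then show "y \<in> (\<Pi>\<^sub>E i\<in>UNIV. X i)" by auto
  qed
  with X(3) have "cyl {i. X i \<noteq> UNIV} x \<subseteq> U" by (rule order_trans[rotated])
  with X(2) show ?thesis by metis
qed

lemma null_flip: "N \<in> null_sets coin_space \<Longrightarrow> flip i -` N \<in> null_sets coin_space"
proof -
  assume N: "N \<in> null_sets coin_space"
  have "emeasure coin_space N = emeasure (distr coin_space coin_space (flip i)) N"
    by (simp add: distr_flip)
  also have "\<dots> = emeasure coin_space (flip i -` N \<inter> space coin_space)"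
    by (rule emeasure_distr) (use N in auto)
  finally have "emeasure coin_space (flip i -` N) = 0" using N by (simp add: null_sets_def)
  moreover have "flip i -` N \<in> sets coin_space"
    using measurable_sets[OF measurable_flip, of N i] N by auto
  ultimately show ?thesis by blast
qed

text \<open>A cylinder in which coordinate \<open>i\<close> has been freed is the old cylinder
  together with its mirror image under \<open>flip i\<close>. As \<open>U\<close> is invariant under
  that flip, the part outside \<open>U\<close> is a null set together with its mirror image, hence
  null. The coordinates outside \<open>C\<close> are freed one at a time.\<close>

lemma null_cyl_drop:
  assumes "finite D'" "D' \<inter> C = {}" "\<And>i. i \<notin> C \<Longrightarrow> flip i -` U = U"
    and "cyl (D \<union> D') x - U \<in> null_sets coin_space" "D \<subseteq> C"
  shows "cyl D x - U \<in> null_sets coin_space"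
  using assms
proof (induction D' rule: finite_induct)
  case (insert i D')
  let ?N = "cyl (D \<union> insert i D') x - U"
  have i: "i \<notin> C" "i \<notin> D" "i \<notin> D'" using insert by auto
  have inv: "flip i w \<in> U \<longleftrightarrow> w \<in> U" for w using insert.prems(2)[OF i(1)] by blast
  have "cyl (D \<union> D') x - U = ?N \<union> flip i -` ?N"
  proof (intro set_eqI iffI)
    fix w assume w: "w \<in> cyl (D \<union> D') x - U"
    show "w \<in> ?N \<union> flip i -` ?N"
    proof (cases "w i = x i")
      case True then show ?thesis using w by (auto simp: cyl_def)
    next
      case False
      then have "flip i w \<in> cyl (D \<union> insert i D') x" using w i by (auto simp: cyl_def flip_def)
      then show ?thesis using w inv by auto
    qed
  next
    fix w assume "w \<in> ?N \<union> flip i -` ?N"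
    then show "w \<in> cyl (D \<union> D') x - U"
    proof
      assume "w \<in> flip i -` ?N"
      then have "flip i w \<in> cyl (D \<union> insert i D') x" "w \<notin> U" using inv by auto
      moreover have "flip i w j = w j" if "j \<in> D \<union> D'" for j using that i by (auto simp: flip_def)
      ultimately show ?thesis by (auto simp: cyl_def)
    qed (auto simp: cyl_def)
  qed
  then have "cyl (D \<union> D') x - U \<in> null_sets coin_space"
    using insert.prems(3) null_flip by (metis null_sets.Un)
  then show ?case using insert by auto
qed simp

text \<open>Kakutani's theorem. A countable union of basic open subsets exhausting an open set up to measure zero
  depends on countably many coordinates; by invariance under flips of the other coordinates only
  countably many cylinders are needed to cover the rest of the open set.\<close>

lemma open_in_completion_coin:
  assumes U: "open (U :: ('k \<Rightarrow> bool) set)"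
  shows "U \<in> sets (completion coin_space)"
proof -
  interpret prob_space "coin_space :: ('k \<Rightarrow> bool) measure" by (rule prob_space_coin)
  define I where "I = {(D, x). finite D \<and> cyl D x \<subseteq> U}"
  have "\<exists>J\<subseteq>I. countable J \<and> (\<forall>i\<in>I. case_prod cyl i - (\<Union>j\<in>J. case_prod cyl j) \<in> null_sets coin_space)"
    by (rule countable_exhaustion) (auto simp: I_def cyl_sets)
  then obtain J where J: "J \<subseteq> I" "countable J"
    "\<forall>i\<in>I. case_prod cyl i - (\<Union>j\<in>J. case_prod cyl j) \<in> null_sets coin_space" by auto
  define U0 where "U0 = (\<Union>j\<in>J. case_prod cyl j)"
  define C where "C = (\<Union>j\<in>J. fst j)"
  have "countable (fst j)" if "j \<in> J" for j
  proof -
    have "j \<in> I" using J(1) that by blast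
    then show ?thesis by (cases j) (simp add: I_def countable_finite)
  qed
  then have cC: "countable C" unfolding C_def using J(2) by (intro countable_UN) auto
  have inv: "flip i -` U0 = U0" if "i \<notin> C" for i
  proof -
    have "flip i w \<in> cyl D x \<longleftrightarrow> w \<in> cyl D x" if "(D, x) \<in> J" for w D x
    proof -
      have "i \<notin> D" using that \<open>i \<notin> C\<close> by (force simp: C_def)
      then have "flip i w j = w j" if "j \<in> D" for j using that by (auto simp: flip_def)
      then show ?thesis by (simp add: cyl_def)
    qed
    then show ?thesis unfolding U0_def by fastforce
  qed
  have U0U: "U0 \<subseteq> U" using J(1) by (auto simp: U0_def I_def)
  have U0m: "U0 \<in> sets coin_space" unfolding U0_def
    by (rule sets.countable_UN'') (use J in \<open>auto simp: I_def intro: cyl_sets\<close>)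
  \<comment> \<open>The values of \<open>x\<close> on \<open>D\<close> are coded by the finite set
    \<open>A\<close> of coordinates that are true. As \<open>D\<close> and \<open>A\<close> are
    finite subsets of the countable set \<open>C\<close>, there are only countably many such
    cylinders, although \<open>x\<close> runs over an uncountable set.\<close>
  define Z where "Z = {(D, A). D \<in> {D. finite D \<and> D \<subseteq> C} \<and> A \<in> {D. finite D \<and> D \<subseteq> C} \<and> cyl D (\<lambda>i. i \<in> A) - U0 \<in> null_sets coin_space}"
  have cZ: "countable Z"
  proof (rule countable_subset)
    show "Z \<subseteq> {D. finite D \<and> D \<subseteq> C} \<times> {D. finite D \<and> D \<subseteq> C}" by (auto simp: Z_def)
    show "countable ({D. finite D \<and> D \<subseteq> C} \<times> {D. finite D \<and> D \<subseteq> C})"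
      by (intro countable_SIGMA countable_Collect_finite_subset cC)
  qed
  have nullZ: "(\<Union>(D, A)\<in>Z. cyl D (\<lambda>i. i \<in> A) - U0) \<in> null_sets coin_space"
    by (rule null_sets_UN') (use cZ in \<open>auto simp: Z_def\<close>)
  have "U - U0 \<subseteq> (\<Union>(D, A)\<in>Z. cyl D (\<lambda>i. i \<in> A) - U0)"
  proof
    fix x assume x: "x \<in> U - U0"
    then obtain D where D: "finite D" "cyl D x \<subseteq> U" using open_contains_cyl[OF U] by blast
    let ?A = "{i \<in> D \<inter> C. x i}"
    have "cyl ((D \<inter> C) \<union> (D - C)) x - U0 \<in> null_sets coin_space"
      using bspec[OF J(3), of "(D, x)"] D by (simp add: I_def U0_def Un_commute Un_Diff_Int)
    from null_cyl_drop[OF _ _ inv this] have "cyl (D \<inter> C) x - U0 \<in> null_sets coin_space" using D by auto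
    moreover have "cyl (D \<inter> C) x = cyl (D \<inter> C) (\<lambda>i. i \<in> ?A)" by (auto simp: cyl_def)
    ultimately have "(D \<inter> C, ?A) \<in> Z" using D by (auto simp: Z_def)
    moreover have "x \<in> cyl (D \<inter> C) (\<lambda>i. i \<in> ?A) - U0" using x by (auto simp: cyl_def)
    ultimately show "x \<in> (\<Union>(D, A)\<in>Z. cyl D (\<lambda>i. i \<in> A) - U0)" by blast
  qed
  \<comment> \<open>Nothing is known yet about the measurability of \<open>U - U0\<close>; it lies
    inside a null set, and this is where the completion enters.\<close>
  then have "U - U0 \<in> null_sets (completion coin_space)"
    using nullZ by (meson null_sets_completionI null_sets_completion_subset)
  then have "U0 \<union> (U - U0) \<in> sets (completion coin_space)"
    using U0m by (intro sets.Un) auto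
  then show ?thesis using U0U by (simp add: Un_absorb1)
qed

lemma borel_in_completion_coin:
  "X \<in> sets borel \<Longrightarrow> X \<in> sets (completion (coin_space :: ('k \<Rightarrow> bool) measure))"
proof -
  have "sigma_sets UNIV {S :: ('k \<Rightarrow> bool) set. open S} \<subseteq> sets (completion coin_space)"
    using sets.sigma_sets_subset[of "{S :: ('k \<Rightarrow> bool) set. open S}" "completion coin_space"]
      open_in_completion_coin by (auto simp del: sets_completion)
  then have "sets borel \<subseteq> sets (completion (coin_space :: ('k \<Rightarrow> bool) measure))"
    by (simp add: borel_def del: sets_completion)
  then show "X \<in> sets borel \<Longrightarrow> X \<in> sets (completion (coin_space :: ('k \<Rightarrow> bool) measure))" by blast
qed

section \<open>Random subsets of a finite set\<close>

text \<open>The probability of \<open>B\<close> when each point of \<open>X\<close> is selected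
  independently with probability \<epsilon>. Expectations are finite sums over \<open>Pow X\<close>,
  so that linearity exchanges them with integrals over the sample space.\<close>

definition bern :: "real \<Rightarrow> 'b set \<Rightarrow> 'b set \<Rightarrow> real" where
  "bern \<epsilon> X B = (\<Prod>x\<in>X. if x \<in> B then \<epsilon> else 1 - \<epsilon>)"

lemma bern_nonneg: "0 \<le> \<epsilon> \<Longrightarrow> \<epsilon> \<le> 1 \<Longrightarrow> 0 \<le> bern \<epsilon> X B"
  by (auto simp: bern_def intro!: prod_nonneg)

lemma sum_Pow_insert:
  assumes "finite X" "x \<notin> X"
  shows "(\<Sum>B\<in>Pow (insert x X). f B) = (\<Sum>B\<in>Pow X. f B) + (\<Sum>B\<in>Pow X. f (insert x B))"
proof -
  have "inj_on (insert x) (Pow X)" using assms(2) by (auto simp: inj_on_def)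
  moreover have "Pow X \<inter> insert x ` Pow X = {}" using assms(2) by auto
  ultimately show ?thesis
    using assms(1) by (simp add: Pow_insert sum.union_disjoint sum.reindex)
qed

lemma bern_superset:
  assumes "finite X" "Q \<subseteq> X"
  shows "(\<Sum>B\<in>Pow X. bern \<epsilon> X B * of_bool (Q \<subseteq> B)) = \<epsilon> ^ card Q"
  using assms
proof (induction X arbitrary: Q rule: finite_induct)
  case empty
  then show ?case by (simp add: bern_def)
next
  case (insert x X)
  have 1: "bern \<epsilon> (insert x X) B = (1 - \<epsilon>) * bern \<epsilon> X B" if "B \<in> Pow X" for B
    using insert that by (auto simp: bern_def)
  have 2: "bern \<epsilon> (insert x X) (insert x B) = \<epsilon> * bern \<epsilon> X B" if "B \<in> Pow X" for B
  proof -
    have "(\<Prod>y\<in>X. if y = x \<or> y \<in> B then \<epsilon> else 1 - \<epsilon>) = (\<Prod>y\<in>X. if y \<in> B then \<epsilon> else 1 - \<epsilon>)"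
      using insert.hyps by (intro prod.cong) auto
    then show ?thesis using insert.hyps by (simp add: bern_def)
  qed
  have *: "(\<Sum>B\<in>Pow (insert x X). bern \<epsilon> (insert x X) B * of_bool (Q \<subseteq> B)) =
      (1 - \<epsilon>) * (\<Sum>B\<in>Pow X. bern \<epsilon> X B * of_bool (Q \<subseteq> B)) +
      \<epsilon> * (\<Sum>B\<in>Pow X. bern \<epsilon> X B * of_bool (Q \<subseteq> insert x B))"
    unfolding sum_Pow_insert[OF insert.hyps] sum_distrib_left using 1 2
    by (intro arg_cong2[of _ _ _ _ "(+)"] sum.cong) (simp_all only: mult.assoc)
  show ?case
  proof (cases "x \<in> Q")
    case True
    have "(\<Sum>B\<in>Pow X. bern \<epsilon> X B * of_bool (Q \<subseteq> B)) = 0"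
      using True insert.hyps by (intro sum.neutral) auto
    moreover have "(Q \<subseteq> insert x B) = (Q - {x} \<subseteq> B)" for B by auto
    moreover have "(\<Sum>B\<in>Pow X. bern \<epsilon> X B * of_bool (Q - {x} \<subseteq> B)) = \<epsilon> ^ card (Q - {x})"
      using insert by (intro insert.IH) auto
    moreover have "card Q = Suc (card (Q - {x}))"
      using True insert.prems insert.hyps(1) finite_subset card_Suc_Diff1 by (metis finite_insert)
    ultimately show ?thesis unfolding * by simp
  next
    case False
    then have "(Q \<subseteq> insert x B) = (Q \<subseteq> B)" for B by auto
    moreover have "(\<Sum>B\<in>Pow X. bern \<epsilon> X B * of_bool (Q \<subseteq> B)) = \<epsilon> ^ card Q"
      using insert False by (intro insert.IH) auto
    ultimately show ?thesis unfolding * by (simp add: algebra_simps)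
  qed
qed

lemma bern_total: "finite X \<Longrightarrow> (\<Sum>B\<in>Pow X. bern \<epsilon> X B) = 1"
  using bern_superset[of X "{}" \<epsilon>] by simp

lemma bern_single: "finite X \<Longrightarrow> x \<in> X \<Longrightarrow> (\<Sum>B\<in>Pow X. bern \<epsilon> X B * of_bool (x \<in> B)) = \<epsilon>"
  using bern_superset[of X "{x}" \<epsilon>] by simp

lemma bern_pair:
  "finite X \<Longrightarrow> x \<in> X \<Longrightarrow> y \<in> X \<Longrightarrow> x \<noteq> y \<Longrightarrow>
    (\<Sum>B\<in>Pow X. bern \<epsilon> X B * (of_bool (x \<in> B) * of_bool (y \<in> B))) = \<epsilon>\<^sup>2"
  using bern_superset[of X "{x, y}" \<epsilon>] by (simp add: of_bool_conj power2_eq_square)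

lemma bern_meets:
  assumes "finite X" "Q \<subseteq> X" "card Q \<le> m" "0 \<le> \<epsilon>" "\<epsilon> \<le> 1"
  shows "(\<Sum>B\<in>Pow X. bern \<epsilon> X B * of_bool (Q \<inter> B \<noteq> {})) \<le> m * \<epsilon>"
proof -
  have fQ: "finite Q" using assms finite_subset by blast
  have "of_bool (Q \<inter> B \<noteq> {}) \<le> (\<Sum>q\<in>Q. of_bool (q \<in> B) :: real)" for B
  proof (cases "Q \<inter> B = {}")
    case False
    then obtain q where q: "q \<in> Q" "q \<in> B" by blast
    then have "of_bool (q \<in> B) \<le> (\<Sum>q\<in>Q. of_bool (q \<in> B) :: real)"
      by (intro member_le_sum fQ) auto
    then show ?thesis using q False by simp
  qed (simp add: sum_nonneg)
  then have "(\<Sum>B\<in>Pow X. bern \<epsilon> X B * of_bool (Q \<inter> B \<noteq> {}))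
      \<le> (\<Sum>B\<in>Pow X. bern \<epsilon> X B * (\<Sum>q\<in>Q. of_bool (q \<in> B)))"
    using bern_nonneg assms by (intro sum_mono mult_left_mono) auto
  also have "\<dots> = (\<Sum>q\<in>Q. \<Sum>B\<in>Pow X. bern \<epsilon> X B * of_bool (q \<in> B))"
    by (subst sum.swap) (simp add: sum_distrib_left)
  also have "\<dots> = (\<Sum>q\<in>Q. \<epsilon>)" using assms by (intro sum.cong refl bern_single) auto
  also have "\<dots> \<le> m * \<epsilon>" using assms by (simp add: mult_right_mono)
  finally show ?thesis .
qed

text \<open>Let \<open>s\<close> points of \<open>D\<close> be selected, and let \<open>A\<close> be
  those whose exception set \<open>S d\<close> is missed. A selected point outside \<open>A\<close>
  is cancelled by an element of its exception set, so the first sum is at most the size of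
  \<open>A\<close>, which is at most \<open>s\<close>; the second sum counts ordered pairs and
  equals s(s-1). Finally s - s(s-1) = 1 - (s-1)^2 is at most 1.\<close>

lemma bonferroni_pointwise:
  fixes B :: "'b set"
  assumes "finite D" "\<And>d. d \<in> D \<Longrightarrow> finite (S d)"
  shows "(\<Sum>d\<in>D. of_bool (d \<in> B) - (\<Sum>x\<in>S d. of_bool (d \<in> B) * of_bool (x \<in> B)))
      - (\<Sum>d\<in>D. \<Sum>d'\<in>D - {d}. of_bool (d \<in> B) * of_bool (d' \<in> B))
    \<le> (of_bool (\<exists>d\<in>D. d \<in> B \<and> S d \<inter> B = {}) :: real)"
proof -
  define s where "s = card (D \<inter> B)"
  define A where "A = {d \<in> D. d \<in> B \<and> S d \<inter> B = {}}"
  have fA: "finite A" "A \<subseteq> D" using assms by (auto simp: A_def)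
  have 1: "of_bool (d \<in> B) - (\<Sum>x\<in>S d. of_bool (d \<in> B) * of_bool (x \<in> B)) \<le> (of_bool (d \<in> A) :: real)"
    if d: "d \<in> D" for d
  proof (cases "d \<in> B \<and> d \<notin> A")
    case True
    then obtain x where x: "x \<in> S d" "x \<in> B" using d by (auto simp: A_def)
    then have "of_bool (x \<in> B) \<le> (\<Sum>x\<in>S d. of_bool (x \<in> B) :: real)"
      using assms(2)[OF d] by (intro member_le_sum) auto
    then show ?thesis using True x by simp
  qed (auto intro: sum_nonneg)
  have "(\<Sum>d\<in>D. of_bool (d \<in> B) - (\<Sum>x\<in>S d. of_bool (d \<in> B) * of_bool (x \<in> B))) \<le> (\<Sum>d\<in>D. of_bool (d \<in> A) :: real)"
    by (intro sum_mono 1)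
  also have "\<dots> = card A" using fA assms(1) by (simp add: Int_absorb1 of_bool_def sum.If_cases)
  finally have a: "(\<Sum>d\<in>D. of_bool (d \<in> B) - (\<Sum>x\<in>S d. of_bool (d \<in> B) * of_bool (x \<in> B))) \<le> real (card A)" .
  have 2: "(\<Sum>d'\<in>D - {d}. of_bool (d \<in> B) * of_bool (d' \<in> B)) = of_bool (d \<in> B) * (real s - 1)"
    if d: "d \<in> D" for d
  proof (cases "d \<in> B")
    case True
    have "(\<Sum>d'\<in>D. of_bool (d' \<in> B)) = real s"
      using assms(1) by (simp add: s_def of_bool_def sum.If_cases)
    moreover have "(\<Sum>d'\<in>D. of_bool (d' \<in> B)) = of_bool (d \<in> B) + (\<Sum>d'\<in>D - {d}. of_bool (d' \<in> B) :: real)"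
      by (rule sum.remove[OF assms(1) d])
    ultimately show ?thesis using True by simp
  qed simp
  have "(\<Sum>d\<in>D. \<Sum>d'\<in>D - {d}. of_bool (d \<in> B) * of_bool (d' \<in> B)) = (\<Sum>d\<in>D. of_bool (d \<in> B) * (real s - 1))"
    by (intro sum.cong 2) auto
  also have "\<dots> = real s * (real s - 1)"
    using assms(1) by (simp add: sum_distrib_right[symmetric] s_def of_bool_def sum.If_cases)
  finally have b: "(\<Sum>d\<in>D. \<Sum>d'\<in>D - {d}. of_bool (d \<in> B) * of_bool (d' \<in> B)) = real s * (real s - 1)" .
  have "card A \<le> s" unfolding s_def by (rule card_mono) (use assms in \<open>auto simp: A_def\<close>)
  then have c: "real (card A) - real s * (real s - 1) \<le> of_bool (A \<noteq> {})"
  proof (cases "A = {}")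
    case True
    then show ?thesis by (cases s) auto
  next
    case False
    then have "s \<ge> 1" using \<open>card A \<le> s\<close> fA(1) by (metis card_gt_0_iff le_trans less_eq_Suc_le One_nat_def)
    have "0 \<le> (real s - 1)\<^sup>2" by simp
    then show ?thesis using \<open>card A \<le> s\<close> False by (simp add: power2_eq_square algebra_simps)
  qed
  have "(A \<noteq> {}) = (\<exists>d\<in>D. d \<in> B \<and> S d \<inter> B = {})" by (auto simp: A_def)
  then show ?thesis using a b c by simp
qed

text \<open>With T\<epsilon> = 1/2 the expected number of selected points of \<open>D\<close> is
  1/2. The pointwise bound subtracts less than 1/4 for pairs in \<open>D\<close> and at most
  (m\<epsilon>)(T\<epsilon>) \<le> 1/8 for exceptional points. It is applied with \<open>D\<close>
  made of heavy atoms and \<open>S d\<close> of the other atoms of the same measure.\<close>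

lemma bern_hits:
  assumes X: "finite X" and D: "D \<subseteq> X" "card D = T" "T > 0" and \<epsilon>: "\<epsilon> = 1 / (2 * T)"
    and S: "\<And>d. d \<in> D \<Longrightarrow> S d \<subseteq> X" "\<And>d. d \<in> D \<Longrightarrow> d \<notin> S d" "\<And>d. d \<in> D \<Longrightarrow> card (S d) \<le> m"
    and m: "m * \<epsilon> \<le> 1 / 4"
  shows "1 / 8 \<le> (\<Sum>B\<in>Pow X. bern \<epsilon> X B * of_bool (\<exists>d\<in>D. d \<in> B \<and> S d \<inter> B = {}))"
proof -
  have fD: "finite D" using D X finite_subset by blast
  have fS: "finite (S d)" if "d \<in> D" for d using S X finite_subset that by blast
  have \<epsilon>1: "0 \<le> \<epsilon>" "\<epsilon> \<le> 1" "T * \<epsilon> = 1/2" using D(3) unfolding \<epsilon> by (auto simp: divide_simps)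
  have e1: "(\<Sum>B\<in>Pow X. bern \<epsilon> X B * (\<Sum>x\<in>S d. of_bool (d \<in> B) * of_bool (x \<in> B))) = card (S d) * \<epsilon>\<^sup>2"
    if d: "d \<in> D" for d
  proof -
    have "(\<Sum>B\<in>Pow X. bern \<epsilon> X B * (\<Sum>x\<in>S d. of_bool (d \<in> B) * of_bool (x \<in> B))) =
       (\<Sum>x\<in>S d. \<Sum>B\<in>Pow X. bern \<epsilon> X B * (of_bool (d \<in> B) * of_bool (x \<in> B)))"
      unfolding sum_distrib_left by (rule sum.swap)
    also have "\<dots> = (\<Sum>x\<in>S d. \<epsilon>\<^sup>2)"
      using d D S X by (intro sum.cong refl bern_pair) auto
    finally show ?thesis by simp
  qed
  have e2: "(\<Sum>B\<in>Pow X. bern \<epsilon> X B * (\<Sum>d'\<in>D - {d}. of_bool (d \<in> B) * of_bool (d' \<in> B))) = (real T - 1) * \<epsilon>\<^sup>2"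
    if d: "d \<in> D" for d
  proof -
    have "(\<Sum>B\<in>Pow X. bern \<epsilon> X B * (\<Sum>d'\<in>D - {d}. of_bool (d \<in> B) * of_bool (d' \<in> B))) =
       (\<Sum>d'\<in>D - {d}. \<Sum>B\<in>Pow X. bern \<epsilon> X B * (of_bool (d \<in> B) * of_bool (d' \<in> B)))"
      unfolding sum_distrib_left by (rule sum.swap)
    also have "\<dots> = (\<Sum>d'\<in>D - {d}. \<epsilon>\<^sup>2)"
      using d D X by (intro sum.cong refl bern_pair) auto
    finally show ?thesis using D d fD by (simp add: of_nat_diff Suc_leI)
  qed
  have "1 / 8 \<le> T * (\<epsilon> - m * \<epsilon>\<^sup>2) - T * ((real T - 1) * \<epsilon>\<^sup>2)"
  proof -
    have "T * (\<epsilon> - m * \<epsilon>\<^sup>2) - T * ((real T - 1) * \<epsilon>\<^sup>2) = T * \<epsilon> - (m * \<epsilon>) * (T * \<epsilon>) - (T * \<epsilon>)\<^sup>2 + (T * \<epsilon>) * \<epsilon>"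
      by (simp add: power2_eq_square algebra_simps)
    also have "\<dots> \<ge> 1/2 - 1/8 - 1/4"
      unfolding \<epsilon>1(3) using m \<epsilon>1 by (simp add: power2_eq_square algebra_simps)
    finally show ?thesis by simp
  qed
  also have "\<dots> \<le> (\<Sum>d\<in>D. \<epsilon> - card (S d) * \<epsilon>\<^sup>2) - (\<Sum>d\<in>D. (real T - 1) * \<epsilon>\<^sup>2)"
  proof -
    have "(\<Sum>d\<in>D. \<epsilon> - m * \<epsilon>\<^sup>2) \<le> (\<Sum>d\<in>D. \<epsilon> - card (S d) * \<epsilon>\<^sup>2)"
      using S(3) by (intro sum_mono diff_left_mono mult_right_mono) auto
    then show ?thesis using D by simp
  qed
  also have "\<dots> = (\<Sum>d\<in>D. (\<Sum>B\<in>Pow X. bern \<epsilon> X B * of_bool (d \<in> B)) -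
        (\<Sum>B\<in>Pow X. bern \<epsilon> X B * (\<Sum>x\<in>S d. of_bool (d \<in> B) * of_bool (x \<in> B))))
      - (\<Sum>d\<in>D. \<Sum>B\<in>Pow X. bern \<epsilon> X B * (\<Sum>d'\<in>D - {d}. of_bool (d \<in> B) * of_bool (d' \<in> B)))"
    by (intro arg_cong2[of _ _ _ _ "(-)"] sum.cong refl)
      (simp_all only: e1 e2 bern_single[OF X subsetD[OF D(1)]])
  also have "\<dots> = (\<Sum>B\<in>Pow X. bern \<epsilon> X B *
      ((\<Sum>d\<in>D. of_bool (d \<in> B) - (\<Sum>x\<in>S d. of_bool (d \<in> B) * of_bool (x \<in> B)))
      - (\<Sum>d\<in>D. \<Sum>d'\<in>D - {d}. of_bool (d \<in> B) * of_bool (d' \<in> B))))"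
    unfolding right_diff_distrib sum_subtractf sum_distrib_left[of _ _ D] sum.swap[of _ D "Pow X"] ..
  also have "\<dots> \<le> (\<Sum>B\<in>Pow X. bern \<epsilon> X B * of_bool (\<exists>d\<in>D. d \<in> B \<and> S d \<inter> B = {}))"
    by (intro sum_mono mult_left_mono bonferroni_pointwise fD fS bern_nonneg \<epsilon>1)
  finally show ?thesis .
qed

section \<open>Sequences of finitely supported measures on the Cantor space\<close>

definition res :: "nat \<Rightarrow> (nat \<Rightarrow> bool) \<Rightarrow> bool list" where
  "res L f = map f [0..<L]"

lemma length_res [simp]: "length (res L f) = L" by (simp add: res_def)

abbreviation strings :: "nat \<Rightarrow> bool list set" where
  "strings L \<equiv> {s. length s = L}"

lemma finite_strings [simp]: "finite (strings L)"
  using finite_lists_length_eq[of "UNIV :: bool set" L] by simp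

lemma eventually_inj_on_res:
  assumes "finite P"
  shows "\<forall>\<^sub>F L in sequentially. inj_on (res L) P"
proof -
  have "\<forall>\<^sub>F L in sequentially. \<forall>x\<in>P. \<forall>y\<in>P. res L x = res L y \<longrightarrow> x = y"
  proof (intro eventually_ball_finite assms ballI)
    fix x y
    show "\<forall>\<^sub>F L in sequentially. res L x = res L y \<longrightarrow> x = y"
    proof (cases "x = y")
      case False
      then obtain k where k: "x k \<noteq> y k" by auto
      show ?thesis
        using eventually_gt_at_top[of k]
        by eventually_elim (use k in \<open>auto simp: res_def\<close>)
    qed simp
  qed
  then show ?thesis by (simp add: inj_on_def)
qed

text \<open>Among m atoms of total weight 1 the heaviest weighs at least 1/m, while m atoms below
  this bound weigh together at most 1/(2m), half of that.\<close>

definition weight_bound :: "nat \<Rightarrow> real" where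
  "weight_bound m = 1 / (2 * (real m)\<^sup>2)"

text \<open>The number of atoms is made exactly \<open>m\<close> by allowing weight zero, so only
  atoms of nonzero weight are required to be distinct. Convergence is required on cylinders only, a
  countable family on which it can hold at almost every sample point simultaneously.\<close>

locale cantor_measures =
  fixes z :: "nat \<Rightarrow> nat \<Rightarrow> nat \<Rightarrow> bool" and \<alpha> :: "nat \<Rightarrow> nat \<Rightarrow> real" and m :: nat
  assumes norm_one: "\<And>n. (\<Sum>i<m. \<bar>\<alpha> n i\<bar>) = 1"
    and null_on_cylinders: "\<And>L s. (\<lambda>n. \<Sum>i<m. \<alpha> n i * of_bool (res L (z n i) = s)) \<longlonglongrightarrow> 0"
    and distinct_points: "\<And>n i j. i < m \<Longrightarrow> j < m \<Longrightarrow> i \<noteq> j \<Longrightarrow> \<alpha> n i \<noteq> 0 \<Longrightarrow> \<alpha> n j \<noteq> 0 \<Longrightarrow> z n i \<noteq> z n j"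
begin

lemma m_pos: "m > 0"
  using norm_one[of 0] by (cases m) auto

text \<open>If these points formed a finite set, one of them would carry weight at least \<open>1/m\<close> infinitely often,
  and a cylinder isolating it from the others would catch only small weights besides.\<close>

lemma infinite_heavy_points:
  assumes N: "infinite N"
  shows "infinite {z n i | n i. n \<in> N \<and> i < m \<and> weight_bound m \<le> \<bar>\<alpha> n i\<bar>}"
proof
  let ?c = "weight_bound m"
  let ?D = "{z n i | n i. n \<in> N \<and> i < m \<and> ?c \<le> \<bar>\<alpha> n i\<bar>}"
  assume fin: "finite ?D"
  have mc: "real m * ?c = 1 / (2 * m)" using m_pos by (simp add: weight_bound_def power2_eq_square)
  have c_le: "?c \<le> 1 / m" using m_pos by (simp add: weight_bound_def power2_eq_square divide_simps)
  have "\<exists>i<m. 1 / m \<le> \<bar>\<alpha> n i\<bar>" for n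
  proof (rule ccontr)
    assume "\<not> ?thesis"
    then have "(\<Sum>i<m. \<bar>\<alpha> n i\<bar>) < (\<Sum>i<m. 1 / real m)"
      using m_pos by (intro sum_strict_mono) (auto simp: not_le)
    then show False using norm_one m_pos by simp
  qed
  then obtain h where h: "\<And>n. h n < m" "\<And>n. 1 / m \<le> \<bar>\<alpha> n (h n)\<bar>" by metis
  have "(\<lambda>n. z n (h n)) ` N \<subseteq> ?D" using h c_le order_trans by blast
  then have "finite ((\<lambda>n. z n (h n)) ` N)" using fin finite_subset by blast
  from pigeonhole_infinite[OF N this] obtain n0
    where n0: "n0 \<in> N" "infinite {n \<in> N. z n (h n) = z n0 (h n0)}" by auto
  define y where "y = z n0 (h n0)"
  have yD: "y \<in> ?D" unfolding y_def using h c_le n0(1) order_trans by blast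
  obtain L where L: "inj_on (res L) ?D"
    using eventually_happens[OF eventually_inj_on_res[OF fin]] by auto
  let ?f = "\<lambda>n. \<Sum>i<m. \<alpha> n i * of_bool (res L (z n i) = res L y)"
  have big: "1 / (2 * m) \<le> \<bar>?f n\<bar>" if n: "n \<in> N" "z n (h n) = y" for n
  proof -
    \<comment> \<open>An atom heavier than \<open>?c\<close> in the cylinder of \<open>y\<close>
      would belong to \<open>?D\<close> and hence be \<open>y\<close>, since \<open>res L\<close> is
      injective on \<open>?D\<close>. But \<open>y\<close> is already atom \<open>h n\<close>, and
      atoms of nonzero weight are distinct.\<close>
    have small: "\<bar>\<alpha> n i * of_bool (res L (z n i) = res L y)\<bar> \<le> ?c" if i: "i \<in> {..<m} - {h n}" for i
    proof (rule ccontr)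
      assume "\<not> ?thesis"
      then have *: "res L (z n i) = res L y" "?c < \<bar>\<alpha> n i\<bar>"
        by (cases "res L (z n i) = res L y"; simp add: weight_bound_def)+
      then have "z n i \<in> ?D" using n i by force
      from inj_onD[OF L *(1) this yD] have "z n i = z n (h n)" using n(2) by simp
      moreover have "\<alpha> n i \<noteq> 0" "\<alpha> n (h n) \<noteq> 0"
        using *(2) h(2)[of n] m_pos by (auto simp: weight_bound_def)
      ultimately show False using distinct_points[of i "h n" n] h(1)[of n] i by auto
    qed
    have "\<bar>\<Sum>i\<in>{..<m} - {h n}. \<alpha> n i * of_bool (res L (z n i) = res L y)\<bar> \<le> (\<Sum>i\<in>{..<m} - {h n}. ?c)"
      by (rule order_trans[OF sum_abs sum_mono[OF small]])
    also have "\<dots> \<le> real m * ?c" using h(1)[of n] m_pos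
      by (simp add: weight_bound_def card_Diff_singleton divide_right_mono)
    finally have 1: "\<bar>\<Sum>i\<in>{..<m} - {h n}. \<alpha> n i * of_bool (res L (z n i) = res L y)\<bar> \<le> 1 / (2 * m)" using mc by simp
    have "?f n = \<alpha> n (h n) + (\<Sum>i\<in>{..<m} - {h n}. \<alpha> n i * of_bool (res L (z n i) = res L y))"
      using h(1)[of n] n(2) by (subst sum.remove[of _ "h n"]) auto
    moreover have "1 / real m = 1 / (2 * m) + 1 / (2 * m)" by simp
    ultimately show ?thesis using 1 h(2)[of n] by linarith
  qed
  have "\<forall>\<^sub>F n in sequentially. \<bar>?f n\<bar> < 1 / (2 * m)"
    using null_on_cylinders[of L "res L y"] m_pos unfolding tendsto_iff
    by (auto simp: dist_real_def elim!: allE[of _ "1 / (2 * real m)"])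
  then obtain n1 where n1: "\<And>n. n \<ge> n1 \<Longrightarrow> \<bar>?f n\<bar> < 1 / (2 * m)" unfolding eventually_sequentially by blast
  obtain n where "n \<ge> n1" "n \<in> N" "z n (h n) = y"
    using n0(2) unfolding y_def[symmetric] infinite_nat_iff_unbounded_le by auto
  then show False using big n1 by force
qed

text \<open>Pick \<open>T\<close> heavy points, each with a measure \<open>n y\<close> in which it
  is the atom numbered \<open>i y\<close>, and apply \<open>bern_hits\<close> to their truncations.
  If the random set contains the truncation of \<open>y\<close> and misses those of the other atoms
  of that measure, the value of the measure on the clopen set is the single weight at
  \<open>y\<close>. A large \<open>L\<close> keeps all atoms concerned apart.\<close>

lemma eventually_random_hit:
  fixes \<epsilon> :: real
  assumes N: "infinite N" and T: "T > 0" "\<epsilon> = 1 / (2 * real T)" "m * \<epsilon> \<le> 1 / 4"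
  shows "\<forall>\<^sub>F L in sequentially. 1 / 8 \<le> (\<Sum>B\<in>Pow (strings L). bern \<epsilon> (strings L) B *
    of_bool (\<exists>n<L. n \<in> N \<and> weight_bound m \<le> \<bar>\<Sum>j<m. \<alpha> n j * of_bool (res L (z n j) \<in> B)\<bar>))"
proof -
  let ?c = "weight_bound m"
  let ?D = "{z n i | n i. n \<in> N \<and> i < m \<and> ?c \<le> \<bar>\<alpha> n i\<bar>}"
  obtain D where D: "D \<subseteq> ?D" "finite D" "card D = T"
    using infinite_arbitrarily_large[OF infinite_heavy_points[OF N]] by blast
  have "\<forall>y\<in>D. \<exists>n i. n \<in> N \<and> i < m \<and> ?c \<le> \<bar>\<alpha> n i\<bar> \<and> y = z n i" using D(1) by blast
  then obtain n i where ni: "\<And>y. y \<in> D \<Longrightarrow> n y \<in> N" "\<And>y. y \<in> D \<Longrightarrow> i y < m"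
    "\<And>y. y \<in> D \<Longrightarrow> ?c \<le> \<bar>\<alpha> (n y) (i y)\<bar>" "\<And>y. y \<in> D \<Longrightarrow> y = z (n y) (i y)" by metis
  define P where "P = D \<union> (\<Union>y\<in>D. z (n y) ` {..<m})"
  have fP: "finite P" using D by (auto simp: P_def)
  have "\<forall>\<^sub>F L in sequentially. \<forall>y\<in>D. n y < L"
    by (intro eventually_ball_finite D ballI eventually_gt_at_top)
  with eventually_inj_on_res[OF fP] show ?thesis
  proof eventually_elim
    case (elim L)
    let ?X = "strings L"
    define inv where "inv = inv_into D (res L)"
    have injD: "inj_on (res L) D" using elim(1) by (rule inj_on_subset) (auto simp: P_def)
    have inv: "inv (res L y) = y" if "y \<in> D" for y using injD that by (simp add: inv_def)
    \<comment> \<open>Exception sets are indexed by strings, so \<open>inv\<close> recovers the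
      heavy point from its truncation. Atoms of weight zero are left out because they may coincide
      with \<open>y\<close>.\<close>
    define S where "S = (\<lambda>d. let y = inv d in (\<lambda>j. res L (z (n y) j)) ` {j. j < m \<and> j \<noteq> i y \<and> \<alpha> (n y) j \<noteq> 0})"
    have nz: "\<alpha> (n y) (i y) \<noteq> 0" if "y \<in> D" for y
      using ni(3)[OF that] m_pos by (auto simp: weight_bound_def)
    have "1 / 8 \<le> (\<Sum>B\<in>Pow ?X. bern \<epsilon> ?X B * of_bool (\<exists>d\<in>res L ` D. d \<in> B \<and> S d \<inter> B = {}))"
    proof (rule bern_hits)
      show "card (res L ` D) = T" using D card_image[OF injD] by simp
      fix d assume "d \<in> res L ` D"
      then obtain y where y: "y \<in> D" "d = res L y" by blast
      show "S d \<subseteq> ?X" by (auto simp: S_def Let_def)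
      show "d \<notin> S d"
      proof
        assume "d \<in> S d"
        then obtain j where j: "j < m" "j \<noteq> i y" "\<alpha> (n y) j \<noteq> 0" "res L y = res L (z (n y) j)"
          using y inv by (auto simp: S_def Let_def)
        have "y = z (n y) j"
          using elim(1) j(1,4) y(1) unfolding inj_on_def P_def by blast
        then show False using distinct_points[of j "i y" "n y"] j ni(2,4)[OF y(1)] nz[OF y(1)] by metis
      qed
      have "card (S d) \<le> card {j. j < m \<and> j \<noteq> i y \<and> \<alpha> (n y) j \<noteq> 0}"
        unfolding S_def y(2) inv[OF y(1)] Let_def by (rule card_image_le) simp
      also have "\<dots> \<le> card {..<m}" by (rule card_mono) auto
      finally show "card (S d) \<le> m" by simp
    qed (use T in auto)
    also have "\<dots> \<le> (\<Sum>B\<in>Pow ?X. bern \<epsilon> ?X B *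
        of_bool (\<exists>n<L. n \<in> N \<and> ?c \<le> \<bar>\<Sum>j<m. \<alpha> n j * of_bool (res L (z n j) \<in> B)\<bar>))"
    proof (intro sum_mono mult_left_mono bern_nonneg)
      fix B
      have "\<exists>n<L. n \<in> N \<and> ?c \<le> \<bar>\<Sum>j<m. \<alpha> n j * of_bool (res L (z n j) \<in> B)\<bar>"
        if hit: "\<exists>d\<in>res L ` D. d \<in> B \<and> S d \<inter> B = {}"
      proof -
        from hit obtain y where y: "y \<in> D" "res L y \<in> B" "S (res L y) \<inter> B = {}" by blast
        have "(\<Sum>j<m. \<alpha> (n y) j * of_bool (res L (z (n y) j) \<in> B)) = (\<Sum>j<m. if j = i y then \<alpha> (n y) (i y) else 0)"
        proof (rule sum.cong)
          fix j assume j: "j \<in> {..<m}"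
          show "\<alpha> (n y) j * of_bool (res L (z (n y) j) \<in> B) = (if j = i y then \<alpha> (n y) (i y) else 0)"
          proof (cases "j = i y")
            case True then show ?thesis using y(2) ni(4)[OF y(1)] by simp
          next
            case False
            then have "res L (z (n y) j) \<notin> B" if "\<alpha> (n y) j \<noteq> 0"
              using y(3) j that inv[OF y(1)] by (auto simp: S_def Let_def)
            then show ?thesis using False by auto
          qed
        qed simp
        also have "\<dots> = \<alpha> (n y) (i y)" using ni(2)[OF y(1)] by simp
        finally show ?thesis using ni(1,3)[OF y(1)] elim(2) y(1) by (intro exI[of _ "n y"]) simp
      qed
      then show "of_bool (\<exists>d\<in>res L ` D. d \<in> B \<and> S d \<inter> B = {}) \<le>
         (of_bool (\<exists>n<L. n \<in> N \<and> ?c \<le> \<bar>\<Sum>j<m. \<alpha> n j * of_bool (res L (z n j) \<in> B)\<bar>) :: real)"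
        by simp
    qed (use T(1) in \<open>simp_all add: T(2)\<close>)
    finally show ?case .
  qed
qed

end

text \<open>There are only finitely many sets of strings of length \<open>L\<close>, so one set
  \<open>Q\<close> of at most \<open>m\<close> strings is the set of truncated atoms of infinitely
  many measures living off \<open>F\<close>. A set \<open>B\<close> that together with
  \<open>F\<close> eventually meets all supports must meet \<open>Q\<close>.\<close>

lemma random_trap:
  fixes z :: "nat \<Rightarrow> nat \<Rightarrow> nat \<Rightarrow> bool" and m :: nat and \<epsilon> :: real
  assumes N: "infinite {n. \<forall>i<m. z n i \<notin> F}" and \<epsilon>: "0 \<le> \<epsilon>" "\<epsilon> \<le> 1"
  shows "(\<Sum>B\<in>Pow (strings L). bern \<epsilon> (strings L) B *
     of_bool (\<exists>n0. \<forall>n\<ge>n0. \<exists>i<m. z n i \<in> F \<or> res L (z n i) \<in> B)) \<le> m * \<epsilon>"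
proof -
  let ?X = "strings L" and ?N = "{n. \<forall>i<m. z n i \<notin> F}"
  have "(\<lambda>n. (\<lambda>i. res L (z n i)) ` {..<m}) ` ?N \<subseteq> Pow ?X" by auto
  then have "finite ((\<lambda>n. (\<lambda>i. res L (z n i)) ` {..<m}) ` ?N)" by (rule finite_subset) simp
  from pigeonhole_infinite[OF N this] obtain n1 where
    n1: "infinite {n \<in> ?N. (\<lambda>i. res L (z n i)) ` {..<m} = (\<lambda>i. res L (z n1 i)) ` {..<m}}" by blast
  define Q where "Q = (\<lambda>i. res L (z n1 i)) ` {..<m}"
  have "Q \<inter> B \<noteq> {}" if trap: "\<exists>n0. \<forall>n\<ge>n0. \<exists>i<m. z n i \<in> F \<or> res L (z n i) \<in> B" for B
  proof -
    from trap obtain n0 where n0: "\<forall>n\<ge>n0. \<exists>i<m. z n i \<in> F \<or> res L (z n i) \<in> B" by blast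
    obtain n where n: "n \<ge> n0" "n \<in> ?N" "(\<lambda>i. res L (z n i)) ` {..<m} = Q"
      using spec[OF n1[unfolded infinite_nat_iff_unbounded_le], of n0] unfolding Q_def by blast
    then obtain i where "i < m" "res L (z n i) \<in> B" using n0 by blast
    then show ?thesis using n(3) by blast
  qed
  then have "(\<Sum>B\<in>Pow ?X. bern \<epsilon> ?X B * of_bool (\<exists>n0. \<forall>n\<ge>n0. \<exists>i<m. z n i \<in> F \<or> res L (z n i) \<in> B))
      \<le> (\<Sum>B\<in>Pow ?X. bern \<epsilon> ?X B * of_bool (Q \<inter> B \<noteq> {}))"
    using \<epsilon> by (intro sum_mono mult_left_mono bern_nonneg) auto
  also have "\<dots> \<le> m * \<epsilon>"
    using \<epsilon> card_image_le[of "{..<m}" "\<lambda>i. res L (z n1 i)"] by (intro bern_meets) (auto simp: Q_def)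
  finally show ?thesis .
qed

section \<open>Subsequences in a \<open>\<sigma>\<close>-complete Boolean algebra\<close>

text \<open>The hypothesis on \<open>g\<close> says that no disjoint sequence is everywhere large
  for \<open>g k\<close>. A tail of the index set splits into infinitely many infinite pieces whose
  suprema are disjoint, so some piece has a supremum that is small for \<open>g k\<close>; keep that
  piece and repeat. The element \<open>a\<close> is the supremum over the diagonal of least
  indices.\<close>

lemma disjoint_subsequence:
  fixes d b :: "nat \<Rightarrow> 'a::boolean_algebra" and g :: "nat \<Rightarrow> 'a \<Rightarrow> real"
  assumes sc: "sigma_complete TYPE('a)"
    and disj: "\<And>i j. i \<noteq> j \<Longrightarrow> inf (d i) (d j) = bot"
    and b: "\<And>j k. j < k \<Longrightarrow> d j \<le> b k"
    and g: "\<And>k s. (\<And>t t'. t \<noteq> t' \<Longrightarrow> inf (s t) (s t') = bot) \<Longrightarrow> \<exists>t::nat. g k (s t) < \<delta>"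
  shows "\<exists>I a. infinite I \<and> (\<forall>k\<in>I. d k \<le> a \<and> (\<exists>u. g k u < \<delta> \<and> a \<le> sup (sup (b k) (d k)) u))"
proof -
  have "\<exists>s. (\<forall>j\<in>J. d j \<le> s) \<and> (\<forall>t. (\<forall>j\<in>J. d j \<le> t) \<longrightarrow> s \<le> t)" for J
  proof -
    have "countable (d ` J)" by simp
    then show ?thesis using sc[unfolded sigma_complete_def, rule_format, of "d ` J"] by simp
  qed
  then obtain lub where lub: "\<And>J j. j \<in> J \<Longrightarrow> d j \<le> lub J"
    "\<And>J t. (\<And>j. j \<in> J \<Longrightarrow> d j \<le> t) \<Longrightarrow> lub J \<le> t" by metis
  have lub_disj: "inf (lub J) (lub J') = bot" if "J \<inter> J' = {}" for J J'
  proof -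
    have "d j \<le> - d j'" if "j \<in> J" "j' \<in> J'" for j j'
      using disj[of j j'] that \<open>J \<inter> J' = {}\<close> by (auto simp: inf_shunt)
    then have "lub J \<le> - d j'" if "j' \<in> J'" for j' using that by (intro lub(2))
    then have "d j' \<le> - lub J" if "j' \<in> J'" for j' using that compl_le_swap1 by blast
    then have "lub J' \<le> - lub J" by (intro lub(2))
    then show ?thesis by (metis inf_shunt inf_commute)
  qed
  have step: "\<exists>J'. infinite J' \<and> J' \<subseteq> J \<inter> {Inf J<..} \<and> g (Inf J) (lub J') < \<delta>" if J: "infinite J" for J :: "nat set"
  proof -
    define J1 where "J1 = J \<inter> {Inf J<..}"
    have "J \<subseteq> J1 \<union> {..Inf J}" by (auto simp: J1_def)
    then have infJ1: "infinite J1" using J finite_subset by blast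
    \<comment> \<open>A pairing function cuts the enumerated tail \<open>J1\<close> into infinitely
      many disjoint infinite pieces.\<close>
    define P where "P = (\<lambda>t. (\<lambda>q. enumerate J1 (prod_encode (t, q))) ` UNIV)"
    have inj: "inj (enumerate J1)" using strict_mono_enumerate[OF infJ1] by (rule strict_mono_imp_inj_on)
    have "inj (\<lambda>q. enumerate J1 (prod_encode (t, q)))" for t
      by (rule injI) (use injD[OF inj] in \<open>force simp: prod_encode_eq\<close>)
    then have infP: "infinite (P t)" for t unfolding P_def by (simp add: finite_image_iff)
    have disjP: "P t \<inter> P t' = {}" if "t \<noteq> t'" for t t'
      using that injD[OF inj] by (force simp: P_def prod_encode_eq)
    have subP: "P t \<subseteq> J1" for t using enumerate_in_set[OF infJ1] by (auto simp: P_def)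
    obtain t where "g (Inf J) (lub (P t)) < \<delta>"
      using g[of "\<lambda>t. lub (P t)" "Inf J"] lub_disj[OF disjP] by auto
    then show ?thesis using infP[of t] subP[of t] unfolding J1_def by auto
  qed
  have "\<exists>J. \<forall>r. infinite (J r) \<and> (J (Suc r) \<subseteq> J r \<inter> {Inf (J r)<..} \<and> g (Inf (J r)) (lub (J (Suc r))) < \<delta>)"
  proof -
    have "\<exists>J. \<forall>r. infinite (J r) \<and> (\<lambda>_ J J'. J' \<subseteq> J \<inter> {Inf J<..} \<and> g (Inf J) (lub J') < \<delta>) r (J r) (J (Suc r))"
      by (rule dependent_nat_choice) (use step in auto)
    then show ?thesis by simp
  qed
  then obtain J where J: "\<And>r. infinite (J r)" "\<And>r. J (Suc r) \<subseteq> J r \<inter> {Inf (J r)<..}"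
    "\<And>r. g (Inf (J r)) (lub (J (Suc r))) < \<delta>" by blast
  define k where "k r = Inf (J r)" for r
  have kJ: "k r \<in> J r" for r unfolding k_def by (rule Inf_nat_def1) (use J(1)[of r] in \<open>metis finite.emptyI\<close>)
  have mono: "J r' \<subseteq> J r" if "r \<le> r'" for r r'
    by (rule lift_Suc_antimono_le[OF _ that]) (use J(2) in blast)
  have kless: "strict_mono k"
    unfolding strict_mono_Suc_iff using kJ J(2) unfolding k_def by blast
  define I where "I = range k"
  have "infinite I" unfolding I_def using kless by (simp add: finite_image_iff strict_mono_imp_inj_on)
  moreover have "d i \<le> lub I \<and> (\<exists>u. g i u < \<delta> \<and> lub I \<le> sup (sup (b i) (d i)) u)" if i: "i \<in> I" for i
  proof -
    obtain r where r: "i = k r" using i by (auto simp: I_def)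
    have "lub I \<le> sup (sup (b i) (d i)) (lub (J (Suc r)))"
    proof (rule lub(2))
      fix j assume "j \<in> I"
      then obtain r' where r': "j = k r'" by (auto simp: I_def)
      \<comment> \<open>Earlier terms lie below \<open>b i\<close>, the term itself is
        \<open>d i\<close>, and later indices all belong to \<open>J (Suc r)\<close>, whose supremum
        is the small remainder \<open>u\<close>.\<close>
      consider "r' < r" | "r' = r" | "Suc r \<le> r'" by linarith
      then show "d j \<le> sup (sup (b i) (d i)) (lub (J (Suc r)))"
      proof cases
        case 1
        then have "d j \<le> b i" using b kless by (simp add: r r' strict_mono_less)
        then show ?thesis by (simp add: le_supI1)
      next
        case 2
        then show ?thesis by (simp add: r r' le_supI1)
      next
        case 3
        then have "d j \<le> lub (J (Suc r))" using kJ[of r'] mono by (intro lub(1)) (auto simp: r')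
        then show ?thesis by (simp add: le_supI2)
      qed
    qed
    then show ?thesis using lub(1)[OF i] J(3)[of r] by (auto simp: r k_def)
  qed
  ultimately show ?thesis by blast
qed

section \<open>Random finitely supported measures\<close>

lemma (in prob_space) sum_prob_le:
  fixes C :: real
  assumes "finite T" "\<And>t. t \<in> T \<Longrightarrow> G t \<in> sets M" "AE w in M. (\<Sum>t\<in>T. indicat_real (G t) w) \<le> C"
  shows "(\<Sum>t\<in>T. prob (G t)) \<le> C"
proof -
  have "(\<Sum>t\<in>T. prob (G t)) = (\<Sum>t\<in>T. expectation (indicat_real (G t)))"
    using assms(2) by (intro sum.cong) auto
  also have "\<dots> = expectation (\<lambda>w. \<Sum>t\<in>T. indicat_real (G t) w)"
    using assms(2) by (intro Bochner_Integration.integral_sum[symmetric]) (auto simp: emeasure_eq_measure)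
  also have "\<dots> \<le> expectation (\<lambda>_. C)"
    using assms by (intro integral_mono_AE) (auto simp: emeasure_eq_measure)
  finally show ?thesis by (simp add: prob_space)
qed

text \<open>The random points are given by a.e. homomorphisms into the measure algebra of \<open>M\<close>; the elements \<open>c k\<close>
  separate the points of each single measure.\<close>

locale random_measures = prob_space M for M :: "'w measure" +
  fixes X :: "nat \<Rightarrow> nat \<Rightarrow> 'a::boolean_algebra \<Rightarrow> 'w set" and \<alpha> :: "nat \<Rightarrow> nat \<Rightarrow> 'w \<Rightarrow> real"
    and m :: nat and c :: "nat \<Rightarrow> 'a"
  assumes X_sets [measurable]: "\<And>n i a. X n i a \<in> sets M"
    and \<alpha>_measurable [measurable]: "\<And>n i. \<alpha> n i \<in> borel_measurable M"
    and X_inf: "\<And>n i a b. AE w in M. w \<in> X n i (inf a b) \<longleftrightarrow> w \<in> X n i a \<and> w \<in> X n i b"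
    and X_compl: "\<And>n i a. AE w in M. w \<in> X n i (- a) \<longleftrightarrow> w \<notin> X n i a"
    and norm_one: "\<And>n. AE w in M. (\<Sum>i<m. \<bar>\<alpha> n i w\<bar>) = 1"
    and separated: "\<And>n i j. i < m \<Longrightarrow> j < m \<Longrightarrow> i \<noteq> j \<Longrightarrow>
       AE w in M. \<alpha> n i w \<noteq> 0 \<longrightarrow> \<alpha> n j w \<noteq> 0 \<longrightarrow> (\<exists>k. w \<in> X n i (c k) \<longleftrightarrow> w \<notin> X n j (c k))"
    and weak_null: "\<And>a. AE w in M. (\<lambda>n. \<Sum>i<m. \<alpha> n i w * indicat_real (X n i a) w) \<longlonglongrightarrow> 0"
begin

section \<open>Elements of the algebra matched with sets in the Cantor space\<close>

definition z :: "nat \<Rightarrow> nat \<Rightarrow> 'w \<Rightarrow> nat \<Rightarrow> bool" where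
  "z n i w k \<longleftrightarrow> w \<in> X n i (c k)"

text \<open>For every atom of every measure, lying in \<open>a\<close> is almost surely the same
  event as having its code in \<open>F\<close>. This lets a deterministic subset of the Cantor space
  be used as an element of the algebra.\<close>

definition represents :: "'a \<Rightarrow> (nat \<Rightarrow> bool) set \<Rightarrow> bool" where
  "represents a F \<longleftrightarrow> (\<forall>n i. Measurable.pred M (\<lambda>w. z n i w \<in> F) \<and> (AE w in M. w \<in> X n i a \<longleftrightarrow> z n i w \<in> F))"

lemma X_sup: "AE w in M. w \<in> X n i (sup a b) \<longleftrightarrow> w \<in> X n i a \<or> w \<in> X n i b"
proof -
  have eq: "sup a b = - (inf (- a) (- b))" by simp
  show ?thesis unfolding eq
    using X_compl[of n i "inf (- a) (- b)"] X_inf[of n i "- a" "- b"] X_compl[of n i a] X_compl[of n i b]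
    by eventually_elim blast
qed

lemma X_bot: "AE w in M. w \<notin> X n i bot"
  using X_inf[of n i a "- a"] X_compl[of n i a] by eventually_elim simp

lemma X_mono: "a \<le> b \<Longrightarrow> AE w in M. w \<in> X n i a \<longrightarrow> w \<in> X n i b"
  using X_inf[of n i a b] by (auto simp: inf_absorb1)

lemma X_disjoint: "inf a b = bot \<Longrightarrow> AE w in M. \<not> (w \<in> X n i a \<and> w \<in> X n i b)"
  using X_inf[of n i a b] X_bot[of n i] by auto

lemma represents_bot: "represents bot {}"
  using X_bot by (auto simp: represents_def)

lemma represents_compl: "represents a F \<Longrightarrow> represents (- a) (- F)"
  unfolding represents_def
proof (intro allI conjI)
  fix n i
  assume *: "\<forall>n i. Measurable.pred M (\<lambda>w. z n i w \<in> F) \<and> (AE w in M. (w \<in> X n i a) = (z n i w \<in> F))"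
  then have [measurable]: "Measurable.pred M (\<lambda>w. z n i w \<in> F)" by blast
  show "Measurable.pred M (\<lambda>w. z n i w \<in> - F)" by simp
  from * have "AE w in M. (w \<in> X n i a) = (z n i w \<in> F)" by blast
  with X_compl[of n i a] show "AE w in M. (w \<in> X n i (- a)) = (z n i w \<in> - F)"
    by eventually_elim simp
qed

lemma represents_inter:
  assumes "represents a F" "represents b E"
  shows "represents (inf a b) (F \<inter> E)"
  unfolding represents_def
proof (intro allI conjI)
  fix n i
  have [measurable]: "Measurable.pred M (\<lambda>w. z n i w \<in> F)" "Measurable.pred M (\<lambda>w. z n i w \<in> E)"
    using assms by (auto simp: represents_def)
  show "Measurable.pred M (\<lambda>w. z n i w \<in> F \<inter> E)" by simp
  have "AE w in M. (w \<in> X n i a) = (z n i w \<in> F)" "AE w in M. (w \<in> X n i b) = (z n i w \<in> E)"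
    using assms by (auto simp: represents_def)
  with X_inf[of n i a b] show "AE w in M. (w \<in> X n i (inf a b)) = (z n i w \<in> F \<inter> E)"
    by eventually_elim simp
qed

lemma represents_union:
  assumes "represents a F" "represents b E"
  shows "represents (sup a b) (F \<union> E)"
  using represents_compl[OF represents_inter[OF represents_compl[OF assms(1)] represents_compl[OF assms(2)]]]
  by simp

lemma represents_coordinate: "represents (c k) {f. f k}"
  by (auto simp: represents_def z_def)

lemma represents_cylinder: "\<exists>a. represents a {f. res L f = s}"
proof (induction L arbitrary: s)
  case 0
  then show ?case
    using represents_bot represents_compl[OF represents_bot] by (cases "s = []") (auto simp: res_def)
next
  case (Suc L)
  show ?case
  proof (cases "length s = Suc L")
    case False
    then have "{f. res (Suc L) f = s} = {}" using length_res[of "Suc L"] by auto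
    then show ?thesis using represents_bot by auto
  next
    case True
    then obtain s' x where s: "s = s' @ [x]" by (metis length_0_conv nat.distinct(1) rev_exhaust)
    obtain a where a: "represents a {f. res L f = s'}" using Suc by blast
    have "{f. res (Suc L) f = s} = {f. res L f = s'} \<inter> (if x then {f. f L} else - {f. f L})"
      by (auto simp: res_def s)
    moreover have "represents (if x then c L else - c L) (if x then {f. f L} else - {f. f L})"
      using represents_coordinate represents_compl by auto
    ultimately show ?thesis using represents_inter[OF a] by metis
  qed
qed

lemma represents_strings: "finite B \<Longrightarrow> \<exists>a. represents a {f. res L f \<in> B}"
proof (induction B rule: finite_induct)
  case empty
  then show ?case using represents_bot by auto
next
  case (insert s B)
  then obtain a where "represents a {f. res L f \<in> B}" by blast
  moreover obtain b where "represents b {f. res L f = s}" using represents_cylinder by blast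
  moreover have "{f. res L f \<in> insert s B} = {f. res L f = s} \<union> {f. res L f \<in> B}" by auto
  ultimately show ?case using represents_union by metis
qed

lemma represents_finite_strings: "\<exists>a. represents a {f. res L f \<in> B}"
proof -
  have "{f. res L f \<in> B} = {f. res L f \<in> B \<inter> strings L}" by auto
  then show ?thesis using represents_strings[of "B \<inter> strings L" L] by simp
qed

text \<open>All requirements are countable in number: one for each measure, pair of atoms or
  cylinder. Cylinders are represented by elements of the algebra, so \<open>weak_null\<close>
  applies to each of them.\<close>

lemma AE_cantor_measures: "AE w in M. cantor_measures (\<lambda>n i. z n i w) (\<lambda>n i. \<alpha> n i w) m"
proof -
  have 1: "AE w in M. \<forall>n. (\<Sum>i<m. \<bar>\<alpha> n i w\<bar>) = 1" unfolding AE_all_countable using norm_one by blast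
  have 2: "AE w in M. \<forall>L s. (\<lambda>n. \<Sum>i<m. \<alpha> n i w * of_bool (res L (z n i w) = s)) \<longlonglongrightarrow> 0"
    unfolding AE_all_countable
  proof (intro allI)
    fix L s
    obtain a where a: "represents a {f. res L f = s}" using represents_cylinder by blast
    then have "AE w in M. \<forall>n i. w \<in> X n i a \<longleftrightarrow> z n i w \<in> {f. res L f = s}"
      unfolding AE_all_countable represents_def by blast
    with weak_null[of a] show "AE w in M. (\<lambda>n. \<Sum>i<m. \<alpha> n i w * of_bool (res L (z n i w) = s)) \<longlonglongrightarrow> 0"
      by eventually_elim (simp add: indicator_def of_bool_def)
  qed
  have 3: "AE w in M. \<forall>n i j. i < m \<longrightarrow> j < m \<longrightarrow> i \<noteq> j \<longrightarrow> \<alpha> n i w \<noteq> 0 \<longrightarrow> \<alpha> n j w \<noteq> 0 \<longrightarrow> z n i w \<noteq> z n j w"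
    unfolding AE_all_countable
  proof (intro allI)
    fix n i j
    show "AE w in M. i < m \<longrightarrow> j < m \<longrightarrow> i \<noteq> j \<longrightarrow> \<alpha> n i w \<noteq> 0 \<longrightarrow> \<alpha> n j w \<noteq> 0 \<longrightarrow> z n i w \<noteq> z n j w"
    proof (cases "i < m \<and> j < m \<and> i \<noteq> j")
      case True
      then have "AE w in M. \<alpha> n i w \<noteq> 0 \<longrightarrow> \<alpha> n j w \<noteq> 0 \<longrightarrow> (\<exists>k. w \<in> X n i (c k) \<longleftrightarrow> w \<notin> X n j (c k))"
        using separated by blast
      then show ?thesis
      proof eventually_elim
        case (elim w)
        then show ?case by (metis z_def)
      qed
    qed auto
  qed
  from 1 2 3 show ?thesis
  proof eventually_elim
    case (elim w)
    then show ?case by unfold_locales auto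
  qed
qed

section \<open>Catching heavy atoms off a set that rarely traps the supports\<close>

definition trapped :: "(nat \<Rightarrow> bool) set \<Rightarrow> 'w set" where
  "trapped F = {w \<in> space M. \<exists>n0. \<forall>n\<ge>n0. \<exists>i<m. z n i w \<in> F}"

text \<open>The lower bound \<open>k\<close> on the index forces the measures caught over all stages
  to have arbitrarily large index; convergence to zero says nothing about a single measure.\<close>

definition caught :: "nat \<Rightarrow> (nat \<Rightarrow> bool) set \<Rightarrow> (nat \<Rightarrow> bool) set \<Rightarrow> nat \<Rightarrow> 'w \<Rightarrow> bool" where
  "caught k F E n w \<longleftrightarrow> k \<le> n \<and> (\<forall>j<m. z n j w \<notin> F) \<and>
     weight_bound m \<le> \<bar>\<Sum>j<m. \<alpha> n j w * of_bool (z n j w \<in> E)\<bar>"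

definition hit :: "nat \<Rightarrow> (nat \<Rightarrow> bool) set \<Rightarrow> (nat \<Rightarrow> bool) set \<Rightarrow> 'w set" where
  "hit k F E = {w \<in> space M. \<exists>n. caught k F E n w}"

lemma represents_pred: "represents a F \<Longrightarrow> Measurable.pred M (\<lambda>w. z n i w \<in> F)"
  by (simp add: represents_def)

lemma trapped_sets: "represents a F \<Longrightarrow> trapped F \<in> sets M"
proof -
  assume "represents a F"
  note [measurable] = represents_pred[OF this]
  show ?thesis unfolding trapped_def by measurable
qed

lemma caught_pred:
  assumes "represents a F" "represents b E"
  shows "Measurable.pred M (caught k F E n)"
proof -
  note [measurable] = assms[THEN represents_pred]
  show ?thesis unfolding caught_def[abs_def] of_bool_def by measurable
qed

lemma hit_sets:
  assumes "represents a F" "represents b E"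
  shows "hit k F E \<in> sets M"
proof -
  note [measurable] = caught_pred[OF assms]
  show ?thesis unfolding hit_def by measurable
qed

text \<open>Both bounds come from a random set of strings of a long length \<open>L\<close>. Where
  \<open>F\<close> does not trap the supports, infinitely many measures live off \<open>F\<close>
  and the random set catches one of them with chance at least 1/8; the chance that it completes a
  trap there is at most m\<epsilon>. Averaging then yields one deterministic set.\<close>

lemma extend_trap:
  assumes F: "represents a F" "prob (trapped F) < 1 / 4" and \<delta>: "\<delta> > 0"
  shows "\<exists>E b. represents b E \<and> prob (trapped (F \<union> E)) \<le> prob (trapped F) + \<delta> \<and> 1 / 32 \<le> prob (hit k F E)"
proof -
  define E where "E = (\<lambda>L B. {f. res L f \<in> B})"
  have "\<exists>b. represents b (E L B)" for L B unfolding E_def by (rule represents_finite_strings)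
  then obtain b where b: "\<And>L B. represents (b L B) (E L B)" by metis
  \<comment> \<open>The term 2m gives m\<epsilon> \<le> 1/4, as \<open>eventually_random_hit\<close>
    demands, and 16m/\<delta> gives m\<epsilon> \<le> \<delta>/32 for the cost of a larger
    trap.\<close>
  obtain T where T: "real T > 1 + 2 * m + 16 * m / \<delta>" using reals_Archimedean2 by blast
  have "0 \<le> 16 * m / \<delta>" using \<delta> by simp
  then have T1: "T > 0" "2 * m \<le> real T" using T by (cases T; simp)+
  define \<epsilon> where "\<epsilon> = 1 / (2 * real T)"
  have "16 * m / \<delta> \<le> T" using T by simp
  then have T2: "16 * real m \<le> real T * \<delta>" using \<delta> by (simp add: field_simps)
  have \<epsilon>: "0 \<le> \<epsilon>" "\<epsilon> \<le> 1" "m * \<epsilon> \<le> 1 / 4" "m * \<epsilon> \<le> \<delta> / 32"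
    using T1 T2 by (auto simp: \<epsilon>_def field_simps)
  have tm [measurable]: "trapped F \<in> sets M" using F trapped_sets by blast
  have hm [measurable]: "hit k F (E L B) \<in> sets M" for L B using F b hit_sets by blast
  have tm2 [measurable]: "trapped (F \<union> E L B) \<in> sets M" for L B
    using trapped_sets[OF represents_union[OF F(1) b]] by blast
  define u where "u L w = (\<Sum>B\<in>Pow (strings L). bern \<epsilon> (strings L) B * indicat_real (hit k F (E L B)) w)" for L w
  have um [measurable]: "u L \<in> borel_measurable M" for L unfolding u_def by measurable
  have ev: "AE w in M. w \<notin> trapped F \<longrightarrow> (\<forall>\<^sub>F L in sequentially. 1 / 8 \<le> u L w)"
    using AE_cantor_measures AE_space
  proof eventually_elim
    case (elim w)
    then interpret cantor_measures "\<lambda>n i. z n i w" "\<lambda>n i. \<alpha> n i w" m by blast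
    show ?case
    proof
      assume nt: "w \<notin> trapped F"
      let ?N = "{n. k \<le> n \<and> (\<forall>j<m. z n j w \<notin> F)}"
      have "infinite ?N" unfolding infinite_nat_iff_unbounded_le
      proof
        fix n0
        have "\<exists>n\<ge>max n0 k. \<forall>i<m. z n i w \<notin> F" using nt elim(2) unfolding trapped_def by blast
        then obtain n where "n \<ge> max n0 k" "\<forall>i<m. z n i w \<notin> F" by blast
        then show "\<exists>n\<ge>n0. n \<in> ?N" by auto
      qed
      from eventually_random_hit[OF this T1(1) \<epsilon>_def \<epsilon>(3)]
      show "\<forall>\<^sub>F L in sequentially. 1 / 8 \<le> u L w"
      proof eventually_elim
        case (elim L)
        note elim
        also have "(\<Sum>B\<in>Pow (strings L). bern \<epsilon> (strings L) B * of_bool (\<exists>n<L. n \<in> ?N \<and>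
             weight_bound m \<le> \<bar>\<Sum>j<m. \<alpha> n j w * of_bool (res L (z n j w) \<in> B)\<bar>)) \<le> u L w"
          unfolding u_def using \<open>w \<in> space M\<close>
          by (intro sum_mono mult_left_mono bern_nonneg \<epsilon>) (auto simp: hit_def caught_def E_def indicator_def)
        finally show ?case .
      qed
    qed
  qed
  define Z where "Z L = {w \<in> space M. 1 / 8 \<le> u L w}" for L
  have Zm [measurable]: "Z L \<in> sets M" for L unfolding Z_def by measurable
  define U where "U L0 = (\<Inter>L\<in>{L0..}. Z L)" for L0
  have Um [measurable]: "U L0 \<in> sets M" for L0 unfolding U_def
    by (rule sets.countable_INT') auto
  \<comment> \<open>How long \<open>L\<close> must be depends on the sample point. Since the sets
    \<open>U L\<close> increase and their union has probability above 1/2, a single \<open>L\<close>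
    serves more than half of the points.\<close>
  have "(\<lambda>L. prob (U L)) \<longlonglongrightarrow> prob (\<Union>L. U L)"
    by (rule finite_Lim_measure_incseq) (auto simp: U_def incseq_def Bex_def)
  moreover have "1 / 2 < prob (\<Union>L. U L)"
  proof -
    have "AE w in M. w \<in> space M - trapped F \<longrightarrow> w \<in> (\<Union>L. U L)"
      using ev by eventually_elim (auto simp: U_def Z_def eventually_sequentially)
    then have "prob (space M - trapped F) \<le> prob (\<Union>L. U L)"
      by (intro finite_measure_mono_AE) auto
    moreover have "prob (space M - trapped F) = 1 - prob (trapped F)" by (rule prob_compl) (rule tm)
    ultimately show ?thesis using F(2) by simp
  qed
  ultimately have "\<forall>\<^sub>F L in sequentially. 1 / 2 < prob (U L)" by (rule order_tendstoD)
  then obtain L where "1 / 2 < prob (U L)" using eventually_happens by force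
  moreover have "prob (U L) \<le> prob (Z L)" by (intro finite_measure_mono) (auto simp: U_def)
  ultimately have ZL: "1 / 2 \<le> prob (Z L)" by simp
  let ?p = "bern \<epsilon> (strings L)"
  have "1 / 16 \<le> expectation (\<lambda>w. 1 / 8 * indicat_real (Z L) w)" using ZL by simp
  also have "\<dots> \<le> expectation (u L)"
  proof (rule integral_mono)
    show "integrable M (u L)" unfolding u_def
      by (intro Bochner_Integration.integrable_sum integrable_mult_right) (auto simp: emeasure_eq_measure)
    show "integrable M (\<lambda>w. 1 / 8 * indicat_real (Z L) w)" by (auto simp: emeasure_eq_measure)
    fix w
    show "1 / 8 * indicat_real (Z L) w \<le> u L w"
      unfolding u_def[of L w] using \<epsilon> by (cases "w \<in> Z L")
       (auto simp: Z_def u_def intro!: sum_nonneg mult_nonneg_nonneg bern_nonneg)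
  qed
  also have "\<dots> = (\<Sum>B\<in>Pow (strings L). ?p B * prob (hit k F (E L B)))"
    unfolding u_def by (subst Bochner_Integration.integral_sum) (auto simp: emeasure_eq_measure)
  finally have 1: "1 / 16 \<le> (\<Sum>B\<in>Pow (strings L). ?p B * prob (hit k F (E L B)))" .
  let ?R = "\<lambda>B. trapped (F \<union> E L B) - trapped F"
  have "(\<Sum>B\<in>Pow (strings L). ?p B * prob (?R B)) = expectation (\<lambda>w. \<Sum>B\<in>Pow (strings L). ?p B * indicat_real (?R B) w)"
    by (subst Bochner_Integration.integral_sum) (auto simp: emeasure_eq_measure)
  also have "\<dots> \<le> expectation (\<lambda>_. m * \<epsilon>)"
  proof (rule integral_mono)
    show "integrable M (\<lambda>w. \<Sum>B\<in>Pow (strings L). ?p B * indicat_real (?R B) w)"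
      by (intro Bochner_Integration.integrable_sum integrable_mult_right) (auto simp: emeasure_eq_measure)
    fix w assume w: "w \<in> space M"
    show "(\<Sum>B\<in>Pow (strings L). ?p B * indicat_real (?R B) w) \<le> m * \<epsilon>"
    proof (cases "w \<in> trapped F")
      case True
      then show ?thesis using \<epsilon> by simp
    next
      case False
      then have "infinite {n. \<forall>i<m. z n i w \<notin> F}"
        using w unfolding infinite_nat_iff_unbounded_le by (auto simp: trapped_def)
      from random_trap[OF this \<epsilon>(1,2), of L]
      have "(\<Sum>B\<in>Pow (strings L). ?p B *
         of_bool (\<exists>n0. \<forall>n\<ge>n0. \<exists>i<m. z n i w \<in> F \<or> res L (z n i w) \<in> B)) \<le> m * \<epsilon>" .
      then show ?thesis using w False by (simp add: trapped_def E_def indicator_def of_bool_def)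
    qed
  qed simp
  also have "\<dots> \<le> \<delta> / 32" using \<epsilon> by (simp add: prob_space)
  finally have 2: "(\<Sum>B\<in>Pow (strings L). ?p B * prob (?R B)) \<le> \<delta> / 32" .
  \<comment> \<open>The average of this difference is at least 1/16 - (\<delta>/32)/\<delta> = 1/32,
    so some \<open>B\<close> reaches it. Dividing by \<delta> lets one inequality give both
    conclusions, since the first probability is at most 1.\<close>
  have "\<exists>B\<in>Pow (strings L). 1 / 32 \<le> prob (hit k F (E L B)) - prob (?R B) / \<delta>"
  proof (rule ccontr)
    assume "\<not> ?thesis"
    then have lt: "0 < 1 / 32 - (prob (hit k F (E L B)) - prob (?R B) / \<delta>)" if "B \<in> Pow (strings L)" for B
      using that by (auto simp: not_le)
    have "(\<Sum>B\<in>Pow (strings L). ?p B * (1 / 32 - (prob (hit k F (E L B)) - prob (?R B) / \<delta>))) =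
        (\<Sum>B\<in>Pow (strings L). ?p B) * (1 / 32) - (\<Sum>B\<in>Pow (strings L). ?p B * prob (hit k F (E L B)))
        + (\<Sum>B\<in>Pow (strings L). ?p B * prob (?R B)) / \<delta>"
      by (simp add: sum_distrib_right sum_divide_distrib sum_subtractf sum.distrib algebra_simps)
    also have "\<dots> \<le> 1 / 32 - 1 / 16 + (\<delta> / 32) / \<delta>"
      using 1 2 \<delta> bern_total[of "strings L" \<epsilon>] by (intro add_mono diff_mono divide_right_mono) auto
    also have "\<dots> = 0" using \<delta> by simp
    finally have le: "(\<Sum>B\<in>Pow (strings L). ?p B * (1 / 32 - (prob (hit k F (E L B)) - prob (?R B) / \<delta>))) \<le> 0" .
    have nn: "0 \<le> ?p B * (1 / 32 - (prob (hit k F (E L B)) - prob (?R B) / \<delta>))" if "B \<in> Pow (strings L)" for B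
      using lt[OF that] \<epsilon> by (intro mult_nonneg_nonneg bern_nonneg) auto
    have "?p B = 0" if B: "B \<in> Pow (strings L)" for B
    proof -
      have "(\<Sum>B\<in>Pow (strings L). ?p B * (1 / 32 - (prob (hit k F (E L B)) - prob (?R B) / \<delta>))) = 0"
        by (intro antisym le sum_nonneg nn)
      then have "?p B * (1 / 32 - (prob (hit k F (E L B)) - prob (?R B) / \<delta>)) = 0"
        using B nn by (subst (asm) sum_nonneg_eq_0_iff) auto
      then show ?thesis using lt[OF B] by simp
    qed
    then have "(\<Sum>B\<in>Pow (strings L). ?p B) = 0" by (rule sum.neutral[rule_format])
    then show False using bern_total[of "strings L" \<epsilon>] by simp
  qed
  then obtain B where B: "1 / 32 \<le> prob (hit k F (E L B)) - prob (?R B) / \<delta>" by blast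
  have "0 \<le> prob (?R B) / \<delta>" using \<delta> by simp
  then have h: "1 / 32 \<le> prob (hit k F (E L B))" using B by linarith
  have "prob (?R B) / \<delta> \<le> 1" using B prob_le_1[of "hit k F (E L B)"] by linarith
  then have "prob (?R B) \<le> \<delta>" using \<delta> by simp
  moreover have "prob (trapped (F \<union> E L B)) \<le> prob (trapped F) + prob (?R B)"
  proof -
    have "prob (trapped (F \<union> E L B)) \<le> prob (trapped F \<union> ?R B)" by (intro finite_measure_mono) auto
    also have "\<dots> \<le> prob (trapped F) + prob (?R B)" by (intro measure_Un_le) auto
    finally show ?thesis .
  qed
  ultimately show ?thesis using h b by force
qed

text \<open>Step k may enlarge the trap by (1/2)^(k+3). Started at zero, the probability of the trap
  stays at most 1/4 - (1/2)^(k+2), so the hypothesis of \<open>extend_trap\<close> holds at every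
  step.\<close>

lemma trapping_sequence:
  "\<exists>F E b. F 0 = {} \<and> (\<forall>k. represents (b k) (E k) \<and> F (Suc k) = F k \<union> E k \<and> 1 / 32 \<le> prob (hit k (F k) (E k)))"
proof -
  have "\<exists>F. \<forall>k. ((k = 0 \<longrightarrow> F k = {}) \<and> (\<exists>a. represents a (F k)) \<and> prob (trapped (F k)) \<le> 1 / 4 - (1 / 2) ^ (k + 2)) \<and>
     (\<exists>E b. represents b E \<and> F (Suc k) = F k \<union> E \<and> 1 / 32 \<le> prob (hit k (F k) E))"
  proof (rule dependent_nat_choice)
    have "trapped {} = {}" by (auto simp: trapped_def)
    then show "\<exists>F. (0 = (0::nat) \<longrightarrow> F = {}) \<and> (\<exists>a. represents a F) \<and> prob (trapped F) \<le> 1 / 4 - (1 / 2) ^ (0 + 2)"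
      using represents_bot by (intro exI[of _ "{}"]) (auto simp: power2_eq_square)
  next
    fix F k
    assume *: "(k = 0 \<longrightarrow> F = {}) \<and> (\<exists>a. represents a F) \<and> prob (trapped F) \<le> 1 / 4 - (1 / 2) ^ (k + 2)"
    then obtain a where a: "represents a F" by blast
    have "(0::real) < (1 / 2) ^ (k + 2)" "(0::real) < (1 / 2) ^ (k + 3)" by simp_all
    then have "prob (trapped F) < 1 / 4" using * by linarith
    from extend_trap[OF a this, of "(1 / 2) ^ (k + 3)" k] obtain E b where E: "represents b E"
      "prob (trapped (F \<union> E)) \<le> prob (trapped F) + (1 / 2) ^ (k + 3)" "1 / 32 \<le> prob (hit k F E)" by auto
    have "prob (trapped (F \<union> E)) \<le> 1 / 4 - (1 / 2) ^ (Suc k + 2)"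
      using E(2) * by (simp add: power_add power2_eq_square power3_eq_cube)
    then show "\<exists>F'. ((Suc k = 0 \<longrightarrow> F' = {}) \<and> (\<exists>a. represents a F') \<and> prob (trapped F') \<le> 1 / 4 - (1 / 2) ^ (Suc k + 2)) \<and>
       (\<exists>E b. represents b E \<and> F' = F \<union> E \<and> 1 / 32 \<le> prob (hit k F E))"
      using E represents_union[OF a E(1)] by blast
  qed
  then show ?thesis by metis
qed

section \<open>The supremum of the disjoint sets and the contradiction\<close>

theorem no_bounded_weak_null_sequence:
  assumes sc: "sigma_complete TYPE('a)"
  shows False
proof -
  obtain F E b where F0: "F 0 = {}" and b: "\<And>k. represents (b k) (E k)" and FS: "\<And>k. F (Suc k) = F k \<union> E k"
    and big: "\<And>k. 1 / 32 \<le> prob (hit k (F k) (E k))"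
    using trapping_sequence by blast
  define s where "s = rec_nat bot (\<lambda>k x. sup x (b k))"
  have s_simps: "s 0 = bot" "\<And>k. s (Suc k) = sup (s k) (b k)" by (auto simp: s_def)
  have s: "represents (s k) (F k)" for k
    by (induction k) (simp_all add: s_simps F0 FS represents_bot represents_union b)
  have s_mono: "s j \<le> s k" if "j \<le> k" for j k
    by (rule lift_Suc_mono_le[OF _ that]) (simp add: s_simps)
  \<comment> \<open>Removing \<open>s k\<close> makes the elements disjoint. A measure caught at
    stage \<open>k\<close> has no atom in \<open>F k\<close>, so its value on \<open>E k\<close> is
    unaffected by the removal.\<close>
  define d where "d k = inf (b k) (- s k)" for k
  have d_le: "d j \<le> s k" if "j < k" for j k
  proof -
    have "d j \<le> s (Suc j)" by (simp add: d_def s_simps le_infI1)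
    also have "\<dots> \<le> s k" using that by (intro s_mono) simp
    finally show ?thesis .
  qed
  have d_disj: "inf (d i) (d j) = bot" if "i < j" for i j
  proof -
    have "inf (d i) (d j) \<le> inf (s j) (- s j)" using d_le[OF that] by (intro inf_mono) (auto simp: d_def)
    then show ?thesis by (simp add: bot_unique)
  qed
  then have d_disj: "inf (d i) (d j) = bot" if "i \<noteq> j" for i j
    using that by (metis inf_commute linorder_neqE_nat)
  have d: "represents (d k) (E k \<inter> - F k)" for k
    unfolding d_def by (intro represents_inter represents_compl b s)
  \<comment> \<open>Among the caught measures the one of least index is singled out, so that each
    sample point and stage carries a single measure with \<open>m\<close> atoms to be
    counted.\<close>
  define first where "first k n w \<longleftrightarrow> caught k (F k) (E k) n w \<and> (\<forall>n'<n. \<not> caught k (F k) (E k) n' w)" for k n w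
  note [measurable] = caught_pred[OF s b]
  have [measurable]: "Measurable.pred M (first k n)" for k n
    unfolding first_def[abs_def] by measurable
  define hitX where "hitX k u = {w \<in> space M. \<exists>n. first k n w \<and> (\<exists>i<m. w \<in> X n i u)}" for k u
  have hitX_sets [measurable]: "hitX k u \<in> sets M" for k u
    unfolding hitX_def by measurable
  have first_unique: "n = n'" if "first k n w" "first k n' w" for k n n' w
    using that unfolding first_def by (metis linorder_neqE_nat)
  \<comment> \<open>At almost every point the atoms of the selected measure lie in at most
    \<open>m\<close> of the disjoint elements, so the probabilities sum to at most \<open>m\<close>.
    More than 64m of them cannot all be at least 1/64.\<close>
  have g: "\<exists>t::nat. prob (hitX k (u t)) < 1 / 64" if u: "\<And>t t'. t \<noteq> t' \<Longrightarrow> inf (u t) (u t') = bot" for k and u :: "nat \<Rightarrow> 'a"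
  proof (rule ccontr)
    assume "\<not> ?thesis"
    then have ge: "1 / 64 \<le> prob (hitX k (u t))" for t by (meson not_less)
    define T where "T = 64 * m + 1"
    have "AE w in M. \<forall>n i t t'. t \<noteq> t' \<longrightarrow> \<not> (w \<in> X n i (u t) \<and> w \<in> X n i (u t'))"
      unfolding AE_all_countable
    proof (intro allI)
      fix n i t t'
      show "AE w in M. t \<noteq> t' \<longrightarrow> \<not> (w \<in> X n i (u t) \<and> w \<in> X n i (u t'))"
        using X_disjoint[OF u] by (cases "t = t'") simp_all
    qed
    then have "AE w in M. (\<Sum>t<T. indicat_real (hitX k (u t)) w) \<le> m"
    proof eventually_elim
      case (elim w)
      define A where "A = {t. t < T \<and> w \<in> hitX k (u t)}"
      have "card A \<le> card {..<m}"
      proof (cases "\<exists>n. first k n w")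
        case False
        then have "A = {}" by (auto simp: A_def hitX_def)
        then show ?thesis by simp
      next
        case True
        then obtain n where n: "first k n w" by blast
        have "\<forall>t\<in>A. \<exists>i<m. w \<in> X n i (u t)"
          using first_unique[OF n] by (auto simp: A_def hitX_def)
        then obtain i where i: "\<And>t. t \<in> A \<Longrightarrow> i t < m" "\<And>t. t \<in> A \<Longrightarrow> w \<in> X n (i t) (u t)" by metis
        have "inj_on i A"
        proof (rule inj_onI)
          fix t t' assume "t \<in> A" "t' \<in> A" "i t = i t'"
          then show "t = t'" using elim i(2) by metis
        qed
        then show ?thesis by (rule card_inj_on_le) (use i in auto)
      qed
      moreover have "{..<T} \<inter> {t. w \<in> hitX k (u t)} = A" by (auto simp: A_def)
      then have "(\<Sum>t<T. indicat_real (hitX k (u t)) w) = card A"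
        by (simp add: indicator_def sum.If_cases)
      ultimately show ?case by simp
    qed
    then have "(\<Sum>t<T. prob (hitX k (u t))) \<le> m"
      by (intro sum_prob_le) auto
    moreover have "(\<Sum>t<T. 1 / 64) \<le> (\<Sum>t<T. prob (hitX k (u t)))" by (intro sum_mono ge)
    ultimately show False by (simp add: T_def)
  qed
  have "\<exists>I a. infinite I \<and> (\<forall>k\<in>I. d k \<le> a \<and> (\<exists>u. prob (hitX k u) < 1 / 64 \<and> a \<le> sup (sup (s k) (d k)) u))"
    by (rule disjoint_subsequence[OF sc d_disj d_le g])
  then obtain I a where I: "infinite I" and dk: "\<And>k. k \<in> I \<Longrightarrow> d k \<le> a"
    and uk: "\<And>k. k \<in> I \<Longrightarrow> \<exists>u. prob (hitX k u) < 1 / 64 \<and> a \<le> sup (sup (s k) (d k)) u"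
    by blast
  define V where "V k = {w \<in> space M. \<exists>n\<ge>k. weight_bound m \<le> \<bar>\<Sum>i<m. \<alpha> n i w * indicat_real (X n i a) w\<bar>}" for k
  have [measurable]: "V k \<in> sets M" for k unfolding V_def by measurable
  have V_anti: "V k' \<subseteq> V k" if "k \<le> k'" for k k'
    unfolding V_def using order_trans[OF that] by blast
  have VI: "1 / 64 \<le> prob (V k)" if k: "k \<in> I" for k
  proof -
    obtain u where u: "prob (hitX k u) < 1 / 64" "a \<le> sup (sup (s k) (d k)) u" using uk[OF k] by blast
    have AE1: "AE w in M. \<forall>n i. (w \<in> X n i a \<longrightarrow> w \<in> X n i (sup (sup (s k) (d k)) u)) \<and>
      (w \<in> X n i (sup (sup (s k) (d k)) u) \<longleftrightarrow> w \<in> X n i (sup (s k) (d k)) \<or> w \<in> X n i u) \<and>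
      (w \<in> X n i (sup (s k) (d k)) \<longleftrightarrow> w \<in> X n i (s k) \<or> w \<in> X n i (d k)) \<and>
      (w \<in> X n i (d k) \<longrightarrow> w \<in> X n i a) \<and> (w \<in> X n i (s k) \<longleftrightarrow> z n i w \<in> F k) \<and>
      (w \<in> X n i (d k) \<longleftrightarrow> z n i w \<in> E k \<inter> - F k)"
      unfolding AE_all_countable AE_conj_iff
      using X_mono[OF u(2)] X_sup X_mono[OF dk[OF k]] s[of k] d[of k] unfolding represents_def by blast
    have "AE w in M. w \<in> hit k (F k) (E k) \<longrightarrow> w \<in> hitX k u \<union> V k"
      using AE1
    proof eventually_elim
      case (elim w)
      show ?case
      proof
        assume w: "w \<in> hit k (F k) (E k)"
        then have ex: "\<exists>n. caught k (F k) (E k) n w" by (simp add: hit_def)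
        define n where "n = (LEAST n. caught k (F k) (E k) n w)"
        have n: "first k n w" unfolding first_def n_def using LeastI_ex[OF ex] not_less_Least by blast
        show "w \<in> hitX k u \<union> V k"
        proof (cases "\<exists>i<m. w \<in> X n i u")
          case True
          then show ?thesis using n w by (auto simp: hitX_def hit_def)
        next
          case False
          have c: "k \<le> n" "\<forall>j<m. z n j w \<notin> F k" "weight_bound m \<le> \<bar>\<Sum>j<m. \<alpha> n j w * of_bool (z n j w \<in> E k)\<bar>"
            using n by (auto simp: first_def caught_def)
          \<comment> \<open>The atoms of the measure lie neither in \<open>s k\<close> nor in
            \<open>u\<close>, while \<open>a\<close> lies between \<open>d k\<close> and the join of
            \<open>s k\<close>, \<open>d k\<close> and \<open>u\<close>. So \<open>a\<close> and
            \<open>E k\<close> contain the same atoms.\<close>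
          have "w \<in> X n i a \<longleftrightarrow> z n i w \<in> E k" if i: "i < m" for i
            using elim[THEN spec, of n, THEN spec, of i] c(2) False i by blast
          then have "(\<Sum>i<m. \<alpha> n i w * indicat_real (X n i a) w) = (\<Sum>j<m. \<alpha> n j w * of_bool (z n j w \<in> E k))"
            by (intro sum.cong) (auto simp: indicator_def)
          then have "w \<in> V k" using c w by (auto simp: V_def hit_def)
          then show ?thesis by simp
        qed
      qed
    qed
    then have "prob (hit k (F k) (E k)) \<le> prob (hitX k u \<union> V k)"
      by (intro finite_measure_mono_AE) auto
    also have "\<dots> \<le> prob (hitX k u) + prob (V k)" by (intro measure_Un_le) auto
    finally show ?thesis using big[of k] u(1) by linarith
  qed
  have V: "1 / 64 \<le> prob (V k)" for k
  proof -
    obtain k' where k': "k' \<ge> k" "k' \<in> I" using I by (auto simp: infinite_nat_iff_unbounded_le)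
    have "prob (V k') \<le> prob (V k)" using V_anti[OF k'(1)] by (rule finite_measure_mono) simp
    then show ?thesis using VI[OF k'(2)] by linarith
  qed
  \<comment> \<open>The events \<open>V k\<close> decrease and keep probability at least 1/64, so
    with positive probability the integrals of \<open>a\<close> are large for infinitely many
    indices.\<close>
  have "(\<lambda>k. prob (V k)) \<longlonglongrightarrow> prob (\<Inter>k. V k)"
    by (rule finite_Lim_measure_decseq) (auto simp: decseq_def dest: V_anti)
  then have "1 / 64 \<le> prob (\<Inter>k. V k)" using V by (intro LIMSEQ_le_const) auto
  moreover have "AE w in M. w \<notin> (\<Inter>k. V k)"
    using weak_null[of a] AE_cantor_measures
  proof eventually_elim
    case (elim w)
    from elim(2) interpret cantor_measures "\<lambda>n i. z n i w" "\<lambda>n i. \<alpha> n i w" m .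
    have "weight_bound m > 0" using m_pos by (simp add: weight_bound_def)
    with elim(1) have "\<forall>\<^sub>F n in sequentially. \<bar>\<Sum>i<m. \<alpha> n i w * indicat_real (X n i a) w\<bar> < weight_bound m"
      unfolding tendsto_iff by (auto simp: dist_real_def)
    then obtain k where "\<And>n. n \<ge> k \<Longrightarrow> \<bar>\<Sum>i<m. \<alpha> n i w * indicat_real (X n i a) w\<bar> < weight_bound m"
      unfolding eventually_sequentially by blast
    then have "w \<notin> V k" by (force simp: V_def)
    then show ?case by blast
  qed
  then have "prob (\<Inter>k. V k) = 0" by (subst prob_eq_0) auto
  ultimately show False by simp
qed

end

section \<open>Conditions as Borel sets\<close>

definition rep :: "'k random \<Rightarrow> ('k \<Rightarrow> bool) set" where
  "rep p = rep_measure_algebra (Rep_random p)"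

lemma rep_refl: "ae_eq (rep p) (rep p)"
  unfolding rep_def by (rule Quotient3_rep_reflp[OF Quotient3_measure_algebra])

lemma rep_borel: "rep p \<in> sets borel"
  using rep_refl by (auto simp: ae_eq_def)

lemma rep_completion: "rep p \<in> sets (completion coin_space)"
  by (rule borel_in_completion_coin[OF rep_borel])

lemma le_rep_iff: "p \<le> q \<longleftrightarrow> coin_null (rep p - rep q)"
  by (simp add: less_eq_random.rep_eq less_eq_measure_algebra.rep_eq rep_def)

lemma rep_not_null: "\<not> coin_null (rep p)"
proof
  assume "coin_null (rep p)"
  then have "Rep_random p \<le> bot"
    unfolding less_eq_measure_algebra.rep_eq by (rule coin_null_subset) (simp add: rep_def)
  then have "Rep_random p = bot" by (simp add: bot_unique)
  then show False using Rep_random[of p] by simp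
qed

lemma condition_exists:
  assumes "X \<in> sets borel" "\<not> coin_null X"
  obtains p where "coin_null (rep p - X)" "coin_null (X - rep p)"
proof -
  have X: "ae_eq X X" using assms by (simp add: ae_eq_def)
  have "abs_measure_algebra X \<noteq> bot"
  proof
    assume "abs_measure_algebra X = bot"
    then have "abs_measure_algebra X = abs_measure_algebra {}" by (simp add: bot_measure_algebra_def)
    then have "ae_eq X {}"
      using Quotient3_rel[OF Quotient3_measure_algebra, of X "{}"] X by (simp add: ae_eq_def)
    then show False using assms(2) by (simp add: ae_eq_def)
  qed
  then have "Rep_random (Abs_random (abs_measure_algebra X)) = abs_measure_algebra X"
    by (intro Abs_random_inverse) simp
  then have "rep (Abs_random (abs_measure_algebra X)) = rep_measure_algebra (abs_measure_algebra X)"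
    by (simp add: rep_def)
  moreover have "ae_eq (rep_measure_algebra (abs_measure_algebra X)) X"
    by (rule rep_abs_rsp_left[OF Quotient3_measure_algebra X])
  ultimately have "coin_null (rep (Abs_random (abs_measure_algebra X)) - X \<union> (X - rep (Abs_random (abs_measure_algebra X))))"
    by (simp add: ae_eq_def)
  then show ?thesis by (intro that[of "Abs_random (abs_measure_algebra X)"]) (auto intro: coin_null_subset)
qed

section \<open>Properties that hold almost everywhere on a condition\<close>

lemma coin_null_UN: "countable J \<Longrightarrow> (\<And>j. j \<in> J \<Longrightarrow> coin_null (f j)) \<Longrightarrow> coin_null (\<Union>j\<in>J. f j)"
  by (rule null_sets_UN')

text \<open>As a filter, being true almost everywhere on the condition can be handled by the rules
  for \<open>eventually\<close>, which combine the null sets. The property may be any set of points: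
  null sets are those of the completion.\<close>

definition aef :: "'k random \<Rightarrow> ('k \<Rightarrow> bool) filter" where
  "aef p = Abs_filter (\<lambda>Q. coin_null {w \<in> rep p. \<not> Q w})"

lemma eventually_aef: "eventually Q (aef p) \<longleftrightarrow> coin_null {w \<in> rep p. \<not> Q w}"
  unfolding aef_def
proof (rule eventually_Abs_filter, rule is_filter.intro)
  fix Q R
  assume "coin_null {w \<in> rep p. \<not> Q w}" "coin_null {w \<in> rep p. \<not> R w}"
  then show "coin_null {w \<in> rep p. \<not> (Q w \<and> R w)}"
    by (rule coin_null_subset2) auto
next
  fix Q R assume "\<forall>w. Q w \<longrightarrow> R w" "coin_null {w \<in> rep p. \<not> Q w}"
  then show "coin_null {w \<in> rep p. \<not> R w}" by (auto elim: coin_null_subset)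
qed simp

lemma aef_nontrivial: "\<not> eventually (\<lambda>_. False) (aef p)"
  by (simp add: eventually_aef rep_not_null)

lemma aef_const [simp]: "eventually (\<lambda>_. P) (aef p) \<longleftrightarrow> P"
  using aef_nontrivial by (cases P) auto

lemma aef_mono: "eventually Q (aef p) \<Longrightarrow> q \<le> p \<Longrightarrow> eventually Q (aef q)"
  unfolding eventually_aef le_rep_iff by (erule (1) coin_null_subset2) auto

lemma le_aef_iff: "p \<le> q \<longleftrightarrow> eventually (\<lambda>w. w \<in> rep q) (aef p)"
  unfolding eventually_aef le_rep_iff set_diff_eq ..

lemma aef_all_countable:
  assumes "\<And>x::'c::countable. eventually (Q x) (aef p)"
  shows "eventually (\<lambda>w. \<forall>x. Q x w) (aef p)"
proof -
  have "{w \<in> rep p. \<not> (\<forall>x. Q x w)} = (\<Union>x. {w \<in> rep p. \<not> Q x w})" by auto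
  then show ?thesis unfolding eventually_aef using assms[unfolded eventually_aef]
    by (simp add: coin_null_UN)
qed

lemma aef_ball_countable:
  assumes "countable J" "\<And>x. x \<in> J \<Longrightarrow> eventually (Q x) (aef p)"
  shows "eventually (\<lambda>w. \<forall>x\<in>J. Q x w) (aef p)"
proof -
  have "{w \<in> rep p. \<not> (\<forall>x\<in>J. Q x w)} = (\<Union>x\<in>J. {w \<in> rep p. \<not> Q x w})" by auto
  then show ?thesis unfolding eventually_aef using assms[unfolded eventually_aef]
    by (simp add: coin_null_UN)
qed

lemma restrict_condition:
  assumes "X \<in> sets borel" "\<not> eventually (\<lambda>w. w \<notin> X) (aef p)"
  obtains q where "q \<le> p" "eventually (\<lambda>w. w \<in> X) (aef q)" "coin_null (rep p \<inter> X - rep q)"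
proof -
  have "\<not> coin_null (rep p \<inter> X)" using assms(2) by (simp add: eventually_aef Int_def)
  then obtain q where q: "coin_null (rep q - rep p \<inter> X)" "coin_null (rep p \<inter> X - rep q)"
    using condition_exists[of "rep p \<inter> X"] assms(1) rep_borel by blast
  show ?thesis
    by (rule that[OF _ _ q(2)]) (auto simp: le_rep_iff eventually_aef intro: coin_null_subset[OF q(1)])
qed

text \<open>Exhaust the measure by countably many conditions with \<open>P\<close> below
  \<open>p\<close>. If a part of \<open>p\<close> of positive measure were left over, density would
  give a condition with \<open>P\<close> inside it, yet the exhaustion covers that condition too.
  The result is a countable predense family below \<open>p\<close>.\<close>

lemma countable_cover:
  assumes "\<And>q. q \<le> p \<Longrightarrow> \<exists>r\<le>q. P r"
  obtains J where "countable J" "\<And>r. r \<in> J \<Longrightarrow> r \<le> p \<and> P r" "eventually (\<lambda>w. \<exists>r\<in>J. w \<in> rep r) (aef p)"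
proof -
  interpret c: prob_space "completion (coin_space :: ('a \<Rightarrow> bool) measure)"
    by (rule prob_space.prob_space_completion[OF prob_space_coin])
  let ?D = "{r. r \<le> p \<and> P r}"
  obtain J where J: "J \<subseteq> ?D" "countable J" "\<And>r. r \<in> ?D \<Longrightarrow> coin_null (rep r - (\<Union>j\<in>J. rep j))"
    using c.countable_exhaustion[of ?D rep] rep_completion by metis
  let ?U = "\<Union>j\<in>J. rep j"
  have U: "?U \<in> sets borel" using J(2) rep_borel by (intro sets.countable_UN'') auto
  have "eventually (\<lambda>w. w \<in> ?U) (aef p)"
  proof (rule ccontr)
    assume "\<not> ?thesis"
    then have "\<not> eventually (\<lambda>w. w \<notin> - ?U) (aef p)" by simp
    with U obtain q where q: "q \<le> p" "eventually (\<lambda>w. w \<in> - ?U) (aef q)"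
      using restrict_condition[of "- ?U" p] by (metis borel_comp)
    obtain r where r: "r \<le> q" "P r" using assms[OF q(1)] by blast
    then have "eventually (\<lambda>w. w \<in> ?U) (aef r)"
      using J(3)[of r] q(1) by (simp add: eventually_aef set_diff_eq)
    moreover have "eventually (\<lambda>w. w \<in> - ?U) (aef r)" using aef_mono[OF q(2) r(1)] .
    ultimately have "eventually (\<lambda>w. False) (aef r)" by eventually_elim simp
    then show False by simp
  qed
  then show ?thesis using J by (intro that[of J]) auto
qed

text \<open>A countable cover of \<open>p\<close> by conditions on which the property holds leaves
  only countably many exceptional null sets. Thus witnesses of forced existential statements may be
  fixed after strengthening the condition.\<close>

lemma aef_dense:
  assumes "\<And>q. q \<le> p \<Longrightarrow> \<exists>r\<le>q. eventually Q (aef r)"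
  shows "eventually Q (aef p)"
proof -
  obtain J where J: "countable J" "\<And>r. r \<in> J \<Longrightarrow> r \<le> p \<and> eventually Q (aef r)"
    "eventually (\<lambda>w. \<exists>r\<in>J. w \<in> rep r) (aef p)"
    using countable_cover[of p "\<lambda>r. eventually Q (aef r)"] assms by blast
  have "coin_null (\<Union>r\<in>J. {w \<in> rep r. \<not> Q w})"
    using J by (intro coin_null_UN) (auto simp: eventually_aef)
  with J(3)[unfolded eventually_aef] show ?thesis
    unfolding eventually_aef by (rule coin_null_subset2) auto
qed

section \<open>Regular formulas and their truth values\<close>

text \<open>These are the fixed points of double negation, that is, the regular open sets of
  conditions. For them the implication defined from conjunction and negation has its usual meaning
  at a condition.\<close>

definition reg :: "'p::order formula \<Rightarrow> bool" where
  "reg \<phi> \<longleftrightarrow> (\<forall>p. \<phi> p \<longleftrightarrow> (\<forall>q\<le>p. \<exists>r\<le>q. \<phi> r))"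

lemma reg_mono: "reg \<phi> \<Longrightarrow> \<phi> p \<Longrightarrow> q \<le> p \<Longrightarrow> \<phi> q"
  unfolding reg_def by (meson order_trans)

lemma reg_dense: "reg \<phi> \<Longrightarrow> (\<And>q. q \<le> p \<Longrightarrow> \<exists>r\<le>q. \<phi> r) \<Longrightarrow> \<phi> p"
  unfolding reg_def by blast

lemma regI:
  "(\<And>p q. \<phi> p \<Longrightarrow> q \<le> p \<Longrightarrow> \<phi> q) \<Longrightarrow> (\<And>p. (\<And>q. q \<le> p \<Longrightarrow> \<exists>r\<le>q. \<phi> r) \<Longrightarrow> \<phi> p) \<Longrightarrow> reg \<phi>"
  unfolding reg_def by (meson order_refl)

lemma reg_and: "reg \<phi> \<Longrightarrow> reg \<psi> \<Longrightarrow> reg (\<phi> \<^bold>\<and> \<psi>)"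
proof (rule regI)
  assume r: "reg \<phi>" "reg \<psi>"
  fix p assume *: "\<And>q. q \<le> p \<Longrightarrow> \<exists>r\<le>q. (\<phi> \<^bold>\<and> \<psi>) r"
  have "\<phi> p" by (rule reg_dense[OF r(1)]) (use * in \<open>unfold forces_and_def, blast\<close>)
  moreover have "\<psi> p" by (rule reg_dense[OF r(2)]) (use * in \<open>unfold forces_and_def, blast\<close>)
  ultimately show "(\<phi> \<^bold>\<and> \<psi>) p" by (simp add: forces_and_def)
qed (auto simp: forces_and_def intro: reg_mono)

lemma reg_not: "reg \<phi> \<Longrightarrow> reg (\<^bold>\<not> \<phi>)"
proof (rule regI)
  assume r: "reg \<phi>"
  fix p assume *: "\<And>q. q \<le> p \<Longrightarrow> \<exists>r\<le>q. (\<^bold>\<not> \<phi>) r"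
  then show "(\<^bold>\<not> \<phi>) p" unfolding forces_not_def by (meson r reg_mono order_refl)
qed (auto simp: forces_not_def intro: order_trans)

lemma reg_all: "(\<And>x. reg (\<phi> x)) \<Longrightarrow> reg (\<^bold>\<forall>x. \<phi> x)"
proof (rule regI)
  assume r: "\<And>x. reg (\<phi> x)"
  fix p assume *: "\<And>q. q \<le> p \<Longrightarrow> \<exists>r\<le>q. (\<^bold>\<forall>x. \<phi> x) r"
  have "\<phi> x p" for x by (rule reg_dense[OF r]) (use * in \<open>unfold forces_all_def, blast\<close>)
  then show "(\<^bold>\<forall>x. \<phi> x) p" by (simp add: forces_all_def)
qed (auto simp: forces_all_def intro: reg_mono)

lemma reg_ground: "reg (ground P)"
  by (auto simp: reg_def ground_def)

lemmas reg_intros = reg_and reg_not reg_all reg_ground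

lemma and_iff: "(\<phi> \<^bold>\<and> \<psi>) p \<longleftrightarrow> \<phi> p \<and> \<psi> p"
  by (simp add: forces_and_def)

lemma all_iff: "(\<^bold>\<forall>x. \<phi> x) p \<longleftrightarrow> (\<forall>x. \<phi> x p)"
  by (simp add: forces_all_def)

lemma ex_iff: "(\<^bold>\<exists>x. \<phi> x) p \<longleftrightarrow> (\<forall>q\<le>p. \<exists>r\<le>q. \<exists>x. \<phi> x r)"
  unfolding forces_not_def forces_all_def by blast

lemma ex_intro: "\<phi> x p \<Longrightarrow> reg (\<phi> x) \<Longrightarrow> (\<^bold>\<exists>x. \<phi> x) p"
  unfolding ex_iff using reg_mono by blast

lemma or_iff: "(\<phi> \<^bold>\<or> \<psi>) p \<longleftrightarrow> (\<forall>q\<le>p. \<exists>r\<le>q. \<phi> r \<or> \<psi> r)"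
  by (auto simp: forces_not_def forces_and_def)

lemma imp_iff: "reg \<phi> \<Longrightarrow> reg \<psi> \<Longrightarrow> (\<phi> \<^bold>\<longrightarrow> \<psi>) p \<longleftrightarrow> (\<forall>q\<le>p. \<phi> q \<longrightarrow> \<psi> q)"
proof
  assume r: "reg \<phi>" "reg \<psi>" and *: "(\<phi> \<^bold>\<longrightarrow> \<psi>) p"
  show "\<forall>q\<le>p. \<phi> q \<longrightarrow> \<psi> q"
  proof (intro allI impI)
    fix q assume q: "q \<le> p" "\<phi> q"
    show "\<psi> q"
    proof (rule reg_dense[OF r(2)])
      fix q' assume "q' \<le> q"
      then show "\<exists>r\<le>q'. \<psi> r"
        using * q r(1) unfolding forces_not_def forces_and_def by (meson order_trans reg_mono)
    qed
  qed
qed (auto simp: forces_not_def forces_and_def)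

lemma iff_iff: "reg \<phi> \<Longrightarrow> reg \<psi> \<Longrightarrow> (\<phi> \<^bold>\<longleftrightarrow> \<psi>) p \<longleftrightarrow> (\<forall>q\<le>p. \<phi> q \<longleftrightarrow> \<psi> q)"
  by (auto simp: and_iff imp_iff)

section \<open>Truth values of formulas as Borel sets\<close>

definition tv :: "'k random formula \<Rightarrow> ('k \<Rightarrow> bool) set" where
  "tv \<phi> = (SOME X. X \<in> sets borel \<and> (\<forall>p. \<phi> p \<longleftrightarrow> eventually (\<lambda>w. w \<in> X) (aef p)))"

text \<open>The truth value is a union of countably many conditions that exhaust all conditions
  forcing the formula. Conversely, if a condition is almost contained in the union, each of its
  extensions meets a member of it in positive measure, and regularity concludes.\<close>

lemma tv_exists:
  fixes \<phi> :: "'k random formula"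
  assumes "reg \<phi>"
  shows "\<exists>X. X \<in> sets borel \<and> (\<forall>p. \<phi> p \<longleftrightarrow> eventually (\<lambda>w. w \<in> X) (aef p))"
proof -
  interpret c: prob_space "completion (coin_space :: ('k \<Rightarrow> bool) measure)"
    by (rule prob_space.prob_space_completion[OF prob_space_coin])
  obtain J where J: "J \<subseteq> {p. \<phi> p}" "countable J" "\<And>r. \<phi> r \<Longrightarrow> coin_null (rep r - (\<Union>j\<in>J. rep j))"
    using c.countable_exhaustion[of "{p. \<phi> p}" rep] rep_completion by (metis mem_Collect_eq)
  let ?U = "\<Union>j\<in>J. rep j"
  have U: "?U \<in> sets borel" using J(2) rep_borel by (intro sets.countable_UN'') auto
  moreover have "\<phi> p \<longleftrightarrow> eventually (\<lambda>w. w \<in> ?U) (aef p)" for p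
  proof
    assume "\<phi> p"
    then show "eventually (\<lambda>w. w \<in> ?U) (aef p)" using J(3)[of p] by (simp add: eventually_aef set_diff_eq)
  next
    assume ev: "eventually (\<lambda>w. w \<in> ?U) (aef p)"
    show "\<phi> p"
    proof (rule reg_dense[OF assms])
      fix q assume q: "q \<le> p"
      have "\<exists>j\<in>J. \<not> eventually (\<lambda>w. w \<notin> rep j) (aef q)"
      proof (rule ccontr)
        assume "\<not> ?thesis"
        then have "eventually (\<lambda>w. \<forall>j\<in>J. w \<notin> rep j) (aef q)"
          by (intro aef_ball_countable J) auto
        with aef_mono[OF ev q] have "eventually (\<lambda>w. False) (aef q)" by eventually_elim auto
        then show False by simp
      qed
      then obtain j where j: "j \<in> J" "\<not> eventually (\<lambda>w. w \<notin> rep j) (aef q)" by blast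
      then obtain r where "r \<le> q" "eventually (\<lambda>w. w \<in> rep j) (aef r)"
        using restrict_condition[OF rep_borel, of j q] by blast
      then show "\<exists>r\<le>q. \<phi> r" using j J(1) reg_mono[OF assms] le_aef_iff by blast
    qed
  qed
  ultimately show ?thesis by blast
qed

lemma tv_borel: "reg \<phi> \<Longrightarrow> tv \<phi> \<in> sets borel"
  and tv_iff: "reg \<phi> \<Longrightarrow> \<phi> p \<longleftrightarrow> eventually (\<lambda>w. w \<in> tv \<phi>) (aef p)"
  using someI_ex[OF tv_exists, of \<phi>] unfolding tv_def by blast+

text \<open>Truth values are chosen by \<open>SOME\<close> and determined only up to null sets. If
  two candidates differed on a part of \<open>p\<close> of positive measure, a condition inside the
  difference would be almost contained in only one of them, although the same conditions are almost
  contained in both.\<close>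

lemma tv_unique:
  assumes "reg \<phi>" "Y \<in> sets borel" "\<And>p. \<phi> p \<longleftrightarrow> eventually (\<lambda>w. w \<in> Y) (aef p)"
  shows "eventually (\<lambda>w. w \<in> tv \<phi> \<longleftrightarrow> w \<in> Y) (aef p)"
proof -
  have sub: "eventually (\<lambda>w. w \<notin> X - Y) (aef p)"
    if "X \<in> sets borel" "Y \<in> sets borel" "\<And>p. eventually (\<lambda>w. w \<in> X) (aef p) \<Longrightarrow> eventually (\<lambda>w. w \<in> Y) (aef p)" for X Y
  proof (rule ccontr)
    assume "\<not> ?thesis"
    then obtain q where "eventually (\<lambda>w. w \<in> X - Y) (aef q)"
      using restrict_condition[of "X - Y" p] \<open>X \<in> sets borel\<close> \<open>Y \<in> sets borel\<close> by blast
    then have "eventually (\<lambda>w. w \<in> X) (aef q)" and n: "eventually (\<lambda>w. w \<notin> Y) (aef q)"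
      by (auto elim: eventually_mono)
    then have "eventually (\<lambda>w. w \<in> Y) (aef q)" using that(3) by blast
    with n have "eventually (\<lambda>w. False) (aef q)" by eventually_elim blast
    then show False by simp
  qed
  have "eventually (\<lambda>w. w \<notin> tv \<phi> - Y) (aef p)" "eventually (\<lambda>w. w \<notin> Y - tv \<phi>) (aef p)"
    using tv_borel[OF assms(1)] tv_iff[OF assms(1)] assms(2,3) by (intro sub; blast)+
  then show ?thesis by eventually_elim blast
qed

text \<open>\<open>sem \<phi> Q\<close>: at almost every point of \<open>2\<^sup>\<kappa>\<close>, \<open>Q\<close> is the truth value of \<open>\<phi>\<close>. Almost every point is generic for
  countably many formulas, so that connectives and countable quantifiers are evaluated pointwise.\<close>

definition sem :: "'k random formula \<Rightarrow> (('k \<Rightarrow> bool) \<Rightarrow> bool) \<Rightarrow> bool" where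
  "sem \<phi> Q \<longleftrightarrow> reg \<phi> \<and> (\<forall>p. eventually (\<lambda>w. w \<in> tv \<phi> \<longleftrightarrow> Q w) (aef p))"

lemma sem_reg: "sem \<phi> Q \<Longrightarrow> reg \<phi>" by (simp add: sem_def)

lemma sem_tv: "sem \<phi> Q \<Longrightarrow> eventually (\<lambda>w. w \<in> tv \<phi> \<longleftrightarrow> Q w) (aef p)" by (simp add: sem_def)

lemma semD: "sem \<phi> Q \<Longrightarrow> \<phi> p \<longleftrightarrow> eventually Q (aef p)"
  using eventually_subst[OF sem_tv] tv_iff[OF sem_reg] by blast

lemma sem_self: "reg \<phi> \<Longrightarrow> sem \<phi> (\<lambda>w. w \<in> tv \<phi>)"
  by (simp add: sem_def)

lemma sem_ground: "sem (ground P :: 'k random formula) (\<lambda>_. P)"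
proof -
  have "ground P p \<longleftrightarrow> eventually (\<lambda>w. w \<in> (if P then UNIV else {})) (aef p)" for p :: "'k random"
    by (simp add: ground_def)
  from tv_unique[OF reg_ground _ this] show ?thesis by (cases P) (simp_all add: sem_def reg_ground)
qed

lemma sem_and: assumes "sem \<phi> Q" "sem \<psi> R" shows "sem (\<phi> \<^bold>\<and> \<psi>) (\<lambda>w. Q w \<and> R w)"
proof -
  note r = assms[THEN sem_reg]
  have "(\<phi> \<^bold>\<and> \<psi>) p \<longleftrightarrow> eventually (\<lambda>w. w \<in> tv \<phi> \<inter> tv \<psi>) (aef p)" for p
    by (simp add: and_iff tv_iff[OF r(1)] tv_iff[OF r(2)] eventually_conj_iff)
  from tv_unique[OF reg_and[OF r] _ this] tv_borel[OF r(1)] tv_borel[OF r(2)]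
  have "eventually (\<lambda>w. w \<in> tv (\<phi> \<^bold>\<and> \<psi>) \<longleftrightarrow> w \<in> tv \<phi> \<inter> tv \<psi>) (aef p)" for p by auto
  then have "eventually (\<lambda>w. w \<in> tv (\<phi> \<^bold>\<and> \<psi>) \<longleftrightarrow> Q w \<and> R w) (aef p)" for p
    using sem_tv[OF assms(1), of p] sem_tv[OF assms(2), of p] by eventually_elim auto
  then show ?thesis using reg_and[OF r] by (simp add: sem_def)
qed

lemma sem_not: assumes "sem \<phi> Q" shows "sem (\<^bold>\<not> \<phi>) (\<lambda>w. \<not> Q w)"
proof -
  note r = assms[THEN sem_reg]
  have "(\<^bold>\<not> \<phi>) p \<longleftrightarrow> eventually (\<lambda>w. w \<in> - tv \<phi>) (aef p)" for p
  proof
    assume n: "(\<^bold>\<not> \<phi>) p"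
    show "eventually (\<lambda>w. w \<in> - tv \<phi>) (aef p)"
    proof (rule ccontr)
      assume "\<not> ?thesis"
      then have "\<not> eventually (\<lambda>w. w \<notin> tv \<phi>) (aef p)" by simp
      then obtain q where "q \<le> p" "eventually (\<lambda>w. w \<in> tv \<phi>) (aef q)"
        by (rule restrict_condition[OF tv_borel[OF r]])
      then show False using n tv_iff[OF r] by (auto simp: forces_not_def)
    qed
  next
    assume ev: "eventually (\<lambda>w. w \<in> - tv \<phi>) (aef p)"
    show "(\<^bold>\<not> \<phi>) p" unfolding forces_not_def
    proof (intro allI impI notI)
      fix q assume "q \<le> p" "\<phi> q"
      with aef_mono[OF ev] tv_iff[OF r] have "eventually (\<lambda>w. w \<in> - tv \<phi>) (aef q)" "eventually (\<lambda>w. w \<in> tv \<phi>) (aef q)"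
        by blast+
      then have "eventually (\<lambda>w. False) (aef q)" by eventually_elim blast
      then show False by simp
    qed
  qed
  from tv_unique[OF reg_not[OF r] _ this] tv_borel[OF r]
  have "eventually (\<lambda>w. w \<in> tv (\<^bold>\<not> \<phi>) \<longleftrightarrow> w \<in> - tv \<phi>) (aef p)" for p by auto
  then have "eventually (\<lambda>w. w \<in> tv (\<^bold>\<not> \<phi>) \<longleftrightarrow> \<not> Q w) (aef p)" for p
    using sem_tv[OF assms(1), of p] by eventually_elim auto
  then show ?thesis using reg_not[OF r] by (simp add: sem_def)
qed

text \<open>Countability of the index type makes the intersection of the truth values Borel and lets
  the exceptional null sets add up to a null set.\<close>

lemma sem_all:
  fixes \<phi> :: "'c::countable \<Rightarrow> 'k random formula"
  assumes "\<And>x. sem (\<phi> x) (Q x)" shows "sem (\<^bold>\<forall>x. \<phi> x) (\<lambda>w. \<forall>x. Q x w)"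
proof -
  note r = assms[THEN sem_reg]
  have A: "(\<^bold>\<forall>x. \<phi> x) p \<longleftrightarrow> eventually (\<lambda>w. w \<in> (\<Inter>x. tv (\<phi> x))) (aef p)" for p
  proof
    assume "(\<^bold>\<forall>x. \<phi> x) p"
    then have "eventually (\<lambda>w. \<forall>x. w \<in> tv (\<phi> x)) (aef p)"
      by (intro aef_all_countable) (simp add: all_iff tv_iff[OF r])
    then show "eventually (\<lambda>w. w \<in> (\<Inter>x. tv (\<phi> x))) (aef p)" by simp
  next
    assume "eventually (\<lambda>w. w \<in> (\<Inter>x. tv (\<phi> x))) (aef p)"
    then have "eventually (\<lambda>w. w \<in> tv (\<phi> x)) (aef p)" for x by eventually_elim blast
    then show "(\<^bold>\<forall>x. \<phi> x) p" by (simp add: all_iff tv_iff[OF r])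
  qed
  have "(\<Inter>x. tv (\<phi> x)) \<in> sets borel"
    by (rule sets.countable_INT'') (auto simp: tv_borel[OF r])
  then have "eventually (\<lambda>w. w \<in> tv (\<^bold>\<forall>x. \<phi> x) \<longleftrightarrow> w \<in> (\<Inter>x. tv (\<phi> x))) (aef p)" for p
    by (rule tv_unique[OF reg_all[OF r] _ A])
  moreover have "eventually (\<lambda>w. \<forall>x. w \<in> tv (\<phi> x) \<longleftrightarrow> Q x w) (aef p)" for p
    by (rule aef_all_countable) (rule sem_tv[OF assms])
  ultimately have "eventually (\<lambda>w. w \<in> tv (\<^bold>\<forall>x. \<phi> x) \<longleftrightarrow> (\<forall>x. Q x w)) (aef p)" for p
    by (rule eventually_elim2) simp
  then show ?thesis using reg_all[OF r] by (simp add: sem_def)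
qed

lemma sem_eq: "sem \<phi> Q \<Longrightarrow> Q = R \<Longrightarrow> sem \<phi> R" by simp

lemma sem_or: assumes "sem \<phi> Q" "sem \<psi> R" shows "sem (\<phi> \<^bold>\<or> \<psi>) (\<lambda>w. Q w \<or> R w)"
  using sem_not[OF sem_and[OF sem_not[OF assms(1)] sem_not[OF assms(2)]]] by simp

lemma sem_imp: assumes "sem \<phi> Q" "sem \<psi> R" shows "sem (\<phi> \<^bold>\<longrightarrow> \<psi>) (\<lambda>w. Q w \<longrightarrow> R w)"
  using sem_not[OF sem_and[OF assms(1) sem_not[OF assms(2)]]] by simp

lemma sem_iff: assumes "sem \<phi> Q" "sem \<psi> R" shows "sem (\<phi> \<^bold>\<longleftrightarrow> \<psi>) (\<lambda>w. Q w \<longleftrightarrow> R w)"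
  using sem_and[OF sem_imp[OF assms] sem_imp[OF assms(2,1)]] by (rule sem_eq) auto

lemma sem_ex:
  assumes "\<And>x::'c::countable. sem (\<phi> x) (Q x)" shows "sem (\<^bold>\<exists>x. \<phi> x) (\<lambda>w. \<exists>x. Q x w)"
  using sem_not[OF sem_all[OF sem_not[OF assms]]] by simp

text \<open>Below any condition either the formula fails almost everywhere or part of its truth
  value is again a condition, at which the premise applies. So hypothetical reasoning at conditions
  becomes a pointwise implication.\<close>

lemma aef_impI:
  assumes "reg \<phi>" "\<And>q. q \<le> p \<Longrightarrow> \<phi> q \<Longrightarrow> eventually Q (aef q)"
  shows "eventually (\<lambda>w. w \<in> tv \<phi> \<longrightarrow> Q w) (aef p)"
proof (rule aef_dense)
  fix q assume q: "q \<le> p"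
  show "\<exists>r\<le>q. eventually (\<lambda>w. w \<in> tv \<phi> \<longrightarrow> Q w) (aef r)"
  proof (cases "eventually (\<lambda>w. w \<notin> tv \<phi>) (aef q)")
    case True
    then show ?thesis by (intro exI[of _ q]) (auto elim: eventually_mono)
  next
    case False
    then obtain r where r: "r \<le> q" "eventually (\<lambda>w. w \<in> tv \<phi>) (aef r)"
      by (rule restrict_condition[OF tv_borel[OF assms(1)]])
    then have "eventually Q (aef r)" using assms(2)[OF order_trans[OF r(1) q]] tv_iff[OF assms(1)] by blast
    then show ?thesis using r(1) by (intro exI[of _ r]) (auto elim: eventually_mono)
  qed
qed

section \<open>Equality and membership in the forcing language\<close>

lemma forces_eq_unfold:
  "(\<sigma> \<^bold>= \<tau>) p \<longleftrightarrow>
     (\<forall>\<sigma>' s q. (\<sigma>', s) \<in> elts \<sigma> \<longrightarrow> q \<le> p \<longrightarrow> q \<le> s \<longrightarrow>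
        (\<exists>r\<le>q. \<exists>\<tau>' t. (\<tau>', t) \<in> elts \<tau> \<and> r \<le> t \<and> (\<sigma>' \<^bold>= \<tau>') r)) \<and>
     (\<forall>\<tau>' t q. (\<tau>', t) \<in> elts \<tau> \<longrightarrow> q \<le> p \<longrightarrow> q \<le> t \<longrightarrow>
        (\<exists>r\<le>q. \<exists>\<sigma>' s. (\<sigma>', s) \<in> elts \<sigma> \<and> r \<le> s \<and> (\<sigma>' \<^bold>= \<tau>') r))"
  by (subst forces_eq.simps)
    (simp only: Ball_def Bex_def split_paired_All split_paired_Ex prod.case, simp only: imp_conjL, simp only: all_simps)

lemma forces_mem_unfold:
  "(\<sigma> \<^bold>\<in> \<tau>) p \<longleftrightarrow> (\<forall>q\<le>p. \<exists>r\<le>q. \<exists>\<tau>' t. (\<tau>', t) \<in> elts \<tau> \<and> r \<le> t \<and> (\<sigma> \<^bold>= \<tau>') r)"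
  unfolding forces_mem_def by (simp only: Bex_def split_paired_Ex prod.case)

lemma eq_mono: "(\<sigma> \<^bold>= \<tau>) p \<Longrightarrow> q \<le> p \<Longrightarrow> (\<sigma> \<^bold>= \<tau>) q"
  unfolding forces_eq_unfold[of \<sigma> \<tau>] using order_trans[of _ q p] by blast

lemma reg_eq: "reg (\<sigma> \<^bold>= \<tau>)"
proof (rule regI)
  fix p assume *: "\<And>q. q \<le> p \<Longrightarrow> \<exists>r\<le>q. (\<sigma> \<^bold>= \<tau>) r"
  show "(\<sigma> \<^bold>= \<tau>) p"
    unfolding forces_eq_unfold[of \<sigma> \<tau>]
  proof (intro conjI allI impI)
    fix \<sigma>' s q assume a: "(\<sigma>', s) \<in> elts \<sigma>" "q \<le> p" "q \<le> s"
    obtain r where r: "r \<le> q" "(\<sigma> \<^bold>= \<tau>) r" using *[OF a(2)] by blast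
    then have "\<exists>r'\<le>r. \<exists>\<tau>' t. (\<tau>', t) \<in> elts \<tau> \<and> r' \<le> t \<and> (\<sigma>' \<^bold>= \<tau>') r'"
      using a order_trans[OF r(1) a(3)] forces_eq_unfold[of \<sigma> \<tau> r] by blast
    then show "\<exists>r\<le>q. \<exists>\<tau>' t. (\<tau>', t) \<in> elts \<tau> \<and> r \<le> t \<and> (\<sigma>' \<^bold>= \<tau>') r" using r(1) order_trans by blast
  next
    fix \<tau>' t q assume a: "(\<tau>', t) \<in> elts \<tau>" "q \<le> p" "q \<le> t"
    obtain r where r: "r \<le> q" "(\<sigma> \<^bold>= \<tau>) r" using *[OF a(2)] by blast
    then have "\<exists>r'\<le>r. \<exists>\<sigma>' s. (\<sigma>', s) \<in> elts \<sigma> \<and> r' \<le> s \<and> (\<sigma>' \<^bold>= \<tau>') r'"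
      using a order_trans[OF r(1) a(3)] forces_eq_unfold[of \<sigma> \<tau> r] by blast
    then show "\<exists>r\<le>q. \<exists>\<sigma>' s. (\<sigma>', s) \<in> elts \<sigma> \<and> r \<le> s \<and> (\<sigma>' \<^bold>= \<tau>') r" using r(1) order_trans by blast
  qed
qed (rule eq_mono)

lemma reg_mem: "reg (\<sigma> \<^bold>\<in> \<tau>)"
proof (rule regI)
  fix p q assume "(\<sigma> \<^bold>\<in> \<tau>) p" "q \<le> p"
  then show "(\<sigma> \<^bold>\<in> \<tau>) q" unfolding forces_mem_unfold[of \<sigma> \<tau>] using order_trans[of _ q p] by blast
next
  fix p assume *: "\<And>q. q \<le> p \<Longrightarrow> \<exists>r\<le>q. (\<sigma> \<^bold>\<in> \<tau>) r"
  show "(\<sigma> \<^bold>\<in> \<tau>) p" unfolding forces_mem_unfold[of \<sigma> \<tau> p]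
  proof (intro allI impI)
    fix q assume "q \<le> p"
    then obtain r where r: "r \<le> q" "(\<sigma> \<^bold>\<in> \<tau>) r" using * by blast
    then have "\<exists>r'\<le>r. \<exists>\<tau>' t. (\<tau>', t) \<in> elts \<tau> \<and> r' \<le> t \<and> (\<sigma> \<^bold>= \<tau>') r'"
      unfolding forces_mem_unfold[of \<sigma> \<tau> r] by blast
    then show "\<exists>r\<le>q. \<exists>\<tau>' t. (\<tau>', t) \<in> elts \<tau> \<and> r \<le> t \<and> (\<sigma> \<^bold>= \<tau>') r"
      using order_trans[OF _ r(1)] by blast
  qed
qed

lemma eq_refl: "(\<sigma> \<^bold>= \<sigma>) p"
proof (induction \<sigma> arbitrary: p rule: wf_induct_rule[OF wf_elts])
  case (1 \<sigma>)
  then show ?case unfolding forces_eq_unfold[of \<sigma> \<sigma>] by blast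
qed

lemma eq_sym: "(\<sigma> \<^bold>= \<tau>) p \<Longrightarrow> (\<tau> \<^bold>= \<sigma>) p"
proof -
  have "(\<sigma> \<^bold>= \<tau>) p \<longleftrightarrow> (\<tau> \<^bold>= \<sigma>) p"
  proof (induction \<sigma> arbitrary: \<tau> p rule: wf_induct_rule[OF wf_elts])
    case (1 \<sigma>)
    then have "(\<sigma>' \<^bold>= \<tau>') p \<longleftrightarrow> (\<tau>' \<^bold>= \<sigma>') p" if "(\<sigma>', s) \<in> elts \<sigma>" for \<sigma>' s \<tau>' p using that by blast
    then have A: "(\<exists>\<sigma>' s. (\<sigma>', s) \<in> elts \<sigma> \<and> r \<le> s \<and> (\<sigma>' \<^bold>= \<tau>') r) \<longleftrightarrow>
        (\<exists>\<sigma>' s. (\<sigma>', s) \<in> elts \<sigma> \<and> r \<le> s \<and> (\<tau>' \<^bold>= \<sigma>') r)"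
      and B: "(\<sigma>', s) \<in> elts \<sigma> \<Longrightarrow> (\<exists>\<tau>' t. (\<tau>', t) \<in> elts \<tau> \<and> r \<le> t \<and> (\<sigma>' \<^bold>= \<tau>') r) \<longleftrightarrow>
        (\<exists>\<tau>' t. (\<tau>', t) \<in> elts \<tau> \<and> r \<le> t \<and> (\<tau>' \<^bold>= \<sigma>') r)" for r \<tau>' \<sigma>' s by blast+
    show ?case unfolding forces_eq_unfold[of \<sigma> \<tau>] forces_eq_unfold[of \<tau> \<sigma>]
      by (subst conj_commute) (simp add: A B cong: conj_cong imp_cong)
  qed
  then show "(\<sigma> \<^bold>= \<tau>) p \<Longrightarrow> (\<tau> \<^bold>= \<sigma>) p" by blast
qed

text \<open>Induction on the first name alone suffices, with the other two arbitrary: in both halves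
  of extensionality the induction hypothesis is used at an element of the first name.\<close>

lemma eq_trans: "(\<sigma> \<^bold>= \<tau>) p \<Longrightarrow> (\<tau> \<^bold>= \<rho>) p \<Longrightarrow> (\<sigma> \<^bold>= \<rho>) p"
proof (induction \<sigma> arbitrary: \<tau> \<rho> p rule: wf_induct_rule[OF wf_elts])
  case (1 \<sigma>)
  then have IH: "(\<sigma>' \<^bold>= \<tau>') p \<Longrightarrow> (\<tau>' \<^bold>= \<rho>') p \<Longrightarrow> (\<sigma>' \<^bold>= \<rho>') p"
    if "(\<sigma>', s) \<in> elts \<sigma>" for \<sigma>' s \<tau>' \<rho>' p using that by blast
  show ?case unfolding forces_eq_unfold[of \<sigma> \<rho>]
  proof (intro conjI allI impI)
    fix \<sigma>' s q assume a: "(\<sigma>', s) \<in> elts \<sigma>" "q \<le> p" "q \<le> s"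
    obtain r \<tau>' t where r: "r \<le> q" "(\<tau>', t) \<in> elts \<tau>" "r \<le> t" "(\<sigma>' \<^bold>= \<tau>') r"
      using a 1(2) unfolding forces_eq_unfold[of \<sigma> \<tau>] by meson
    have "r \<le> p" using r(1) a(2) by (rule order_trans)
    then obtain r' \<rho>' u where r': "r' \<le> r" "(\<rho>', u) \<in> elts \<rho>" "r' \<le> u" "(\<tau>' \<^bold>= \<rho>') r'"
      using r 1(3) unfolding forces_eq_unfold[of \<tau> \<rho>] by meson
    have "(\<sigma>' \<^bold>= \<rho>') r'" using IH[OF a(1) eq_mono[OF r(4) r'(1)] r'(4)] .
    then show "\<exists>r\<le>q. \<exists>\<tau>' t. (\<tau>', t) \<in> elts \<rho> \<and> r \<le> t \<and> (\<sigma>' \<^bold>= \<tau>') r"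
      using r' order_trans[OF r'(1) r(1)] by blast
  next
    fix \<rho>' u q assume a: "(\<rho>', u) \<in> elts \<rho>" "q \<le> p" "q \<le> u"
    obtain r \<tau>' t where r: "r \<le> q" "(\<tau>', t) \<in> elts \<tau>" "r \<le> t" "(\<tau>' \<^bold>= \<rho>') r"
      using a 1(3) unfolding forces_eq_unfold[of \<tau> \<rho>] by meson
    have "r \<le> p" using r(1) a(2) by (rule order_trans)
    then obtain r' \<sigma>' s where r': "r' \<le> r" "(\<sigma>', s) \<in> elts \<sigma>" "r' \<le> s" "(\<sigma>' \<^bold>= \<tau>') r'"
      using r 1(2) unfolding forces_eq_unfold[of \<sigma> \<tau>] by meson
    have "(\<sigma>' \<^bold>= \<rho>') r'" using IH[OF r'(2) r'(4) eq_mono[OF r(4) r'(1)]] .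
    then show "\<exists>r\<le>q. \<exists>\<sigma>' s. (\<sigma>', s) \<in> elts \<sigma> \<and> r \<le> s \<and> (\<sigma>' \<^bold>= \<rho>') r"
      using r' order_trans[OF r'(1) r(1)] by blast
  qed
qed

lemma mem_cong1: "(\<sigma> \<^bold>= \<sigma>') p \<Longrightarrow> (\<sigma> \<^bold>\<in> \<tau>) p \<Longrightarrow> (\<sigma>' \<^bold>\<in> \<tau>) p"
proof (rule reg_dense[OF reg_mem])
  assume a: "(\<sigma> \<^bold>= \<sigma>') p" "(\<sigma> \<^bold>\<in> \<tau>) p"
  fix q assume q: "q \<le> p"
  have "(\<sigma>' \<^bold>= \<tau>') r" if "(\<sigma> \<^bold>= \<tau>') r" "r \<le> q" for \<tau>' r
    by (rule eq_trans[OF eq_sym[OF eq_mono[OF a(1) order_trans[OF that(2) q]]] that(1)])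
  then have "(\<sigma>' \<^bold>\<in> \<tau>) q"
    using reg_mono[OF reg_mem a(2) q] unfolding forces_mem_unfold[of _ \<tau>] using order_trans[of _ _ q] by blast
  then show "\<exists>r\<le>q. (\<sigma>' \<^bold>\<in> \<tau>) r" by blast
qed

lemma elts_mem: "(\<sigma>, s) \<in> elts \<tau> \<Longrightarrow> p \<le> s \<Longrightarrow> (\<sigma> \<^bold>\<in> \<tau>) p"
  unfolding forces_mem_unfold[of _ \<tau>] using eq_refl order_trans[of _ p s] by blast

lemma mem_cong2: assumes "(\<tau> \<^bold>= \<tau>') p" "(\<sigma> \<^bold>\<in> \<tau>) p" shows "(\<sigma> \<^bold>\<in> \<tau>') p"
proof (rule reg_dense[OF reg_mem])
  fix q assume q: "q \<le> p"
  then obtain r \<rho> t where r: "r \<le> q" "(\<rho>, t) \<in> elts \<tau>" "r \<le> t" "(\<sigma> \<^bold>= \<rho>) r"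
    using assms(2) unfolding forces_mem_unfold[of _ \<tau>] by meson
  have "r \<le> p" using r(1) q by (rule order_trans)
  then obtain r' \<rho>' u where r': "r' \<le> r" "(\<rho>', u) \<in> elts \<tau>'" "r' \<le> u" "(\<rho> \<^bold>= \<rho>') r'"
    using r assms(1) unfolding forces_eq_unfold[of \<tau> \<tau>'] by meson
  have "(\<rho>' \<^bold>\<in> \<tau>') r'" using r' elts_mem by blast
  moreover have "(\<rho>' \<^bold>= \<sigma>) r'" using eq_trans[OF eq_mono[OF r(4) r'(1)] r'(4)] eq_sym by blast
  ultimately have "(\<sigma> \<^bold>\<in> \<tau>') r'" using mem_cong1 by blast
  then show "\<exists>r\<le>q. (\<sigma> \<^bold>\<in> \<tau>') r" using order_trans[OF r'(1) r(1)] by blast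
qed

lemma eq_ext:
  assumes "\<And>x q. q \<le> p \<Longrightarrow> (x \<^bold>\<in> \<sigma>) q \<longleftrightarrow> (x \<^bold>\<in> \<tau>) q"
  shows "(\<sigma> \<^bold>= \<tau>) p"
  unfolding forces_eq_unfold[of \<sigma> \<tau>]
proof (intro conjI allI impI)
  fix \<sigma>' s q assume a: "(\<sigma>', s) \<in> elts \<sigma>" "q \<le> p" "q \<le> s"
  then have "(\<sigma>' \<^bold>\<in> \<tau>) q" using assms elts_mem by blast
  then show "\<exists>r\<le>q. \<exists>\<tau>' t. (\<tau>', t) \<in> elts \<tau> \<and> r \<le> t \<and> (\<sigma>' \<^bold>= \<tau>') r"
    unfolding forces_mem_unfold[of _ \<tau>] by blast
next
  fix \<tau>' t q assume a: "(\<tau>', t) \<in> elts \<tau>" "q \<le> p" "q \<le> t"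
  then have "(\<tau>' \<^bold>\<in> \<sigma>) q" using assms elts_mem by blast
  then show "\<exists>r\<le>q. \<exists>\<sigma>' s. (\<sigma>', s) \<in> elts \<sigma> \<and> r \<le> s \<and> (\<sigma>' \<^bold>= \<tau>') r"
    unfolding forces_mem_unfold[of _ \<sigma>] using eq_sym by blast
qed

section \<open>Unordered and ordered pairs\<close>

lemma reg_is_upair: "reg (is_upair z x y)"
  unfolding is_upair_def by (intro reg_intros reg_eq reg_mem)

lemma reg_is_pair: "reg (is_pair z x y)"
  unfolding is_pair_def by (intro reg_intros reg_is_upair)

lemma reg_app: "reg (app f x y)"
  unfolding app_def by (intro reg_intros reg_is_pair reg_mem)

lemma is_upair_iff:
  "is_upair z x y p \<longleftrightarrow> (\<forall>w. \<forall>q\<le>p. (w \<^bold>\<in> z) q \<longleftrightarrow> (w \<^bold>= x \<^bold>\<or> w \<^bold>= y) q)"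
  unfolding is_upair_def all_iff by (subst iff_iff) (intro reg_intros reg_eq reg_mem refl)+

lemma or_intro1: "reg \<phi> \<Longrightarrow> \<phi> p \<Longrightarrow> (\<phi> \<^bold>\<or> \<psi>) p"
  unfolding or_iff using reg_mono by blast

lemma or_intro2: "reg \<psi> \<Longrightarrow> \<psi> p \<Longrightarrow> (\<phi> \<^bold>\<or> \<psi>) p"
  unfolding or_iff using reg_mono by blast

lemma upair_mem1: "is_upair z x y p \<Longrightarrow> (x \<^bold>\<in> z) p"
  using or_intro1[OF reg_eq eq_refl] unfolding is_upair_iff by blast

lemma upair_mem2: "is_upair z x y p \<Longrightarrow> (y \<^bold>\<in> z) p"
  using or_intro2[OF reg_eq eq_refl] unfolding is_upair_iff by blast

lemma upairE:
  assumes "is_upair z x y p" "(w \<^bold>\<in> z) p"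
  obtains r where "r \<le> p" "(w \<^bold>= x) r \<or> (w \<^bold>= y) r"
proof -
  have "(w \<^bold>= x \<^bold>\<or> w \<^bold>= y) p" using assms unfolding is_upair_iff by blast
  then show ?thesis unfolding or_iff using that by blast
qed

lemma singleton_mem: "is_upair z x x p \<Longrightarrow> (w \<^bold>\<in> z) p \<Longrightarrow> (w \<^bold>= x) p"
  by (rule reg_dense[OF reg_eq]) (metis upairE reg_mono[OF reg_is_upair] reg_mono[OF reg_mem])

lemma eq_cong2: "(x \<^bold>= y) p \<Longrightarrow> (w \<^bold>= x) p \<longleftrightarrow> (w \<^bold>= y) p"
  using eq_trans eq_sym by blast

lemma mem_cong2_iff: "(x \<^bold>= y) p \<Longrightarrow> (w \<^bold>\<in> x) p \<longleftrightarrow> (w \<^bold>\<in> y) p"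
  using mem_cong2 eq_sym by blast

lemma upair_cong:
  assumes "is_upair z x y p" "(z \<^bold>= z') p" "(x \<^bold>= x') p" "(y \<^bold>= y') p"
  shows "is_upair z' x' y' p"
  unfolding is_upair_iff
proof (intro allI impI)
  fix w q assume q: "q \<le> p"
  have "(w \<^bold>\<in> z') q \<longleftrightarrow> (w \<^bold>\<in> z) q" using mem_cong2_iff[OF eq_mono[OF assms(2) q]] by blast
  also have "\<dots> \<longleftrightarrow> (w \<^bold>= x \<^bold>\<or> w \<^bold>= y) q" using assms(1) q unfolding is_upair_iff by blast
  also have "\<dots> \<longleftrightarrow> (w \<^bold>= x' \<^bold>\<or> w \<^bold>= y') q"
  proof -
    have "(w \<^bold>= x) r \<longleftrightarrow> (w \<^bold>= x') r" "(w \<^bold>= y) r \<longleftrightarrow> (w \<^bold>= y') r" if "r \<le> q" for r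
      using eq_cong2[OF eq_mono[OF assms(3) order_trans[OF that q]]]
        eq_cong2[OF eq_mono[OF assms(4) order_trans[OF that q]]] by blast+
    then have "(\<exists>r'\<le>r. (w \<^bold>= x) r' \<or> (w \<^bold>= y) r') \<longleftrightarrow> (\<exists>r'\<le>r. (w \<^bold>= x') r' \<or> (w \<^bold>= y') r')"
      if "r \<le> q" for r using order_trans[OF _ that] by blast
    then show ?thesis unfolding or_iff by blast
  qed
  finally show "(w \<^bold>\<in> z') q \<longleftrightarrow> (w \<^bold>= x' \<^bold>\<or> w \<^bold>= y') q" .
qed

lemma pairE:
  assumes "is_pair z x y p"
  obtains r u v where "r \<le> p" "is_upair u x x r" "is_upair v x y r" "is_upair z u v r"
proof -
  from assms obtain r1 u where 1: "r1 \<le> p" "(\<^bold>\<exists>v. is_upair u x x \<^bold>\<and> is_upair v x y \<^bold>\<and> is_upair z u v) r1"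
    unfolding is_pair_def ex_iff[of "\<lambda>u. \<^bold>\<exists>v. is_upair u x x \<^bold>\<and> is_upair v x y \<^bold>\<and> is_upair z u v"] by blast
  then obtain r2 v where "r2 \<le> r1" "(is_upair u x x \<^bold>\<and> is_upair v x y \<^bold>\<and> is_upair z u v) r2"
    unfolding ex_iff by blast
  then show ?thesis using that[of r2 u v] order_trans[OF _ 1(1)] by (auto simp: and_iff)
qed

lemma pairI:
  assumes "is_upair u x x p" "is_upair v x y p" "is_upair z u v p"
  shows "is_pair z x y p"
proof -
  have "(is_upair u x x \<^bold>\<and> is_upair v x y \<^bold>\<and> is_upair z u v) p" using assms by (simp add: and_iff)
  then have "(\<^bold>\<exists>v. is_upair u x x \<^bold>\<and> is_upair v x y \<^bold>\<and> is_upair z u v) p"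
    by (rule ex_intro[of "\<lambda>v. is_upair u x x \<^bold>\<and> is_upair v x y \<^bold>\<and> is_upair z u v"]) (intro reg_intros reg_is_upair)
  then show ?thesis unfolding is_pair_def
    by (rule ex_intro[of "\<lambda>u. \<^bold>\<exists>v. is_upair u x x \<^bold>\<and> is_upair v x y \<^bold>\<and> is_upair z u v"]) (intro reg_intros reg_is_upair)
qed

lemma pair_cong:
  assumes "is_pair z x y p" "(z \<^bold>= z') p" "(x \<^bold>= x') p" "(y \<^bold>= y') p"
  shows "is_pair z' x' y' p"
proof (rule reg_dense[OF reg_is_pair])
  fix q assume q: "q \<le> p"
  obtain r u v where r: "r \<le> q" "is_upair u x x r" "is_upair v x y r" "is_upair z u v r"
    using pairE[OF reg_mono[OF reg_is_pair assms(1) q]] .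
  note e = assms(2-4)[THEN eq_mono, OF order_trans[OF r(1) q]]
  have "is_pair z' x' y' r"
    using pairI[OF upair_cong[OF r(2) eq_refl e(2) e(2)] upair_cong[OF r(3) eq_refl e(2) e(3)]
        upair_cong[OF r(4) e(1) eq_refl eq_refl]] .
  then show "\<exists>r\<le>q. is_pair z' x' y' r" using r(1) by blast
qed

text \<open>The argument for Kuratowski pairs, carried out by density: membership in an unordered
  pair yields one of two equalities only after the condition is strengthened, so each case
  distinction passes to a smaller condition.\<close>

lemma upair_pair_inject:
  assumes u: "is_upair u x x p" and v: "is_upair v x y p" and z: "is_upair z u v p"
    and u': "is_upair u' x' x' p" and v': "is_upair v' x' y' p" and z': "is_upair z u' v' p"
  shows "(x \<^bold>= x') p" "(y \<^bold>= y') p"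
proof -
  note m = reg_mono[OF reg_is_upair] reg_mono[OF reg_mem]
  show x: "(x \<^bold>= x') p"
  proof (rule reg_dense[OF reg_eq])
    fix q assume q: "q \<le> p"
    obtain r where r: "r \<le> q" "(u \<^bold>= u') r \<or> (u \<^bold>= v') r"
      using upairE[OF m(1)[OF z' q] m(2)[OF upair_mem1[OF z] q]] .
    have rp: "r \<le> p" using r(1) q by (rule order_trans)
    have "(x' \<^bold>\<in> u') r" "(x' \<^bold>\<in> v') r" using upair_mem1[OF m(1)[OF u' rp]] upair_mem1[OF m(1)[OF v' rp]] by auto
    then have "(x' \<^bold>\<in> u) r" using r(2) mem_cong2 eq_sym by blast
    then have "(x' \<^bold>= x) r" using singleton_mem[OF m(1)[OF u rp]] by blast
    then show "\<exists>r\<le>q. (x \<^bold>= x') r" using r(1) eq_sym by blast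
  qed
  show "(y \<^bold>= y') p"
  proof (rule reg_dense[OF reg_eq])
    fix q assume q: "q \<le> p"
    obtain r where r: "r \<le> q" "(v \<^bold>= u') r \<or> (v \<^bold>= v') r"
      using upairE[OF m(1)[OF z' q] m(2)[OF upair_mem2[OF z] q]] .
    have rp: "r \<le> p" using r(1) q by (rule order_trans)
    have yv: "(y \<^bold>\<in> v) r" and y'v': "(y' \<^bold>\<in> v') r"
      using upair_mem2[OF m(1)[OF v rp]] upair_mem2[OF m(1)[OF v' rp]] by auto
    \<comment> \<open>The degenerate case of crossed equalities: with \<open>x\<close> and
      \<open>x'\<close> already forced equal, these make all four components equal.\<close>
    have fin: "\<exists>r\<le>q. (y \<^bold>= y') r" if "s \<le> r" "(y \<^bold>= x') s" "(y' \<^bold>= x) s" for s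
    proof -
      have "(x' \<^bold>= x) s" using eq_sym[OF eq_mono[OF x order_trans[OF that(1) rp]]] .
      then have "(y \<^bold>= y') s" using that eq_trans eq_sym by blast
      then show ?thesis using order_trans[OF that(1) r(1)] by blast
    qed
    from r(2) show "\<exists>r\<le>q. (y \<^bold>= y') r"
    proof
      assume vu: "(v \<^bold>= u') r"
      have yx: "(y \<^bold>= x') r" using singleton_mem[OF m(1)[OF u' rp] mem_cong2[OF vu yv]] .
      obtain s where s: "s \<le> r" "(v' \<^bold>= u) s \<or> (v' \<^bold>= v) s"
        using upairE[OF m(1)[OF z rp] m(2)[OF upair_mem2[OF z'] rp]] .
      have sp: "s \<le> p" using s(1) rp by (rule order_trans)
      from s(2) show ?thesis
      proof
        assume "(v' \<^bold>= u) s"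
        then have "(y' \<^bold>= x) s" using singleton_mem[OF m(1)[OF u sp] mem_cong2[OF _ m(2)[OF y'v' s(1)]]] by blast
        then show ?thesis using fin[OF s(1) eq_mono[OF yx s(1)]] by blast
      next
        assume "(v' \<^bold>= v) s"
        then have "(y' \<^bold>\<in> v) s" using mem_cong2[OF _ m(2)[OF y'v' s(1)]] by blast
        from upairE[OF m(1)[OF v sp] this] obtain t where t: "t \<le> s" "(y' \<^bold>= x) t \<or> (y' \<^bold>= y) t" .
        have tr: "t \<le> r" using t(1) s(1) by (rule order_trans)
        show ?thesis using t(2) fin[OF tr eq_mono[OF yx tr]] eq_sym order_trans[OF tr r(1)] by blast
      qed
    next
      assume vv: "(v \<^bold>= v') r"
      from upairE[OF m(1)[OF v' rp] mem_cong2[OF vv yv]] obtain s where s: "s \<le> r" "(y \<^bold>= x') s \<or> (y \<^bold>= y') s" .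
      have "(y' \<^bold>\<in> v) s" using mem_cong2[OF eq_sym[OF vv] y'v'] m(2) s(1) by blast
      from upairE[OF m(1)[OF v order_trans[OF s(1) rp]] this] obtain t where t: "t \<le> s" "(y' \<^bold>= x) t \<or> (y' \<^bold>= y) t" .
      have tr: "t \<le> r" using t(1) s(1) by (rule order_trans)
      show ?thesis using s(2) t(2) fin[OF tr] eq_mono[OF _ t(1)] eq_sym order_trans[OF tr r(1)] by blast
    qed
  qed
qed

lemma pair_inject:
  assumes "is_pair z x y p" "is_pair z x' y' p"
  shows "(x \<^bold>= x') p" "(y \<^bold>= y') p"
proof -
  have *: "\<exists>r\<le>q. (x \<^bold>= x') r \<and> (y \<^bold>= y') r" if q: "q \<le> p" for q
  proof -
    obtain r u v where r: "r \<le> q" "is_upair u x x r" "is_upair v x y r" "is_upair z u v r"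
      using pairE[OF reg_mono[OF reg_is_pair assms(1) q]] .
    obtain s u' v' where s: "s \<le> r" "is_upair u' x' x' s" "is_upair v' x' y' s" "is_upair z u' v' s"
      using pairE[OF reg_mono[OF reg_is_pair assms(2) order_trans[OF r(1) q]]] .
    note m = r(2-4)[THEN reg_mono[OF reg_is_upair], OF s(1)]
    show ?thesis using upair_pair_inject[OF m s(2-4)] order_trans[OF s(1) r(1)] by blast
  qed
  show "(x \<^bold>= x') p" by (rule reg_dense[OF reg_eq]) (use * in blast)
  show "(y \<^bold>= y') p" by (rule reg_dense[OF reg_eq]) (use * in blast)
qed

lemma app_iff: "app f x y p \<longleftrightarrow> (\<forall>q\<le>p. \<exists>r\<le>q. \<exists>z. is_pair z x y r \<and> (z \<^bold>\<in> f) r)"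
  unfolding app_def ex_iff and_iff ..

section \<open>Reals\<close>

text \<open>Application of a formula to a condition, wrapped so that higher-order unification stays unique.\<close>

definition forced_at :: "'p formula \<Rightarrow> 'p \<Rightarrow> bool" where
  "forced_at \<phi> p = \<phi> p"

lemma forced_atI: "\<phi> p \<Longrightarrow> forced_at \<phi> p" by (simp add: forced_at_def)

lemma andD1: "forced_at (\<phi> \<^bold>\<and> \<psi>) p \<Longrightarrow> forced_at \<phi> p"
  and andD2: "forced_at (\<phi> \<^bold>\<and> \<psi>) p \<Longrightarrow> forced_at \<psi> p"
  by (simp_all add: forced_at_def forces_and_def)

lemma semE: "forced_at \<phi> p \<Longrightarrow> sem \<phi> Q \<Longrightarrow> eventually Q (aef p)"
  unfolding forced_at_def using semD by blast

lemmas sem_intros = sem_all sem_ex sem_iff sem_imp sem_or sem_and sem_not sem_ground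

lemma reg_is_real: "reg (is_real x)"
  unfolding is_real_def by (intro reg_intros reg_eq reg_mem)

lemma reg_less_rat: "reg (less_rat x q)"
  unfolding less_rat_def by (intro reg_intros reg_eq reg_mem)

lemma reg_eq_rat: "reg (eq_rat x q)"
  unfolding eq_rat_def by (intro reg_intros reg_eq reg_mem reg_is_real)

lemma reg_is_add: "reg (is_add z x y)"
  unfolding is_add_def by (intro reg_intros reg_eq reg_mem reg_is_real)

lemma reg_is_mult: "reg (is_mult z x y)"
  unfolding is_mult_def by (intro reg_intros reg_eq reg_mem reg_is_real reg_less_rat)

lemma reg_is_abs: "reg (is_abs z x)"
  unfolding is_abs_def by (intro reg_intros reg_eq reg_mem reg_is_real reg_less_rat)

abbreviation below :: "('i, 'k random) name \<Rightarrow> ('k \<Rightarrow> bool) \<Rightarrow> rat \<Rightarrow> bool" where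
  "below x w q \<equiv> w \<in> tv (rat_name q \<^bold>\<in> x)"

lemma sem_below: "sem (rat_name q \<^bold>\<in> x) (\<lambda>w. below x w q)"
  by (rule sem_self[OF reg_mem])

lemma sem_less_rat: "sem (less_rat x c) (\<lambda>w. \<exists>r. r < c \<and> \<not> below x w r)"
  unfolding less_rat_def by (intro sem_ex sem_and sem_ground sem_not sem_below)

definition denotes :: "('k \<Rightarrow> bool) \<Rightarrow> ('i, 'k random) name \<Rightarrow> real \<Rightarrow> bool" where
  "denotes w x v \<longleftrightarrow> (\<forall>q. below x w q \<longleftrightarrow> of_rat q < v)"

text \<open>The supremum is taken in the extended reals to be total: it is measurable for every name
  and equals the denoted real wherever the name denotes one. Elsewhere its value carries no
  meaning.\<close>

definition val :: "('i, 'k random) name \<Rightarrow> ('k \<Rightarrow> bool) \<Rightarrow> real" where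
  "val x w = real_of_ereal (SUP q. if below x w q then ereal (of_rat q) else -\<infinity>)"

lemma real_cut_rat_ext:
  assumes "\<And>q. of_rat q < (a::real) \<longleftrightarrow> of_rat q < b"
  shows "a = b"
proof (rule ccontr)
  assume "a \<noteq> b"
  then obtain q where "of_rat q \<in> {min a b<..<max a b}" using of_rat_dense[of "min a b" "max a b"] by force
  then show False using assms[of q] by (auto simp: min_def max_def split: if_splits)
qed

lemma denotes_unique: "denotes w x a \<Longrightarrow> denotes w x b \<Longrightarrow> a = b"
  unfolding denotes_def by (rule real_cut_rat_ext) simp

lemma val_eq: assumes "denotes w x v" shows "val x w = v"
proof -
  have "(SUP q. if below x w q then ereal (of_rat q) else -\<infinity>) = ereal v"
  proof (rule antisym)
    show "(SUP q. if below x w q then ereal (of_rat q) else -\<infinity>) \<le> ereal v"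
      by (rule SUP_least) (use assms in \<open>auto simp: denotes_def less_imp_le\<close>)
    show "ereal v \<le> (SUP q. if below x w q then ereal (of_rat q) else -\<infinity>)"
    proof (rule ereal_le_real, rule ccontr)
      fix t assume t: "(SUP q. if below x w q then ereal (of_rat q) else -\<infinity>) \<le> ereal t" "\<not> ereal v \<le> ereal t"
      then obtain q where q: "t < of_rat q" "of_rat q < v" using of_rat_dense[of t v] by auto
      then have "ereal (of_rat q) \<le> (SUP q. if below x w q then ereal (of_rat q) else -\<infinity>)"
        using assms by (intro SUP_upper2[of q]) (auto simp: denotes_def)
      then have "ereal (of_rat q) \<le> ereal t" using t(1) by (rule order_trans)
      then show False using q by simp
    qed
  qed
  then show ?thesis by (simp add: val_def)
qed

lemma measurable_val: "val x \<in> borel_measurable borel"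
proof -
  have [measurable]: "Measurable.pred borel (\<lambda>w. below x w q)" for q
    unfolding pred_def using tv_borel[OF reg_mem] by simp
  show ?thesis unfolding val_def by measurable
qed

lemma rational_cut:
  assumes "\<exists>q. C q" "\<exists>q. \<not> C q" "\<And>q r. C r \<Longrightarrow> q < r \<Longrightarrow> C q" "\<And>q. C q \<Longrightarrow> \<exists>r>q. C r"
  shows "\<exists>v::real. \<forall>q. C q \<longleftrightarrow> of_rat q < v"
proof -
  let ?S = "of_rat ` {q. C q} :: real set"
  obtain b where b: "\<not> C b" using assms(2) by blast
  have "x \<le> of_rat b" if "x \<in> ?S" for x
    using that b assms(3) by (auto simp: of_rat_less_eq) (metis linorder_le_less_linear)
  then have bdd: "bdd_above ?S" by (rule bdd_aboveI)
  have "C q \<longleftrightarrow> of_rat q < Sup ?S" for q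
  proof
    assume "C q"
    then obtain r where r: "q < r" "C r" using assms(4) by blast
    then have "of_rat r \<le> Sup ?S" using bdd by (intro cSup_upper) auto
    then show "of_rat q < Sup ?S" using r(1) by (metis less_le_trans of_rat_less)
  next
    assume "of_rat q < Sup ?S"
    then obtain r where "C r" "(of_rat q :: real) < of_rat r"
      using assms(1) less_cSup_iff[OF _ bdd, of "of_rat q"] by auto
    then show "C q" using assms(3) by (simp add: of_rat_less)
  qed
  then show ?thesis by blast
qed

text \<open>The cut axioms used here quantify over rationals only, so they hold pointwise almost
  everywhere; there the rationals below \<open>x\<close> form the cut of a real number.\<close>

lemma is_real_denotes:
  assumes "is_real x p"
  shows "eventually (\<lambda>w. denotes w x (val x w)) (aef p)"
proof -
  note a = forced_atI[of "is_real x", OF assms, unfolded is_real_def, THEN andD2]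
  have "eventually (\<lambda>w. \<exists>q. below x w q) (aef p)"
    by (rule semE[OF a[THEN andD1]]) (intro sem_intros sem_below)
  moreover have "eventually (\<lambda>w. \<exists>q. \<not> below x w q) (aef p)"
    by (rule semE[OF a[THEN andD2, THEN andD1]]) (intro sem_intros sem_below)
  moreover have "eventually (\<lambda>w. \<forall>q r. below x w r \<and> q < r \<longrightarrow> below x w q) (aef p)"
    by (rule semE[OF a[THEN andD2, THEN andD2, THEN andD1]]) (intro sem_intros sem_below)
  moreover have "eventually (\<lambda>w. \<forall>q. below x w q \<longrightarrow> (\<exists>r. q < r \<and> below x w r)) (aef p)"
    by (rule semE[OF a[THEN andD2, THEN andD2, THEN andD2]]) (intro sem_intros sem_below)
  ultimately show ?thesis
  proof eventually_elim
    case (elim w)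
    then have "\<exists>v. denotes w x v" unfolding denotes_def by (intro rational_cut) auto
    then show ?case using val_eq by metis
  qed
qed

lemma eq_rat_denotes:
  assumes "eq_rat x c p"
  shows "eventually (\<lambda>w. denotes w x (of_rat c)) (aef p)"
proof -
  have "eventually (\<lambda>w. \<forall>r. below x w r \<longleftrightarrow> r < c) (aef p)"
    by (rule semE[OF forced_atI[of "eq_rat x c", OF assms, unfolded eq_rat_def, THEN andD2]]) (intro sem_intros sem_below)
  then show ?thesis by eventually_elim (simp add: denotes_def of_rat_less)
qed

lemma is_add_denotes:
  assumes "is_add z x y p"
  shows "eventually (\<lambda>w. \<forall>a b. denotes w x a \<longrightarrow> denotes w y b \<longrightarrow> denotes w z (a + b)) (aef p)"
proof -
  have "eventually (\<lambda>w. \<forall>q. below z w q \<longleftrightarrow> (\<exists>r s. below x w r \<and> below y w s \<and> q = r + s)) (aef p)"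
    by (rule semE[OF forced_atI[of "is_add z x y", OF assms, unfolded is_add_def, THEN andD2]]) (intro sem_intros sem_below)
  then show ?thesis
  proof eventually_elim
    case (elim w)
    show ?case
    proof (intro allI impI)
      fix a b assume ab: "denotes w x a" "denotes w y b"
      show "denotes w z (a + b)" unfolding denotes_def
      proof
        fix q
        have "(\<exists>r s. of_rat r < a \<and> of_rat s < b \<and> q = r + s) \<longleftrightarrow> of_rat q < a + b"
        proof
          assume "of_rat q < a + b"
          then obtain r where r: "of_rat q - b < of_rat r" "of_rat r < a"
            using of_rat_dense[of "of_rat q - b" a] by auto
          then have "of_rat (q - r) < b" by (simp add: of_rat_diff)
          then show "\<exists>r s. of_rat r < a \<and> of_rat s < b \<and> q = r + s"
            using r(2) by (intro exI[of _ r] exI[of _ "q - r"]) simp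
        qed (auto simp: of_rat_add)
        then show "below z w q \<longleftrightarrow> of_rat q < a + b" using elim ab by (simp add: denotes_def)
      qed
    qed
  qed
qed

lemma below_less_rat:
  assumes "denotes w x a"
  shows "(\<exists>r. r < c \<and> \<not> below x w r) \<longleftrightarrow> a < of_rat c"
proof
  assume "\<exists>r<c. \<not> below x w r"
  then show "a < of_rat c" using assms by (auto simp: denotes_def not_less of_rat_less elim: le_less_trans)
next
  assume "a < of_rat c"
  then obtain r where "a < of_rat r" "of_rat r < (of_rat c :: real)" using of_rat_dense[of a "of_rat c"] by auto
  then show "\<exists>r<c. \<not> below x w r" using assms by (intro exI[of _ r]) (auto simp: denotes_def of_rat_less)
qed

lemma less_rat_denotes:
  assumes "less_rat x c p"
  shows "eventually (\<lambda>w. \<forall>a. denotes w x a \<longrightarrow> a < of_rat c) (aef p)"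
  using semE[OF forced_atI[of "less_rat x c", OF assms] sem_less_rat] by eventually_elim (use below_less_rat in blast)

lemma is_abs_denotes:
  assumes "is_abs z x p"
  shows "eventually (\<lambda>w. \<forall>a. denotes w x a \<longrightarrow> denotes w z \<bar>a\<bar>) (aef p)"
proof -
  have "eventually (\<lambda>w. \<forall>q. below z w q \<longleftrightarrow> below x w q \<or> (\<exists>r. r < - q \<and> \<not> below x w r)) (aef p)"
    by (rule semE[OF forced_atI[of "is_abs z x", OF assms, unfolded is_abs_def, THEN andD2]]) (intro sem_less_rat sem_intros sem_below)
  then show ?thesis
  proof eventually_elim
    case (elim w)
    show ?case
    proof (intro allI impI)
      fix a assume a: "denotes w x a"
      have "below z w q \<longleftrightarrow> of_rat q < a \<or> a < of_rat (- q)" for q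
        using elim below_less_rat[OF a, of "- q"] a by (simp add: denotes_def)
      then show "denotes w z \<bar>a\<bar>" by (auto simp: denotes_def of_rat_minus)
    qed
  qed
qed

lemma rational_approximation:
  fixes x :: real
  shows "\<exists>a b :: nat \<Rightarrow> rat. (\<forall>n. of_rat (a n) < x) \<and> (\<forall>n. x < of_rat (b n)) \<and>
    (\<lambda>n. of_rat (a n) :: real) \<longlonglongrightarrow> x \<and> (\<lambda>n. of_rat (b n) :: real) \<longlonglongrightarrow> x"
proof -
  have "\<exists>q. x - 1 / real (Suc n) < of_rat q \<and> of_rat q < x" "\<exists>q. x < of_rat q \<and> of_rat q < x + 1 / real (Suc n)" for n
    using of_rat_dense[of "x - 1 / real (Suc n)" x] of_rat_dense[of x "x + 1 / real (Suc n)"] by auto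
  then obtain a b where ab: "\<And>n. x - 1 / real (Suc n) < of_rat (a n)" "\<And>n. of_rat (a n) < x"
    "\<And>n. x < of_rat (b n)" "\<And>n. of_rat (b n) < x + 1 / real (Suc n)" by metis
  have z: "(\<lambda>n. 1 / real (Suc n)) \<longlonglongrightarrow> 0" using LIMSEQ_inverse_real_of_nat by (simp add: inverse_eq_divide)
  have "(\<lambda>n. of_rat (a n) :: real) \<longlonglongrightarrow> x"
    by (rule tendsto_sandwich[of "\<lambda>n. x - 1 / real (Suc n)" _ _ "\<lambda>_. x"])
      (use ab tendsto_diff[OF tendsto_const z, of x] in \<open>auto intro!: always_eventually less_imp_le simp del: of_nat_Suc\<close>)
  moreover have "(\<lambda>n. of_rat (b n) :: real) \<longlonglongrightarrow> x"
    by (rule tendsto_sandwich[of "\<lambda>_. x" _ _ "\<lambda>n. x + 1 / real (Suc n)"])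
      (use ab tendsto_add[OF tendsto_const z, of x] in \<open>auto intro!: always_eventually less_imp_le simp del: of_nat_Suc\<close>)
  ultimately show ?thesis using ab by blast
qed

text \<open>A product is affine in each factor, so over a rectangle it is bounded below by its least
  corner value. The sign of the fixed factor decides which endpoint gives the bound.\<close>

lemma corner_lower_bound:
  fixes a b c d x y :: real
  assumes "a < x" "x < b" "c < y" "y < d" "q < a * c" "q < a * d" "q < b * c" "q < b * d"
  shows "q < x * y"
proof -
  have mid: "q < t * y" if "q < t * c" "q < t * d" for t
  proof (cases "t \<ge> 0")
    case True
    then have "t * c \<le> t * y" using assms by (intro mult_left_mono) auto
    then show ?thesis using that by simp
  next
    case False
    then have "t * d \<le> t * y" using assms by (intro mult_left_mono_neg) auto
    then show ?thesis using that by simp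
  qed
  have "q < a * y" "q < b * y" using mid assms by auto
  show ?thesis
  proof (cases "y \<ge> 0")
    case True
    then have "a * y \<le> x * y" using assms by (intro mult_right_mono) auto
    then show ?thesis using \<open>q < a * y\<close> by simp
  next
    case False
    then have "b * y \<le> x * y" using assms by (intro mult_right_mono_neg) auto
    then show ?thesis using \<open>q < b * y\<close> by simp
  qed
qed

lemma is_mult_denotes:
  assumes "is_mult z x y p"
  shows "eventually (\<lambda>w. \<forall>s t. denotes w x s \<longrightarrow> denotes w y t \<longrightarrow> denotes w z (s * t)) (aef p)"
proof -
  have "eventually (\<lambda>w. \<forall>q. below z w q \<longleftrightarrow> (\<exists>a b c d. below x w a \<and> (\<exists>r. r < b \<and> \<not> below x w r) \<and>
      below y w c \<and> (\<exists>r. r < d \<and> \<not> below y w r) \<and> q < Min {a * c, a * d, b * c, b * d})) (aef p)"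
    by (rule semE[OF forced_atI[of "is_mult z x y", OF assms, unfolded is_mult_def, THEN andD2]]) (intro sem_less_rat sem_intros sem_below)
  then show ?thesis
  proof eventually_elim
    case (elim w)
    show ?case
    proof (intro allI impI)
      fix s t assume st: "denotes w x s" "denotes w y t"
      show "denotes w z (s * t)" unfolding denotes_def
      proof
        fix q
        have "below z w q \<longleftrightarrow> (\<exists>a b c d. of_rat a < s \<and> s < of_rat b \<and> of_rat c < t \<and> t < of_rat d \<and>
            q < Min {a * c, a * d, b * c, b * d})"
          using elim st unfolding below_less_rat[OF st(1)] below_less_rat[OF st(2)] by (simp add: denotes_def)
        also have "\<dots> \<longleftrightarrow> of_rat q < s * t"
        proof
          assume "\<exists>a b c d. of_rat a < s \<and> s < of_rat b \<and> of_rat c < t \<and> t < of_rat d \<and>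
            q < Min {a * c, a * d, b * c, b * d}"
          then obtain a b c d where *: "of_rat a < s" "s < of_rat b" "of_rat c < t" "t < of_rat d"
            "q < a * c" "q < a * d" "q < b * c" "q < b * d" by auto
          show "of_rat q < s * t"
            using *(5-8) by (intro corner_lower_bound[OF *(1-4)]) (auto simp: of_rat_less of_rat_mult[symmetric])
        next
          \<comment> \<open>Rational endpoints converging to \<open>s\<close> and \<open>t\<close>
            from both sides make all four corner products converge to \<open>s * t\<close>, so
            eventually all of them exceed \<open>q\<close>.\<close>
          assume q: "of_rat q < s * t"
          obtain a b where ab: "\<And>n. of_rat (a n) < s" "\<And>n. s < of_rat (b n)"
            "(\<lambda>n. of_rat (a n) :: real) \<longlonglongrightarrow> s" "(\<lambda>n. of_rat (b n) :: real) \<longlonglongrightarrow> s" using rational_approximation[of s] by blast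
          obtain c d where cd: "\<And>n. of_rat (c n) < t" "\<And>n. t < of_rat (d n)"
            "(\<lambda>n. of_rat (c n) :: real) \<longlonglongrightarrow> t" "(\<lambda>n. of_rat (d n) :: real) \<longlonglongrightarrow> t" using rational_approximation[of t] by blast
          have lim: "\<forall>\<^sub>F n in sequentially. q < f n * g n"
            if "(\<lambda>n. of_rat (f n) :: real) \<longlonglongrightarrow> s" "(\<lambda>n. of_rat (g n) :: real) \<longlonglongrightarrow> t" for f g :: "nat \<Rightarrow> rat"
          proof -
            have "\<forall>\<^sub>F n in sequentially. of_rat q < (of_rat (f n) * of_rat (g n) :: real)"
              using order_tendstoD(1)[OF tendsto_mult[OF that] q] .
            then show ?thesis by eventually_elim (simp add: of_rat_less of_rat_mult[symmetric])
          qed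
          have "\<forall>\<^sub>F n in sequentially. q < Min {a n * c n, a n * d n, b n * c n, b n * d n}"
            using lim[OF ab(3) cd(3)] lim[OF ab(3) cd(4)] lim[OF ab(4) cd(3)] lim[OF ab(4) cd(4)]
            by eventually_elim simp
          then obtain n where "q < Min {a n * c n, a n * d n, b n * c n, b n * d n}"
            using eventually_happens by force
          then show "\<exists>a b c d. of_rat a < s \<and> s < of_rat b \<and> of_rat c < t \<and> t < of_rat d \<and>
            q < Min {a * c, a * d, b * c, b * d}" using ab(1,2) cd(1,2) by blast
        qed
        finally show "below z w q \<longleftrightarrow> of_rat q < s * t" .
      qed
    qed
  qed
qed

lemma tv_eqD:
  assumes "(x \<^bold>= y) p" shows "eventually (\<lambda>w. w \<in> tv (s \<^bold>\<in> x) \<longleftrightarrow> w \<in> tv (s \<^bold>\<in> y)) (aef p)"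
proof -
  have "(s \<^bold>\<in> x \<^bold>\<longleftrightarrow> s \<^bold>\<in> y) p"
    using mem_cong2_iff[OF eq_mono[OF assms]] by (subst iff_iff) (auto intro: reg_mem)
  then show ?thesis unfolding semD[OF sem_iff[OF sem_self[OF reg_mem] sem_self[OF reg_mem]]] .
qed

section \<open>Names for pairs, rationals and points\<close>

text \<open>A set of names has no evident embedding into the index type; choosing preimages by
  \<open>inv_into\<close> reduces this to an embedding of the parameters \<open>J\<close>.\<close>

lemma elts_set_name_image:
  fixes F :: "'x \<Rightarrow> ('i, 'p) name \<times> 'p" and g :: "'x \<Rightarrow> 'i"
  assumes "inj_on g J"
  shows "elts (set_name (F ` J)) = F ` J"
proof (rule elts_set_name)
  show "inj_on (g \<circ> inv_into J F) (F ` J)"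
  proof (rule comp_inj_on)
    show "inj_on (inv_into J F) (F ` J)" by (rule inj_on_inv_into) simp
    show "inj_on g (inv_into J F ` F ` J)" by (rule inj_on_subset[OF assms]) (auto intro: inv_into_into)
  qed
qed

definition upair_name :: "('i, 'p::order_top) name \<Rightarrow> ('i, 'p) name \<Rightarrow> ('i, 'p) name" where
  "upair_name x y = set_name {(x, top), (y, top)}"

definition pair_name :: "('i, 'p::order_top) name \<Rightarrow> ('i, 'p) name \<Rightarrow> ('i, 'p) name" where
  "pair_name x y = upair_name (upair_name x x) (upair_name x y)"

definition cut_name :: "rat \<Rightarrow> ('i, 'p::order_top) name" where
  "cut_name c = set_name ((\<lambda>q. (rat_name q, top)) ` {q. q < c})"

lemma reg_is_point: "reg (is_point e x)"
  unfolding is_point_def by (intro reg_intros reg_eq reg_mem)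

lemma reg_dist_less: "reg (dist_less x y c)"
  unfolding dist_less_def by (intro reg_intros reg_is_real reg_is_add reg_is_abs reg_less_rat)

lemma sem_const: assumes "\<And>p. \<phi> p \<longleftrightarrow> P" shows "sem \<phi> (\<lambda>_. P)"
proof -
  have "\<phi> = ground P" using assms by (auto simp: ground_def fun_eq_iff)
  then show ?thesis using sem_ground by simp
qed

lemma semI: "sem \<phi> Q \<Longrightarrow> eventually Q (aef p) \<Longrightarrow> \<phi> p"
  using semD by blast

lemma not_iff: "(\<^bold>\<not> \<phi>) p \<longleftrightarrow> (\<forall>q\<le>p. \<not> \<phi> q)"
  by (simp add: forces_not_def)

lemma ground_iff: "ground P p \<longleftrightarrow> P"
  by (simp add: ground_def)

lemma imp_intro: "reg \<phi> \<Longrightarrow> reg \<psi> \<Longrightarrow> (\<And>q. q \<le> p \<Longrightarrow> \<phi> q \<Longrightarrow> \<psi> q) \<Longrightarrow> (\<phi> \<^bold>\<longrightarrow> \<psi>) p"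
  by (simp add: imp_iff)

lemma all_intro: "(\<And>x. \<phi> x p) \<Longrightarrow> (\<^bold>\<forall>x. \<phi> x) p"
  by (simp add: all_iff)

lemma decide: "(\<exists>r\<le>p. \<phi> r) \<or> (\<^bold>\<not> \<phi>) p"
  by (auto simp: not_iff)

section \<open>Ultrafilters of the extension seen from conditions\<close>

lemma point_iff:
  "is_point e U p \<longleftrightarrow>
     (\<forall>x. \<forall>q\<le>p. (x \<^bold>\<in> U) q \<longrightarrow> (\<exists>r\<le>q. \<exists>a. (x \<^bold>= e a) r)) \<and> (e top \<^bold>\<in> U) p \<and>
     (\<forall>q\<le>p. \<not> (e bot \<^bold>\<in> U) q) \<and>
     (\<forall>a b. \<forall>q\<le>p. (e a \<^bold>\<in> U) q \<longrightarrow> (e b \<^bold>\<in> U) q \<longrightarrow> (e (inf a b) \<^bold>\<in> U) q) \<and>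
     (\<forall>a b. \<forall>q\<le>p. a \<le> b \<longrightarrow> (e a \<^bold>\<in> U) q \<longrightarrow> (e b \<^bold>\<in> U) q) \<and>
     (\<forall>a. \<forall>q\<le>p. \<exists>r\<le>q. (e a \<^bold>\<in> U) r \<or> (e (- a) \<^bold>\<in> U) r)"
proof -
  have 1: "(\<^bold>\<forall>x. x \<^bold>\<in> U \<^bold>\<longrightarrow> (\<^bold>\<exists>a. x \<^bold>= e a)) p \<longleftrightarrow> (\<forall>x. \<forall>q\<le>p. (x \<^bold>\<in> U) q \<longrightarrow> (\<exists>r\<le>q. \<exists>a. (x \<^bold>= e a) r))"
  proof -
    have "(x \<^bold>\<in> U \<^bold>\<longrightarrow> (\<^bold>\<exists>a. x \<^bold>= e a)) p \<longleftrightarrow> (\<forall>q\<le>p. (x \<^bold>\<in> U) q \<longrightarrow> (\<^bold>\<exists>a. x \<^bold>= e a) q)" for x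
      by (rule imp_iff) (intro reg_intros reg_mem reg_eq)+
    also have "\<dots> x \<longleftrightarrow> (\<forall>q\<le>p. (x \<^bold>\<in> U) q \<longrightarrow> (\<exists>r\<le>q. \<exists>a. (x \<^bold>= e a) r))" for x
      unfolding ex_iff using reg_mono[OF reg_mem] order_trans by blast
    finally show ?thesis by (simp add: all_iff)
  qed
  have 4: "(\<^bold>\<forall>a b. e a \<^bold>\<in> U \<^bold>\<and> e b \<^bold>\<in> U \<^bold>\<longrightarrow> e (inf a b) \<^bold>\<in> U) p \<longleftrightarrow>
     (\<forall>a b. \<forall>q\<le>p. (e a \<^bold>\<in> U) q \<longrightarrow> (e b \<^bold>\<in> U) q \<longrightarrow> (e (inf a b) \<^bold>\<in> U) q)"
    unfolding all_iff by (subst imp_iff) (auto simp: and_iff intro: reg_and reg_mem)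
  have 5: "(\<^bold>\<forall>a b. e a \<^bold>\<in> U \<^bold>\<and> ground (a \<le> b) \<^bold>\<longrightarrow> e b \<^bold>\<in> U) p \<longleftrightarrow>
     (\<forall>a b. \<forall>q\<le>p. a \<le> b \<longrightarrow> (e a \<^bold>\<in> U) q \<longrightarrow> (e b \<^bold>\<in> U) q)"
    unfolding all_iff by (subst imp_iff) (auto simp: and_iff ground_iff intro: reg_and reg_mem reg_ground)
  have 6: "(\<^bold>\<forall>a. e a \<^bold>\<in> U \<^bold>\<or> e (- a) \<^bold>\<in> U) p \<longleftrightarrow> (\<forall>a. \<forall>q\<le>p. \<exists>r\<le>q. (e a \<^bold>\<in> U) r \<or> (e (- a) \<^bold>\<in> U) r)"
    unfolding all_iff or_iff ..
  have 3: "(\<^bold>\<not> (e bot \<^bold>\<in> U)) p \<longleftrightarrow> (\<forall>q\<le>p. \<not> (e bot \<^bold>\<in> U) q)" by (rule not_iff)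
  show ?thesis unfolding is_point_def
    by (simp only: and_iff[of "\<^bold>\<forall>x. _ x"] and_iff[of "_ \<^bold>\<in> _"] and_iff[of "\<^bold>\<not> _"] 1 3 4 5 6)
qed

lemma point_elem: "is_point e U p \<Longrightarrow> (x \<^bold>\<in> U) p \<Longrightarrow> \<exists>r\<le>p. \<exists>a. (x \<^bold>= e a) r"
  unfolding point_iff by blast

lemma point_bot: "is_point e U p \<Longrightarrow> \<not> (e bot \<^bold>\<in> U) p"
  unfolding point_iff by blast

lemma point_inf: "is_point e U p \<Longrightarrow> (e a \<^bold>\<in> U) p \<Longrightarrow> (e b \<^bold>\<in> U) p \<Longrightarrow> (e (inf a b) \<^bold>\<in> U) p"
  unfolding point_iff by blast

lemma point_up: "is_point e U p \<Longrightarrow> a \<le> b \<Longrightarrow> (e a \<^bold>\<in> U) p \<Longrightarrow> (e b \<^bold>\<in> U) p"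
  unfolding point_iff by blast

lemma point_ultra: "is_point e U p \<Longrightarrow> \<exists>r\<le>p. (e a \<^bold>\<in> U) r \<or> (e (- a) \<^bold>\<in> U) r"
  unfolding point_iff by blast

lemma point_consistent: "is_point e U p \<Longrightarrow> (e a \<^bold>\<in> U) p \<Longrightarrow> (e (- a) \<^bold>\<in> U) p \<Longrightarrow> False"
  using point_inf[of e U p a "- a"] point_bot[of e U p] by simp

lemma point_compl:
  assumes "is_point e U p" "(\<^bold>\<not> (e a \<^bold>\<in> U)) p"
  shows "(e (- a) \<^bold>\<in> U) p"
proof (rule reg_dense[OF reg_mem])
  fix q assume q: "q \<le> p"
  obtain r where r: "r \<le> q" "(e a \<^bold>\<in> U) r \<or> (e (- a) \<^bold>\<in> U) r"
    using point_ultra[OF reg_mono[OF reg_is_point assms(1) q]] by blast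
  moreover have "r \<le> p" using r(1) q by (rule order_trans)
  ultimately show "\<exists>r\<le>q. (e (- a) \<^bold>\<in> U) r" using assms(2) by (auto simp: not_iff)
qed

lemma point_cong:
  assumes "is_point e U p" "(U \<^bold>= V) p"
  shows "is_point e V p"
proof -
  have E: "(x \<^bold>\<in> V) q \<longleftrightarrow> (x \<^bold>\<in> U) q" if "q \<le> p" for x q
    using mem_cong2_iff[OF eq_mono[OF assms(2) that]] by blast
  note P = reg_mono[OF reg_is_point assms(1)]
  show ?thesis unfolding point_iff
  proof (intro conjI allI impI)
    have "(e top \<^bold>\<in> U) p" using assms(1) unfolding point_iff by blast
    then show "(e top \<^bold>\<in> V) p" by (simp add: E)
  next
    fix x q assume q: "q \<le> p" "(x \<^bold>\<in> V) q"
    then show "\<exists>r\<le>q. \<exists>a. (x \<^bold>= e a) r" using point_elem[OF P[OF q(1)]] E by blast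
  next
    fix q assume q: "q \<le> p"
    then show "\<not> (e bot \<^bold>\<in> V) q" using point_bot[OF P[OF q]] E by blast
  next
    fix a b q assume q: "q \<le> p" "(e a \<^bold>\<in> V) q" "(e b \<^bold>\<in> V) q"
    then show "(e (inf a b) \<^bold>\<in> V) q" using point_inf[OF P[OF q(1)]] E by blast
  next
    fix a b q assume q: "q \<le> p" "a \<le> b" "(e a \<^bold>\<in> V) q"
    then show "(e b \<^bold>\<in> V) q" using point_up[OF P[OF q(1)] q(2)] E by blast
  next
    fix a q assume q: "q \<le> p"
    obtain r where r: "r \<le> q" "(e a \<^bold>\<in> U) r \<or> (e (- a) \<^bold>\<in> U) r" using point_ultra[OF P[OF q]] by blast
    then show "\<exists>r\<le>q. (e a \<^bold>\<in> V) r \<or> (e (- a) \<^bold>\<in> V) r" using E[OF order_trans[OF r(1) q]] by blast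
  qed
qed

text \<open>The equivalence is verified at all conditions below \<open>p\<close> and then read
  pointwise. The exceptional null set depends on \<open>a\<close> and \<open>b\<close>, which is why
  \<open>X_inf\<close> is stated for each pair of elements separately.\<close>

lemma tv_point_inf:
  assumes "is_point e U p"
  shows "eventually (\<lambda>w. w \<in> tv (e (inf a b) \<^bold>\<in> U) \<longleftrightarrow> w \<in> tv (e a \<^bold>\<in> U) \<and> w \<in> tv (e b \<^bold>\<in> U)) (aef p)"
proof -
  have "(e (inf a b) \<^bold>\<in> U \<^bold>\<longleftrightarrow> e a \<^bold>\<in> U \<^bold>\<and> e b \<^bold>\<in> U) p"
  proof (subst iff_iff)
    show "\<forall>q\<le>p. (e (inf a b) \<^bold>\<in> U) q \<longleftrightarrow> (e a \<^bold>\<in> U \<^bold>\<and> e b \<^bold>\<in> U) q"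
      using reg_mono[OF reg_is_point assms] point_inf[of e U] point_up[of e U] unfolding and_iff
      by (meson inf_le1 inf_le2)
  qed (intro reg_mem reg_and)+
  then show ?thesis
    by (rule semE[OF forced_atI]) (intro sem_intros sem_self reg_mem)
qed

lemma tv_point_compl:
  assumes "is_point e U p"
  shows "eventually (\<lambda>w. w \<in> tv (e (- a) \<^bold>\<in> U) \<longleftrightarrow> w \<notin> tv (e a \<^bold>\<in> U)) (aef p)"
proof -
  have "(e (- a) \<^bold>\<in> U \<^bold>\<longleftrightarrow> \<^bold>\<not> (e a \<^bold>\<in> U)) p"
  proof (subst iff_iff)
    show "\<forall>q\<le>p. (e (- a) \<^bold>\<in> U) q \<longleftrightarrow> (\<^bold>\<not> (e a \<^bold>\<in> U)) q"
    proof (intro allI impI iffI)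
      fix q assume q: "q \<le> p" and "(e (- a) \<^bold>\<in> U) q"
      then show "(\<^bold>\<not> (e a \<^bold>\<in> U)) q"
        unfolding not_iff using point_consistent reg_mono[OF reg_is_point assms order_trans[OF _ q]] reg_mono[OF reg_mem] by blast
    next
      fix q assume "q \<le> p" "(\<^bold>\<not> (e a \<^bold>\<in> U)) q"
      then show "(e (- a) \<^bold>\<in> U) q" using point_compl reg_mono[OF reg_is_point assms] by blast
    qed
  qed (intro reg_mem reg_not)+
  then show ?thesis
    by (rule semE[OF forced_atI]) (intro sem_intros sem_self reg_mem)
qed

section \<open>Canonical names and the size of the index type\<close>

locale big_names =
  fixes e :: "'a::boolean_algebra \<Rightarrow> ('i, 'k random) name"
  assumes infinite_algebra: "infinite (UNIV :: 'a set)"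
    and big_index: "\<exists>h :: ('a \<times> 'k random) set set \<Rightarrow> 'i. inj h"
begin

lemma inj_pairs: "\<exists>g :: 'a \<times> 'k random \<Rightarrow> 'i. inj g"
proof -
  obtain h :: "('a \<times> 'k random) set set \<Rightarrow> 'i" where "inj h" using big_index by blast
  then have "inj (\<lambda>x. h {{x}})" by (auto simp: inj_def)
  then show ?thesis by blast
qed

lemma inj_nat: "\<exists>g :: nat \<Rightarrow> 'i. inj g"
proof -
  obtain g :: "'a \<times> 'k random \<Rightarrow> 'i" where "inj g" using inj_pairs by blast
  then have "inj (\<lambda>a. g (a, top))" by (auto simp: inj_def)
  then have "infinite (range (\<lambda>a. g (a, top)))" using infinite_algebra by (simp add: finite_image_iff)
  then have "infinite (UNIV :: 'i set)" by (rule infinite_super[OF subset_UNIV])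
  then show ?thesis using infinite_countable_subset by blast
qed

text \<open>The triples parametrise the name of a characteristic function. Condition and truth value
  are coded by a set of one or two pairs, the infinite family of all sets of pairs absorbs its
  square, and a singleton turns the result into an argument of \<open>h\<close>.\<close>

lemma inj_points: "\<exists>g :: ('a \<times> 'k random) set \<times> 'k random \<times> bool \<Rightarrow> 'i. inj g"
proof -
  obtain h :: "('a \<times> 'k random) set set \<Rightarrow> 'i" where h: "inj h" using big_index by blast
  let ?U = "UNIV :: ('a \<times> 'k random) set set"
  have "inj (\<lambda>a::'a. {(a, top :: 'k random)})" by (auto simp: inj_def)
  then have "infinite (range (\<lambda>a::'a. {(a, top :: 'k random)}))" using infinite_algebra by (simp add: finite_image_iff)
  then have inf: "infinite ?U" by (rule infinite_super[OF subset_UNIV])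
  have "\<exists>k. inj_on k (?U \<times> ?U) \<and> k ` (?U \<times> ?U) \<subseteq> ?U"
    by (rule card_of_ordLeq[THEN iffD2, OF ordIso_imp_ordLeq[OF card_of_Times_same_infinite[OF inf]]])
  then obtain k :: "('a \<times> 'k random) set \<times> ('a \<times> 'k random) set \<Rightarrow> ('a \<times> 'k random) set"
    where "inj_on k (?U \<times> ?U)" by (elim exE conjE)
  then have k: "inj k" by simp
  obtain a0 a1 :: 'a where a: "a0 \<noteq> a1"
    using ex_new_if_finite[OF infinite_algebra, of "{undefined}"] by auto
  define c where "c = (\<lambda>(p :: 'k random, b). if b then {(a0, p)} else {(a0, p), (a1, p)})"
  have c: "inj c"
  proof (rule injI)
    fix x y assume "c x = c y"
    then show "x = y" using a by (auto simp: c_def split: prod.splits if_splits)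
  qed
  have "inj (\<lambda>(S, pb). h {k (S, c pb)})"
  proof (rule injI)
    fix x y assume eq: "(case x of (S, pb) \<Rightarrow> h {k (S, c pb)}) = (case y of (S, pb) \<Rightarrow> h {k (S, c pb)})"
    obtain S pb S' pb' where xy: "x = (S, pb)" "y = (S', pb')" by (cases x, cases y) blast
    have "h {k (S, c pb)} = h {k (S', c pb')}" using eq by (simp add: xy)
    from injD[OF h this] have "k (S, c pb) = k (S', c pb')" by blast
    from injD[OF k this] have "S = S'" "c pb = c pb'" by auto
    then show "x = y" using injD[OF c, of pb pb'] by (simp add: xy)
  qed
  then show ?thesis by blast
qed

lemma elts_countable:
  fixes F :: "'x \<Rightarrow> ('i, 'k random) name \<times> 'k random"
  assumes "countable J" shows "elts (set_name (F ` J)) = F ` J"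
proof -
  obtain g :: "nat \<Rightarrow> 'i" where g: "inj g" using inj_nat by blast
  have "inj_on (g \<circ> to_nat_on J) J"
    using inj_on_to_nat_on[OF assms] inj_on_subset[OF g] by (intro comp_inj_on) auto
  then show ?thesis by (rule elts_set_name_image)
qed

lemma elts_upair_name: "elts (upair_name x y :: ('i, 'k random) name) = {(x, top), (y, top)}"
  unfolding upair_name_def using elts_countable[of "{(x, top), (y, top)}" "\<lambda>x. x"] by simp

lemma is_upair_upair_name: "is_upair (upair_name x y) x y (p :: 'k random)" for x y :: "('i, 'k random) name"
proof -
  have "(w \<^bold>\<in> upair_name x y) q \<longleftrightarrow> (w \<^bold>= x \<^bold>\<or> w \<^bold>= y) q" for w and q :: "'k random"
  proof -
    have "(\<exists>\<tau>' t. (\<tau>', t) \<in> {(x, top), (y, top)} \<and> r \<le> t \<and> (w \<^bold>= \<tau>') r) \<longleftrightarrow> (w \<^bold>= x) r \<or> (w \<^bold>= y) r" for r :: "'k random"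
      using top_greatest[of r] by blast
    then show ?thesis unfolding or_iff forces_mem_unfold[of w] elts_upair_name by simp
  qed
  then show ?thesis unfolding is_upair_iff by blast
qed

lemma is_pair_pair_name: "is_pair (pair_name x y) x y (p :: 'k random)" for x y :: "('i, 'k random) name"
  unfolding pair_name_def by (intro pairI[OF is_upair_upair_name is_upair_upair_name is_upair_upair_name])

lemma elts_nat_name: "elts (nat_name n :: ('i, 'k random) name) = (\<lambda>k. (nat_name k, top)) ` {..<n}"
proof (induction n)
  case 0
  then show ?case using elts_countable[of "{}" "\<lambda>x. x"] by simp
next
  case (Suc n)
  have "insert (nat_name n :: ('i, 'k random) name, top :: 'k random) (elts (nat_name n)) = (\<lambda>k. (nat_name k, top)) ` {..<Suc n}"
    by (simp add: Suc lessThan_Suc)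
  then show ?case using elts_countable[of "{..<Suc n}" "\<lambda>k. (nat_name k, top)"] by simp
qed

text \<open>If the names of k < n were forced equal, the smaller would be forced to belong to
  itself, hence to equal the name of some j < k at a stronger condition; that contradicts the
  induction hypothesis for k.\<close>

lemma nat_name_neq: "k < n \<Longrightarrow> \<not> (nat_name k \<^bold>= (nat_name n :: ('i, 'k random) name)) p"
proof (induction n arbitrary: k p rule: less_induct)
  case (less n)
  show ?case
  proof
    assume eq: "(nat_name k \<^bold>= (nat_name n :: ('i, 'k random) name)) p"
    have "(nat_name k \<^bold>\<in> (nat_name n :: ('i, 'k random) name)) p"
      using less.prems by (intro elts_mem[of _ top]) (auto simp: elts_nat_name)
    then have "(nat_name k \<^bold>\<in> (nat_name k :: ('i, 'k random) name)) p" using mem_cong2 eq_sym[OF eq] by blast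
    then obtain r j where "j < k" "(nat_name k \<^bold>= (nat_name j :: ('i, 'k random) name)) r"
      unfolding forces_mem_unfold[of "nat_name k"] elts_nat_name by blast
    then show False using less.IH[OF less.prems, of j r] eq_sym by blast
  qed
qed

lemma rat_name_inj: "(rat_name q \<^bold>= (rat_name r :: ('i, 'k random) name)) p \<Longrightarrow> q = r"
  unfolding rat_name_def using nat_name_neq eq_sym by (metis injD inj_to_nat nat_neq_iff)

lemma elts_cut_name: "elts (cut_name c :: ('i, 'k random) name) = (\<lambda>q. (rat_name q, top)) ` {q. q < c}"
  unfolding cut_name_def by (rule elts_countable) simp

lemma mem_cut_name: "(rat_name q \<^bold>\<in> (cut_name c :: ('i, 'k random) name)) p \<longleftrightarrow> q < c"
proof
  assume "(rat_name q \<^bold>\<in> (cut_name c :: ('i, 'k random) name)) p"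
  then obtain r q' where "q' < c" "(rat_name q \<^bold>= (rat_name q' :: ('i, 'k random) name)) r"
    unfolding forces_mem_unfold[of "rat_name q"] elts_cut_name by blast
  then show "q < c" using rat_name_inj by blast
next
  assume "q < c"
  then show "(rat_name q \<^bold>\<in> (cut_name c :: ('i, 'k random) name)) p"
    by (intro elts_mem[of _ top]) (auto simp: elts_cut_name)
qed

lemma below_cut_name: "eventually (\<lambda>w. \<forall>q. below (cut_name c :: ('i, 'k random) name) w q \<longleftrightarrow> q < c) (aef p)"
  by (rule aef_all_countable) (rule sem_tv[OF sem_const[OF mem_cut_name]])

lemma below_eq_cut_name:
  assumes "(v \<^bold>= (cut_name c :: ('i, 'k random) name)) p"
  shows "eventually (\<lambda>w. \<forall>q. below v w q \<longleftrightarrow> q < c) (aef p)"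
proof -
  have "eventually (\<lambda>w. \<forall>q. below v w q \<longleftrightarrow> below (cut_name c :: ('i, 'k random) name) w q) (aef p)"
    by (rule aef_all_countable) (rule tv_eqD[OF assms])
  with below_cut_name[of c p] show ?thesis by eventually_elim simp
qed

text \<open>Covers every name forced equal to the cut, because a value of a characteristic function
  is known only up to forced equality. That the elements are rationals is shown at conditions, the
  remaining cut axioms pointwise.\<close>

lemma is_real_cut:
  assumes "(v \<^bold>= (cut_name c :: ('i, 'k random) name)) p"
  shows "is_real v p"
proof -
  have 1: "(\<^bold>\<forall>y. y \<^bold>\<in> v \<^bold>\<longrightarrow> (\<^bold>\<exists>q. y \<^bold>= rat_name q)) p"
  proof (intro all_intro imp_intro)
    fix y q assume q: "q \<le> p" "(y \<^bold>\<in> v) q"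
    then have "(y \<^bold>\<in> (cut_name c :: ('i, 'k random) name)) q" using mem_cong2[OF eq_mono[OF assms q(1)]] by blast
    then show "(\<^bold>\<exists>q. y \<^bold>= rat_name q) q"
      unfolding ex_iff forces_mem_unfold[of y] elts_cut_name by blast
  qed (intro reg_intros reg_mem reg_eq)+
  note b = below_eq_cut_name[OF assms]
  have 2: "(\<^bold>\<exists>q. rat_name q \<^bold>\<in> v) p"
  proof -
    have S: "sem (\<^bold>\<exists>q. rat_name q \<^bold>\<in> v) (\<lambda>w. \<exists>q. below v w q)" by (intro sem_intros sem_below)
    have E: "eventually (\<lambda>w. \<exists>q. below v w q) (aef p)" using b by eventually_elim (simp add: lt_ex)
    show "(\<^bold>\<exists>q. rat_name q \<^bold>\<in> v) p" by (rule semI[OF S E])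
  qed
  have 3: "(\<^bold>\<exists>q. \<^bold>\<not> (rat_name q \<^bold>\<in> v)) p"
  proof -
    have S: "sem (\<^bold>\<exists>q. \<^bold>\<not> (rat_name q \<^bold>\<in> v)) (\<lambda>w. \<exists>q. \<not> below v w q)" by (intro sem_intros sem_below)
    have E: "eventually (\<lambda>w. \<exists>q. \<not> below v w q) (aef p)" using b by eventually_elim (auto intro: exI[of _ c])
    show "(\<^bold>\<exists>q. \<^bold>\<not> (rat_name q \<^bold>\<in> v)) p" by (rule semI[OF S E])
  qed
  have 4: "(\<^bold>\<forall>q r. rat_name r \<^bold>\<in> v \<^bold>\<and> ground (q < r) \<^bold>\<longrightarrow> rat_name q \<^bold>\<in> v) p"
  proof -
    have S: "sem (\<^bold>\<forall>q r. rat_name r \<^bold>\<in> v \<^bold>\<and> ground (q < r) \<^bold>\<longrightarrow> rat_name q \<^bold>\<in> v)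
      (\<lambda>w. \<forall>q r. below v w r \<and> q < r \<longrightarrow> below v w q)" by (intro sem_intros sem_below)
    have E: "eventually (\<lambda>w. \<forall>q r. below v w r \<and> q < r \<longrightarrow> below v w q) (aef p)" using b by eventually_elim auto
    show "(\<^bold>\<forall>q r. rat_name r \<^bold>\<in> v \<^bold>\<and> ground (q < r) \<^bold>\<longrightarrow> rat_name q \<^bold>\<in> v) p" by (rule semI[OF S E])
  qed
  have 5: "(\<^bold>\<forall>q. rat_name q \<^bold>\<in> v \<^bold>\<longrightarrow> (\<^bold>\<exists>r. ground (q < r) \<^bold>\<and> rat_name r \<^bold>\<in> v)) p"
  proof -
    have S: "sem (\<^bold>\<forall>q. rat_name q \<^bold>\<in> v \<^bold>\<longrightarrow> (\<^bold>\<exists>r. ground (q < r) \<^bold>\<and> rat_name r \<^bold>\<in> v))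
      (\<lambda>w. \<forall>q. below v w q \<longrightarrow> (\<exists>r. q < r \<and> below v w r))" by (intro sem_intros sem_below)
    have E: "eventually (\<lambda>w. \<forall>q. below v w q \<longrightarrow> (\<exists>r. q < r \<and> below v w r)) (aef p)"
      using b by eventually_elim (auto simp: dense)
    show "(\<^bold>\<forall>q. rat_name q \<^bold>\<in> v \<^bold>\<longrightarrow> (\<^bold>\<exists>r. ground (q < r) \<^bold>\<and> rat_name r \<^bold>\<in> v)) p" by (rule semI[OF S E])
  qed
  show ?thesis unfolding is_real_def
    by (intro and_iff[THEN iffD2] conjI 1 2 3 4 5)
qed

lemma dist_less_cut:
  assumes "(v \<^bold>= (cut_name c :: ('i, 'k random) name)) p" "(u \<^bold>= (cut_name c :: ('i, 'k random) name)) p" "0 < \<epsilon>"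
  shows "dist_less v u \<epsilon> p"
proof -
  let ?z = "cut_name 0 :: ('i, 'k random) name"
  have z: "is_real ?z p" by (rule is_real_cut[OF eq_refl])
  have add: "is_add v u ?z p" unfolding is_add_def
  proof (intro and_iff[THEN iffD2] conjI is_real_cut[OF assms(1)])
    have S: "sem (\<^bold>\<forall>q. rat_name q \<^bold>\<in> v \<^bold>\<longleftrightarrow> (\<^bold>\<exists>r s. rat_name r \<^bold>\<in> u \<^bold>\<and> rat_name s \<^bold>\<in> ?z \<^bold>\<and> ground (q = r + s)))
      (\<lambda>w. \<forall>q. below v w q \<longleftrightarrow> (\<exists>r s. below u w r \<and> below ?z w s \<and> q = r + s))"
      by (intro sem_intros sem_below)
    have *: "q < c \<longleftrightarrow> (\<exists>r s. r < c \<and> s < 0 \<and> q = r + s)" for q :: rat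
    proof
      assume "q < c"
      then obtain r where "q < r" "r < c" using dense by blast
      then show "\<exists>r s. r < c \<and> s < 0 \<and> q = r + s" by (intro exI[of _ r] exI[of _ "q - r"]) simp
    qed auto
    have E: "eventually (\<lambda>w. \<forall>q. below v w q \<longleftrightarrow> (\<exists>r s. below u w r \<and> below ?z w s \<and> q = r + s)) (aef p)"
      using below_eq_cut_name[OF assms(1)] below_eq_cut_name[OF assms(2)] below_cut_name[of 0 p]
    proof eventually_elim
      case (elim w)
      show ?case unfolding elim(1)[rule_format] elim(2)[rule_format] elim(3)[rule_format] using * by blast
    qed
    show "(\<^bold>\<forall>q. rat_name q \<^bold>\<in> v \<^bold>\<longleftrightarrow> (\<^bold>\<exists>r s. rat_name r \<^bold>\<in> u \<^bold>\<and> rat_name s \<^bold>\<in> ?z \<^bold>\<and> ground (q = r + s))) p" by (rule semI[OF S E])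
  qed
  have abs: "is_abs ?z ?z p" unfolding is_abs_def
  proof (intro and_iff[THEN iffD2] conjI z)
    have S: "sem (\<^bold>\<forall>q. rat_name q \<^bold>\<in> ?z \<^bold>\<longleftrightarrow> rat_name q \<^bold>\<in> ?z \<^bold>\<or> less_rat ?z (- q))
      (\<lambda>w. \<forall>q. below ?z w q \<longleftrightarrow> below ?z w q \<or> (\<exists>r. r < - q \<and> \<not> below ?z w r))"
      by (intro sem_less_rat sem_intros sem_below)
    have E: "eventually (\<lambda>w. \<forall>q. below ?z w q \<longleftrightarrow> below ?z w q \<or> (\<exists>r. r < - q \<and> \<not> below ?z w r)) (aef p)"
      using below_cut_name[of 0 p]
    proof eventually_elim
      case (elim w)
      have "(\<exists>r. r < - q \<and> \<not> r < 0) \<longleftrightarrow> q < 0" for q :: rat by (auto intro: exI[of _ 0])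
      then show ?case unfolding elim[rule_format] by blast
    qed
    show "(\<^bold>\<forall>q. rat_name q \<^bold>\<in> ?z \<^bold>\<longleftrightarrow> rat_name q \<^bold>\<in> ?z \<^bold>\<or> less_rat ?z (- q)) p" by (rule semI[OF S E])
  qed
  have less: "less_rat ?z \<epsilon> p"
  proof (rule semI[OF sem_less_rat])
    show "eventually (\<lambda>w. \<exists>r. r < \<epsilon> \<and> \<not> below ?z w r) (aef p)"
      using below_cut_name[of 0 p] by eventually_elim (use assms(3) in \<open>auto intro!: exI[of _ 0]\<close>)
  qed
  have "(is_real ?z \<^bold>\<and> is_add v u ?z \<^bold>\<and> is_abs ?z ?z \<^bold>\<and> less_rat ?z \<epsilon>) p"
    using z add abs less by (simp add: and_iff)
  then have "(\<^bold>\<exists>m. is_real ?z \<^bold>\<and> is_add v u ?z \<^bold>\<and> is_abs m ?z \<^bold>\<and> less_rat m \<epsilon>) p"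
    by (rule ex_intro[of "\<lambda>m. is_real ?z \<^bold>\<and> is_add v u ?z \<^bold>\<and> is_abs m ?z \<^bold>\<and> less_rat m \<epsilon>"])
      (intro reg_intros reg_is_real reg_is_add reg_is_abs reg_less_rat)
  then show ?thesis unfolding dist_less_def
    by (rule ex_intro[of "\<lambda>d. \<^bold>\<exists>m. is_real d \<^bold>\<and> is_add v u d \<^bold>\<and> is_abs m d \<^bold>\<and> less_rat m \<epsilon>"])
      (intro reg_intros reg_is_real reg_is_add reg_is_abs reg_less_rat)
qed

end

section \<open>Characteristic functions of clopen sets\<close>

context big_names
begin

definition point_name :: "('a \<times> 'k random) set \<Rightarrow> ('i, 'k random) name" where
  "point_name S = set_name ((\<lambda>(a, p). (e a, p)) ` S)"

text \<open>A function of the extension needs a name in the ground model, so its graph is listed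
  over canonical names of points. A pair enters with each condition that forces the point to be an
  ultrafilter and decides the membership of \<open>e a\<close>; \<open>b\<close> is the
  decision.\<close>

definition char_pairs :: "'a \<Rightarrow> (('a \<times> 'k random) set \<times> 'k random \<times> bool) set" where
  "char_pairs a = {(S, p, b). is_point e (point_name S) p \<and>
     (if b then (e a \<^bold>\<in> point_name S) p else (\<^bold>\<not> (e a \<^bold>\<in> point_name S)) p)}"

definition char_name :: "'a \<Rightarrow> ('i, 'k random) name" where
  "char_name a = set_name ((\<lambda>(S, p, b). (pair_name (point_name S) (cut_name (of_bool b)), p)) ` char_pairs a)"

lemma elts_point_name: "elts (point_name S) = (\<lambda>(a, p). (e a, p)) ` S"
proof -
  obtain g :: "'a \<times> 'k random \<Rightarrow> 'i" where "inj g" using inj_pairs by blast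
  then have "inj_on g S" by (rule inj_on_subset) simp
  then show ?thesis unfolding point_name_def by (rule elts_set_name_image)
qed

lemma elts_char_name:
  "elts (char_name a) = (\<lambda>(S, p, b). (pair_name (point_name S) (cut_name (of_bool b)), p)) ` char_pairs a"
proof -
  obtain g :: "('a \<times> 'k random) set \<times> 'k random \<times> bool \<Rightarrow> 'i" where "inj g" using inj_points by blast
  then have "inj_on g (char_pairs a)" by (rule inj_on_subset) simp
  then show ?thesis unfolding char_name_def by (rule elts_set_name_image)
qed

text \<open>The set of pairs collects all that is forced about membership of elements of the
  algebra, and an ultrafilter has no other members. So canonical names reach every point, and
  \<open>char_name\<close> is defined on the whole Stone space.\<close>

lemma point_eq_point_name:
  assumes "is_point e x p"
  shows "(x \<^bold>= point_name {(b, s). (e b \<^bold>\<in> x) s}) p"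
proof (rule eq_ext)
  let ?S = "{(b, s). (e b \<^bold>\<in> x) s}"
  fix w q assume q: "q \<le> p"
  show "(w \<^bold>\<in> x) q \<longleftrightarrow> (w \<^bold>\<in> point_name ?S) q"
  proof
    assume w: "(w \<^bold>\<in> x) q"
    show "(w \<^bold>\<in> point_name ?S) q"
    proof (rule reg_dense[OF reg_mem])
      fix q' assume q': "q' \<le> q"
      have wx: "(w \<^bold>\<in> x) q'" using reg_mono[OF reg_mem w q'] .
      obtain r b where r: "r \<le> q'" "(w \<^bold>= e b) r"
        using point_elem[OF reg_mono[OF reg_is_point assms order_trans[OF q' q]] wx] by blast
      have "(e b \<^bold>\<in> x) r" using mem_cong1[OF r(2) reg_mono[OF reg_mem wx r(1)]] .
      then have "(e b, r) \<in> elts (point_name ?S)" by (force simp: elts_point_name)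
      then have "(e b \<^bold>\<in> point_name ?S) r" by (rule elts_mem) simp
      then show "\<exists>r\<le>q'. (w \<^bold>\<in> point_name ?S) r" using mem_cong1[OF eq_sym[OF r(2)]] r(1) by blast
    qed
  next
    assume w: "(w \<^bold>\<in> point_name ?S) q"
    show "(w \<^bold>\<in> x) q"
    proof (rule reg_dense[OF reg_mem])
      fix q' assume q': "q' \<le> q"
      obtain r b s where r: "r \<le> q'" "(e b \<^bold>\<in> x) s" "r \<le> s" "(w \<^bold>= e b) r"
        using w q' unfolding forces_mem_unfold[of w] elts_point_name by auto
      then have "(w \<^bold>\<in> x) r" using mem_cong1[OF eq_sym[OF r(4)] reg_mono[OF reg_mem r(2,3)]] by blast
      then show "\<exists>r\<le>q'. (w \<^bold>\<in> x) r" using r(1) by blast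
    qed
  qed
qed

lemma not_mem_cong: "(x \<^bold>= y) p \<Longrightarrow> (\<^bold>\<not> (w \<^bold>\<in> x)) p \<Longrightarrow> (\<^bold>\<not> (w \<^bold>\<in> y)) p"
  unfolding not_iff using mem_cong2_iff eq_mono by blast

lemma mem_char_nameE:
  assumes "(z \<^bold>\<in> char_name a) p"
  obtains r S b where "r \<le> p" "is_point e (point_name S) r"
    "if b then (e a \<^bold>\<in> point_name S) r else (\<^bold>\<not> (e a \<^bold>\<in> point_name S)) r"
    "(z \<^bold>= pair_name (point_name S) (cut_name (of_bool b))) r"
proof -
  obtain r \<tau> t where r: "r \<le> p" "(\<tau>, t) \<in> elts (char_name a)" "r \<le> t" "(z \<^bold>= \<tau>) r"
    using assms unfolding forces_mem_unfold[of z] by blast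
  then obtain S b where S: "(S, t, b) \<in> char_pairs a" "\<tau> = pair_name (point_name S) (cut_name (of_bool b))"
    unfolding elts_char_name by auto
  show ?thesis
  proof (rule that[OF r(1)])
    show "is_point e (point_name S) r"
      by (rule reg_mono[OF reg_is_point _ r(3)]) (use S(1) in \<open>simp add: char_pairs_def\<close>)
    show "if b then (e a \<^bold>\<in> point_name S) r else (\<^bold>\<not> (e a \<^bold>\<in> point_name S)) r"
      using S(1) reg_mono[OF reg_mem _ r(3)] reg_mono[OF reg_not[OF reg_mem] _ r(3)]
      by (auto simp: char_pairs_def split: if_splits)
    show "(z \<^bold>= pair_name (point_name S) (cut_name (of_bool b))) r" using r(4) S(2) by simp
  qed
qed

lemma app_char_nameE:
  assumes "app (char_name a) x y p"
  obtains r b where "r \<le> p" "(y \<^bold>= cut_name (of_bool b)) r" "if b then (e a \<^bold>\<in> x) r else (\<^bold>\<not> (e a \<^bold>\<in> x)) r"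
proof -
  obtain r z where z: "r \<le> p" "is_pair z x y r" "(z \<^bold>\<in> char_name a) r"
    using assms unfolding app_iff by blast
  obtain s S b where s: "s \<le> r"
    "if b then (e a \<^bold>\<in> point_name S) s else (\<^bold>\<not> (e a \<^bold>\<in> point_name S)) s"
    "(z \<^bold>= pair_name (point_name S) (cut_name (of_bool b))) s"
    using mem_char_nameE[OF z(3)] by metis
  have "is_pair z (point_name S) (cut_name (of_bool b)) s"
    using pair_cong[OF is_pair_pair_name eq_sym[OF s(3)] eq_refl eq_refl] .
  note eq = pair_inject[OF reg_mono[OF reg_is_pair z(2) s(1)] this]
  show ?thesis
  proof (rule that[OF order_trans[OF s(1) z(1)] eq(2)])
    show "if b then (e a \<^bold>\<in> x) s else (\<^bold>\<not> (e a \<^bold>\<in> x)) s"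
      using s(2) mem_cong2[OF eq_sym[OF eq(1)]] not_mem_cong[OF eq_sym[OF eq(1)]] by (cases b) auto
  qed
qed

lemma app_char_nameI:
  assumes "is_point e x p" "if b then (e a \<^bold>\<in> x) p else (\<^bold>\<not> (e a \<^bold>\<in> x)) p"
  shows "app (char_name a) x (cut_name (of_bool b)) p"
proof -
  define S where "S = {(b, s). (e b \<^bold>\<in> x) s}"
  have eq: "(x \<^bold>= point_name S) p" unfolding S_def by (rule point_eq_point_name[OF assms(1)])
  let ?z = "pair_name (point_name S) (cut_name (of_bool b)) :: ('i, 'k random) name"
  have "(S, p, b) \<in> char_pairs a"
    using point_cong[OF assms(1) eq] assms(2) mem_cong2[OF eq] not_mem_cong[OF eq] by (auto simp: char_pairs_def)
  then have "(?z, p) \<in> elts (char_name a)" unfolding elts_char_name by force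
  then have "(?z \<^bold>\<in> char_name a) p" by (rule elts_mem) simp
  moreover have "is_pair ?z x (cut_name (of_bool b)) p"
    by (rule pair_cong[OF is_pair_pair_name eq_refl eq_sym[OF eq] eq_refl])
  ultimately show ?thesis
    unfolding app_iff using reg_mono[OF reg_mem] reg_mono[OF reg_is_pair] by blast
qed

text \<open>Densely below \<open>p\<close> the membership of \<open>e a\<close> in \<open>x\<close>
  is decided and the value is the name of 0 or 1 accordingly; \<open>aef_dense\<close> glues these
  conditions together.\<close>

lemma app_char_name_denotes:
  assumes "app (char_name a) x y p"
  shows "eventually (\<lambda>w. denotes w y (of_bool (w \<in> tv (e a \<^bold>\<in> x)))) (aef p)"
proof (rule aef_dense)
  fix q assume q: "q \<le> p"
  obtain r b where r: "r \<le> q" "(y \<^bold>= cut_name (of_bool b)) r" "if b then (e a \<^bold>\<in> x) r else (\<^bold>\<not> (e a \<^bold>\<in> x)) r"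
    using app_char_nameE[OF reg_mono[OF reg_app assms q]] .
  have "eventually (\<lambda>w. w \<in> tv (e a \<^bold>\<in> x) \<longleftrightarrow> b) (aef r)"
  proof (cases b)
    case True
    then show ?thesis using r(3) tv_iff[OF reg_mem, of "e a" x r] by simp
  next
    case False
    then have "(\<^bold>\<not> (e a \<^bold>\<in> x)) r" using r(3) by simp
    then have "eventually (\<lambda>w. \<not> w \<in> tv (e a \<^bold>\<in> x)) (aef r)"
      using semD[OF sem_not[OF sem_self[OF reg_mem]]] by blast
    then show ?thesis using False by simp
  qed
  with below_eq_cut_name[OF r(2)] have "eventually (\<lambda>w. denotes w y (of_bool (w \<in> tv (e a \<^bold>\<in> x)))) (aef r)"
  proof eventually_elim
    case (elim w)
    have "q < of_bool b \<longleftrightarrow> (of_rat q :: real) < of_bool b" for q :: rat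
      by (cases b) (auto simp: of_rat_less_1_iff)
    then show ?case using elim unfolding denotes_def by simp
  qed
  then show "\<exists>r\<le>q. eventually (\<lambda>w. denotes w y (of_bool (w \<in> tv (e a \<^bold>\<in> x)))) (aef r)" using r(1) by blast
qed

lemma char_name_function: "is_function (char_name a) (is_point e) is_real p"
proof -
  have 1: "(\<^bold>\<forall>z. z \<^bold>\<in> char_name a \<^bold>\<longrightarrow> (\<^bold>\<exists>x y. is_point e x \<^bold>\<and> is_real y \<^bold>\<and> is_pair z x y)) p"
  proof (intro all_intro imp_intro)
    fix z q assume z: "(z \<^bold>\<in> char_name a) q"
    have rg: "reg (\<^bold>\<exists>x y. is_point e x \<^bold>\<and> is_real y \<^bold>\<and> is_pair z x y)"
      by (intro reg_intros reg_is_point reg_is_real reg_is_pair)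
    show "(\<^bold>\<exists>x y. is_point e x \<^bold>\<and> is_real y \<^bold>\<and> is_pair z x y) q"
    proof (rule reg_dense[OF rg])
      fix q' assume "q' \<le> q"
      then obtain r S b where r: "r \<le> q'" "is_point e (point_name S) r"
        "(z \<^bold>= pair_name (point_name S) (cut_name (of_bool b))) r"
        using mem_char_nameE[OF reg_mono[OF reg_mem z]] by metis
      let ?x = "point_name S" and ?y = "cut_name (of_bool b) :: ('i, 'k random) name"
      have "(is_point e ?x \<^bold>\<and> is_real ?y \<^bold>\<and> is_pair z ?x ?y) r"
        using r(2) is_real_cut[OF eq_refl] pair_cong[OF is_pair_pair_name eq_sym[OF r(3)] eq_refl eq_refl]
        by (simp add: and_iff)
      then have "(\<^bold>\<exists>y. is_point e ?x \<^bold>\<and> is_real y \<^bold>\<and> is_pair z ?x y) r"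
        by (rule ex_intro[of "\<lambda>y. is_point e ?x \<^bold>\<and> is_real y \<^bold>\<and> is_pair z ?x y"])
          (intro reg_intros reg_is_point reg_is_real reg_is_pair)
      then have "(\<^bold>\<exists>x y. is_point e x \<^bold>\<and> is_real y \<^bold>\<and> is_pair z x y) r"
        by (rule ex_intro[of "\<lambda>x. \<^bold>\<exists>y. is_point e x \<^bold>\<and> is_real y \<^bold>\<and> is_pair z x y"])
          (intro reg_intros reg_is_point reg_is_real reg_is_pair)
      then show "\<exists>r\<le>q'. (\<^bold>\<exists>x y. is_point e x \<^bold>\<and> is_real y \<^bold>\<and> is_pair z x y) r" using r(1) by blast
    qed
  qed (intro reg_intros reg_mem reg_is_point reg_is_real reg_is_pair)+
  have 2: "(\<^bold>\<forall>x. is_point e x \<^bold>\<longrightarrow> (\<^bold>\<exists>y. app (char_name a) x y)) p"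
  proof (intro all_intro imp_intro)
    fix x q assume x: "is_point e x q"
    show "(\<^bold>\<exists>y. app (char_name a) x y) q" unfolding ex_iff
    proof (intro allI impI)
      fix q' assume q': "q' \<le> q"
      obtain r b where r: "r \<le> q'" "if b then (e a \<^bold>\<in> x) r else (\<^bold>\<not> (e a \<^bold>\<in> x)) r"
        using decide[of q' "e a \<^bold>\<in> x"] by (metis order_refl)
      then show "\<exists>r\<le>q'. \<exists>y. app (char_name a) x y r"
        using app_char_nameI[OF reg_mono[OF reg_is_point x order_trans[OF r(1) q']] r(2)] by blast
    qed
  qed (intro reg_intros reg_is_point reg_app)+
  have 3: "(\<^bold>\<forall>x y y'. app (char_name a) x y \<^bold>\<and> app (char_name a) x y' \<^bold>\<longrightarrow> y \<^bold>= y') p"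
  proof (intro all_intro imp_intro)
    fix x y y' q assume "(app (char_name a) x y \<^bold>\<and> app (char_name a) x y') q"
    then have y: "app (char_name a) x y q" "app (char_name a) x y' q" by (simp_all add: and_iff)
    show "(y \<^bold>= y') q"
    proof (rule reg_dense[OF reg_eq])
      fix q' assume q': "q' \<le> q"
      obtain r b where r: "r \<le> q'" "(y \<^bold>= cut_name (of_bool b)) r" "if b then (e a \<^bold>\<in> x) r else (\<^bold>\<not> (e a \<^bold>\<in> x)) r"
        using app_char_nameE[OF reg_mono[OF reg_app y(1) q']] .
      obtain s b' where s: "s \<le> r" "(y' \<^bold>= cut_name (of_bool b')) s" "if b' then (e a \<^bold>\<in> x) s else (\<^bold>\<not> (e a \<^bold>\<in> x)) s"
        using app_char_nameE[OF reg_mono[OF reg_app y(2) order_trans[OF r(1) q']]] .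
      have "b = b'"
        using r(3) s(1,3) reg_mono[OF reg_mem _ s(1)] by (auto simp: not_iff split: if_splits)
      then have "(y \<^bold>= y') s" using eq_trans[OF eq_mono[OF r(2) s(1)]] eq_sym[OF s(2)] by blast
      then show "\<exists>r\<le>q'. (y \<^bold>= y') r" using order_trans[OF s(1) r(1)] by blast
    qed
  qed (intro reg_intros reg_app reg_eq)+
  show ?thesis unfolding is_function_def by (intro and_iff[THEN iffD2] conjI 1 2 3)
qed

lemma char_name_continuous: "is_continuous e (char_name a) p"
proof -
  let ?f = "char_name a"
  have "(\<^bold>\<forall>x u \<epsilon>. is_point e x \<^bold>\<and> app ?f x u \<^bold>\<and> ground (0 < \<epsilon>) \<^bold>\<longrightarrow>
         (\<^bold>\<exists>a. e a \<^bold>\<in> x \<^bold>\<and> (\<^bold>\<forall>y v. is_point e y \<^bold>\<and> e a \<^bold>\<in> y \<^bold>\<and> app ?f y v \<^bold>\<longrightarrow> dist_less v u \<epsilon>))) p"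
  proof (intro all_intro imp_intro)
    fix x u q and \<epsilon> :: rat assume "(is_point e x \<^bold>\<and> app ?f x u \<^bold>\<and> ground (0 < \<epsilon>)) q"
    then have x: "is_point e x q" "app ?f x u q" "0 < \<epsilon>" by (simp_all add: and_iff ground_iff)
    show "(\<^bold>\<exists>a. e a \<^bold>\<in> x \<^bold>\<and> (\<^bold>\<forall>y v. is_point e y \<^bold>\<and> e a \<^bold>\<in> y \<^bold>\<and> app ?f y v \<^bold>\<longrightarrow> dist_less v u \<epsilon>)) q"
      unfolding ex_iff
    proof (intro allI impI)
      fix q' assume q': "q' \<le> q"
      obtain r b where r: "r \<le> q'" "(u \<^bold>= cut_name (of_bool b)) r" "if b then (e a \<^bold>\<in> x) r else (\<^bold>\<not> (e a \<^bold>\<in> x)) r"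
        using app_char_nameE[OF reg_mono[OF reg_app x(2) q']] .
      \<comment> \<open>The function is constant on the clopen set of \<open>a'\<close>, the side of
        the partition by \<open>a\<close> on which \<open>x\<close> lies, so the same witness serves
        every \<epsilon>.\<close>
      define a' where "a' = (if b then a else - a)"
      have 1: "(e a' \<^bold>\<in> x) r"
        using r(3) point_compl[OF reg_mono[OF reg_is_point x(1) order_trans[OF r(1) q']]] by (auto simp: a'_def)
      have 2: "(\<^bold>\<forall>y v. is_point e y \<^bold>\<and> e a' \<^bold>\<in> y \<^bold>\<and> app ?f y v \<^bold>\<longrightarrow> dist_less v u \<epsilon>) r"
      proof (intro all_intro imp_intro)
        fix y v s assume s: "s \<le> r" and "(is_point e y \<^bold>\<and> e a' \<^bold>\<in> y \<^bold>\<and> app ?f y v) s"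
        then have y: "is_point e y s" "(e a' \<^bold>\<in> y) s" "app ?f y v s" by (simp_all add: and_iff)
        show "dist_less v u \<epsilon> s"
        proof (rule reg_dense[OF reg_dist_less])
          fix s' assume s': "s' \<le> s"
          obtain t b' where t: "t \<le> s'" "(v \<^bold>= cut_name (of_bool b')) t" "if b' then (e a \<^bold>\<in> y) t else (\<^bold>\<not> (e a \<^bold>\<in> y)) t"
            using app_char_nameE[OF reg_mono[OF reg_app y(3) s']] .
          have ts: "t \<le> s" using t(1) s' by (rule order_trans)
          have "(e a' \<^bold>\<in> y) t" "is_point e y t" using reg_mono[OF reg_mem y(2) ts] reg_mono[OF reg_is_point y(1) ts] .
          then have "b' = b"
            using t(3) point_consistent[of e y t a] by (auto simp: a'_def not_iff split: if_splits)
          then have "dist_less v u \<epsilon> t"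
            using dist_less_cut[OF t(2) _ x(3)] eq_mono[OF r(2) order_trans[OF ts s]] by simp
          then show "\<exists>r\<le>s'. dist_less v u \<epsilon> r" using t(1) by blast
        qed
      qed (intro reg_intros reg_is_point reg_mem reg_app reg_dist_less)+
      show "\<exists>r\<le>q'. \<exists>a. (e a \<^bold>\<in> x \<^bold>\<and> (\<^bold>\<forall>y v. is_point e y \<^bold>\<and> e a \<^bold>\<in> y \<^bold>\<and> app ?f y v \<^bold>\<longrightarrow> dist_less v u \<epsilon>)) r"
        using 1 2 r(1) by (intro exI[of _ r] conjI exI[of _ a'] and_iff[THEN iffD2])
    qed
  qed (intro reg_intros reg_is_point reg_mem reg_app reg_dist_less)+
  then show ?thesis unfolding is_continuous_def by (intro and_iff[THEN iffD2] conjI char_name_function)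
qed

end

section \<open>Lists representing measures\<close>

lemma ex2D:
  assumes "(\<^bold>\<exists>x y. \<phi> x y) p" shows "\<exists>r\<le>p. \<exists>x y. \<phi> x y r"
proof -
  obtain r x where r: "r \<le> p" "(\<^bold>\<exists>y. \<phi> x y) r"
    using assms ex_iff[of "\<lambda>x. \<^bold>\<exists>y. \<phi> x y" p] by blast
  then obtain s y where "s \<le> r" "\<phi> x y s" using ex_iff[of "\<phi> x" r] by blast
  then show ?thesis using order_trans[OF _ r(1)] by blast
qed

lemma ex3D:
  assumes "(\<^bold>\<exists>x y z. \<phi> x y z) p" shows "\<exists>r\<le>p. \<exists>x y z. \<phi> x y z r"
proof -
  obtain r x where r: "r \<le> p" "(\<^bold>\<exists>y z. \<phi> x y z) r"
    using assms ex_iff[of "\<lambda>x. \<^bold>\<exists>y z. \<phi> x y z" p] by blast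
  then obtain s y z where "s \<le> r" "\<phi> x y z s" using ex2D[of "\<phi> x" r] by blast
  then show ?thesis using order_trans[OF _ r(1)] by blast
qed

lemma reg_is_pair_in: "reg (is_pair_in z l)"
  by (induction l) (auto intro!: reg_intros reg_is_pair)

lemma reg_not_among: "reg (not_among x l)"
  by (induction l) (auto intro!: reg_intros reg_eq)

lemma reg_is_weight_list: "reg (is_weight_list e l)"
  by (induction l) (auto intro!: reg_intros reg_is_point reg_is_real reg_eq_rat reg_not_among)

lemma reg_is_measure_list: "reg (is_measure_list e m l)"
  unfolding is_measure_list_def by (intro reg_intros reg_is_weight_list reg_mem reg_is_pair_in)

lemma reg_is_abs_sum: "reg (is_abs_sum l r)"
proof (induction l arbitrary: r)
  case (Cons xa l)
  then show ?case unfolding is_abs_sum.simps by (intro reg_intros reg_is_abs reg_is_add)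
qed (simp add: reg_eq_rat)

lemma reg_is_weighted_sum: "reg (is_weighted_sum f l r)"
proof (induction l arbitrary: r)
  case (Cons xa l)
  then show ?case unfolding is_weighted_sum.simps by (intro reg_intros reg_app reg_is_mult reg_is_add)
qed (simp add: reg_eq_rat)

lemma reg_is_integral: "reg (is_integral e f m r)"
  unfolding is_integral_def by (intro reg_intros reg_is_measure_list reg_is_weighted_sum)

lemma not_among_iff: "not_among x l p \<longleftrightarrow> (\<forall>yb\<in>set l. (\<^bold>\<not> (x \<^bold>= fst yb)) p)"
  by (induction l) (auto simp: and_iff ground_iff)

lemma neq_sym: "(\<^bold>\<not> (x \<^bold>= y)) p \<Longrightarrow> (\<^bold>\<not> (y \<^bold>= x)) p"
  unfolding not_iff using eq_sym by blast

lemma weight_list_point: "is_weight_list e l p \<Longrightarrow> xa \<in> set l \<Longrightarrow> is_point e (fst xa) p"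
  by (induction l) (auto simp: and_iff)

lemma weight_list_neq:
  "is_weight_list e l p \<Longrightarrow> xa \<in> set l \<Longrightarrow> yb \<in> set l \<Longrightarrow> xa \<noteq> yb \<Longrightarrow> (\<^bold>\<not> (fst xa \<^bold>= fst yb)) p"
proof (induction l)
  case (Cons c l)
  then have c: "is_weight_list e l p" "\<forall>yb\<in>set l. (\<^bold>\<not> (fst c \<^bold>= fst yb)) p"
    by (simp_all add: and_iff not_among_iff)
  then show ?case using Cons neq_sym by auto
qed simp

lemma weight_list_distinct: "is_weight_list e l p \<Longrightarrow> distinct l"
proof (induction l)
  case (Cons c l)
  then have c: "is_weight_list e l p" "\<forall>yb\<in>set l. (\<^bold>\<not> (fst c \<^bold>= fst yb)) p"
    by (simp_all add: and_iff not_among_iff)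
  then have "c \<notin> set l" using eq_refl[of "fst c" p] by (auto simp: not_iff)
  then show ?case using Cons c by simp
qed simp

text \<open>The partial sums are existential witnesses, available only below stronger conditions.
  The real computed there does not depend on them, so density glues the results.\<close>

lemma abs_sum_denotes:
  assumes "is_abs_sum l r p" "is_weight_list e l p"
  shows "eventually (\<lambda>w. denotes w r (\<Sum>xa\<leftarrow>l. \<bar>val (snd xa) w\<bar>)) (aef p)"
  using assms
proof (induction l arbitrary: r p)
  case Nil
  then show ?case using eq_rat_denotes[of r 0 p] by simp
next
  case (Cons xa l)
  show ?case
  proof (rule aef_dense)
    fix q assume q: "q \<le> p"
    have "(\<^bold>\<exists>t s. is_abs t (snd xa) \<^bold>\<and> is_abs_sum l s \<^bold>\<and> is_add r t s) q"
      using reg_mono[OF reg_is_abs_sum Cons.prems(1) q] by simp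
    then obtain q' t s where "q' \<le> q" "(is_abs t (snd xa) \<^bold>\<and> is_abs_sum l s \<^bold>\<and> is_add r t s) q'"
      using ex2D[of "\<lambda>t s. is_abs t (snd xa) \<^bold>\<and> is_abs_sum l s \<^bold>\<and> is_add r t s" q] by blast
    then have q': "q' \<le> q" "is_abs t (snd xa) q'" "is_abs_sum l s q'" "is_add r t s q'" by (simp_all add: and_iff)
    have wl: "is_weight_list e (xa # l) q'" by (rule reg_mono[OF reg_is_weight_list Cons.prems(2) order_trans[OF q'(1) q]])
    then have wl': "is_weight_list e l q'" "is_real (snd xa) q'" by (simp_all add: and_iff)
    from Cons.IH[OF q'(3) wl'(1)] is_real_denotes[OF wl'(2)] is_abs_denotes[OF q'(2)] is_add_denotes[OF q'(4)]
    have "eventually (\<lambda>w. denotes w r (\<Sum>xa\<leftarrow>xa # l. \<bar>val (snd xa) w\<bar>)) (aef q')" by eventually_elim simp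
    then show "\<exists>r'\<le>q. eventually (\<lambda>w. denotes w r (\<Sum>xa\<leftarrow>xa # l. \<bar>val (snd xa) w\<bar>)) (aef r')" using q'(1) by blast
  qed
qed

lemma sem_pair_in: "sem (is_pair_in z l) (\<lambda>w. \<exists>xa\<in>set l. w \<in> tv (is_pair z (fst xa) (snd xa)))"
proof (induction l)
  case Nil
  then show ?case using sem_ground[of False] by simp
next
  case (Cons xa l)
  then show ?case using sem_or[OF sem_self[OF reg_is_pair] Cons, of z "fst xa" "snd xa"] by simp
qed

lemma measure_list_weight: "is_measure_list e m l p \<Longrightarrow> is_weight_list e l p"
  by (simp add: is_measure_list_def and_iff)

lemma measure_list_mem:
  assumes "is_measure_list e m l p" "q \<le> p"
  shows "(z \<^bold>\<in> m) q \<longleftrightarrow> is_pair_in z l q"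
proof -
  have "forced_at (\<^bold>\<forall>z. z \<^bold>\<in> m \<^bold>\<longleftrightarrow> is_pair_in z l) p"
    using assms(1) by (simp add: is_measure_list_def forced_at_def and_iff)
  then have "(z \<^bold>\<in> m \<^bold>\<longleftrightarrow> is_pair_in z l) p" unfolding forced_at_def forces_all_def by blast
  then show ?thesis using iff_iff[OF reg_mem reg_is_pair_in] assms(2) by blast
qed

lemma tv_imp2:
  assumes "reg \<phi>" "reg \<psi>" "reg \<theta>" "\<And>q. q \<le> p \<Longrightarrow> \<phi> q \<Longrightarrow> \<psi> q \<Longrightarrow> \<theta> q"
  shows "eventually (\<lambda>w. w \<in> tv \<phi> \<longrightarrow> w \<in> tv \<psi> \<longrightarrow> w \<in> tv \<theta>) (aef p)"
proof (rule aef_impI[OF assms(1)])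
  fix q assume q: "q \<le> p" "\<phi> q"
  show "eventually (\<lambda>w. w \<in> tv \<psi> \<longrightarrow> w \<in> tv \<theta>) (aef q)"
  proof (rule aef_impI[OF assms(2)])
    fix r assume r: "r \<le> q" "\<psi> r"
    then have "\<theta> r" using assms(4)[OF order_trans[OF r(1) q(1)]] reg_mono[OF assms(1) q(2) r(1)] by blast
    then show "eventually (\<lambda>w. w \<in> tv \<theta>) (aef r)" using tv_iff[OF assms(3)] by blast
  qed
qed

lemma tv_eq_val: "eventually (\<lambda>w. w \<in> tv (x \<^bold>= y) \<longrightarrow> val x w = val y w) (aef p)"
proof (rule aef_impI[OF reg_eq])
  fix q assume "(x \<^bold>= y) q"
  then have "eventually (\<lambda>w. \<forall>q. below x w q \<longleftrightarrow> below y w q) (aef q)"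
    by (intro aef_all_countable tv_eqD)
  then show "eventually (\<lambda>w. val x w = val y w) (aef q)" by eventually_elim (simp add: val_def)
qed

lemma tv_eq_mem: "eventually (\<lambda>w. w \<in> tv (x \<^bold>= y) \<longrightarrow> (w \<in> tv (s \<^bold>\<in> x) \<longleftrightarrow> w \<in> tv (s \<^bold>\<in> y))) (aef p)"
  by (rule aef_impI[OF reg_eq]) (rule tv_eqD)

section \<open>Comparing two lists of the same measure\<close>

lemma sum_matching:
  fixes g :: "'x \<Rightarrow> real"
  assumes "\<And>a. a \<in> A \<Longrightarrow> \<exists>b\<in>B. R a b \<and> g a = h b" "\<And>b. b \<in> B \<Longrightarrow> \<exists>a\<in>A. R a b"
    and "\<And>a b b'. a \<in> A \<Longrightarrow> b \<in> B \<Longrightarrow> b' \<in> B \<Longrightarrow> R a b \<Longrightarrow> R a b' \<Longrightarrow> b = b'"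
    and "\<And>a a' b. a \<in> A \<Longrightarrow> a' \<in> A \<Longrightarrow> b \<in> B \<Longrightarrow> R a b \<Longrightarrow> R a' b \<Longrightarrow> a = a'"
  shows "sum g A = sum h B"
proof -
  obtain f where f: "\<And>a. a \<in> A \<Longrightarrow> f a \<in> B \<and> R a (f a) \<and> g a = h (f a)" using assms(1) by metis
  have "bij_betw f A B"
  proof (rule bij_betwI')
    fix a a' assume "a \<in> A" "a' \<in> A"
    then show "(f a = f a') = (a = a')" using f assms(4) by metis
  next
    fix b assume "b \<in> B"
    then show "\<exists>a\<in>A. b = f a" using f assms(2,3) by metis
  qed (use f in blast)
  from sum.reindex_bij_betw[OF this, of h] show ?thesis using f by (simp cong: sum.cong)
qed

context big_names
begin

lemma weighted_sum_denotes:
  assumes "is_weighted_sum (char_name a) l r p" "is_weight_list e l p"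
  shows "eventually (\<lambda>w. denotes w r (\<Sum>xa\<leftarrow>l. val (snd xa) w * of_bool (w \<in> tv (e a \<^bold>\<in> fst xa)))) (aef p)"
  using assms
proof (induction l arbitrary: r p)
  case Nil
  then show ?case using eq_rat_denotes[of r 0 p] by simp
next
  case (Cons xa l)
  let ?Q = "\<lambda>w. denotes w r (\<Sum>xa\<leftarrow>xa # l. val (snd xa) w * of_bool (w \<in> tv (e a \<^bold>\<in> fst xa)))"
  let ?\<phi> = "\<lambda>y t s. app (char_name a) (fst xa) y \<^bold>\<and> is_mult t (snd xa) y \<^bold>\<and> is_weighted_sum (char_name a) l s \<^bold>\<and> is_add r t s"
  show ?case
  proof (rule aef_dense)
    fix q assume q: "q \<le> p"
    have "(\<^bold>\<exists>y t s. ?\<phi> y t s) q"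
      using reg_mono[OF reg_is_weighted_sum Cons.prems(1) q] by simp
    then obtain q' y t s where "q' \<le> q" "?\<phi> y t s q'" using ex3D[of ?\<phi> q] by blast
    then have q': "q' \<le> q" "app (char_name a) (fst xa) y q'" "is_mult t (snd xa) y q'"
      "is_weighted_sum (char_name a) l s q'" "is_add r t s q'" by (simp_all add: and_iff)
    have wl: "is_weight_list e (xa # l) q'" by (rule reg_mono[OF reg_is_weight_list Cons.prems(2) order_trans[OF q'(1) q]])
    then have wl': "is_weight_list e l q'" "is_real (snd xa) q'" by (simp_all add: and_iff)
    from Cons.IH[OF q'(4) wl'(1)] is_real_denotes[OF wl'(2)] app_char_name_denotes[OF q'(2)]
      is_mult_denotes[OF q'(3)] is_add_denotes[OF q'(5)]
    have "eventually ?Q (aef q')" by eventually_elim simp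
    then show "\<exists>r'\<le>q. eventually ?Q (aef r')" using q'(1) by blast
  qed
qed

text \<open>The pair named by an entry of \<open>l\<close> is forced to be among the pairs of
  \<open>l'\<close> as well. That is a finite disjunction, which can be read pointwise; injectivity
  of pairs turns each case into equality of both components.\<close>

lemma measure_lists_match:
  assumes "\<And>z q. q \<le> p \<Longrightarrow> is_pair_in z l q \<Longrightarrow> is_pair_in z l' q" "xa \<in> set (l :: (('i, 'k random) name \<times> _) list)"
  shows "eventually (\<lambda>w. \<exists>yb\<in>set l'. w \<in> tv (fst xa \<^bold>= fst yb) \<and> w \<in> tv (snd xa \<^bold>= snd yb)) (aef p)"
proof -
  let ?z = "pair_name (fst xa) (snd xa) :: ('i, 'k random) name"
  have "eventually (\<lambda>w. w \<in> tv (is_pair ?z (fst xa) (snd xa))) (aef p)"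
    using tv_iff[OF reg_is_pair] is_pair_pair_name by blast
  then have "eventually (\<lambda>w. \<exists>yb\<in>set l. w \<in> tv (is_pair ?z (fst yb) (snd yb))) (aef p)"
    by eventually_elim (use assms(2) in blast)
  then have "is_pair_in ?z l p" using semD[OF sem_pair_in] by blast
  then have "is_pair_in ?z l' p" using assms(1) by blast
  then have "eventually (\<lambda>w. \<exists>yb\<in>set l'. w \<in> tv (is_pair ?z (fst yb) (snd yb))) (aef p)"
    using semD[OF sem_pair_in] by blast
  moreover have "eventually (\<lambda>w. w \<in> tv (is_pair ?z (fst yb) (snd yb)) \<longrightarrow>
      w \<in> tv (fst xa \<^bold>= fst yb) \<and> w \<in> tv (snd xa \<^bold>= snd yb)) (aef p)" for yb
  proof (rule aef_impI[OF reg_is_pair])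
    fix q assume "is_pair ?z (fst yb) (snd yb) q"
    then have "(fst xa \<^bold>= fst yb) q" "(snd xa \<^bold>= snd yb) q" using pair_inject[OF is_pair_pair_name] by blast+
    then show "eventually (\<lambda>w. w \<in> tv (fst xa \<^bold>= fst yb) \<and> w \<in> tv (snd xa \<^bold>= snd yb)) (aef q)"
      by (simp add: eventually_conj_iff tv_iff[OF reg_eq, symmetric])
  qed
  then have "eventually (\<lambda>w. \<forall>yb\<in>set l'. w \<in> tv (is_pair ?z (fst yb) (snd yb)) \<longrightarrow>
      w \<in> tv (fst xa \<^bold>= fst yb) \<and> w \<in> tv (snd xa \<^bold>= snd yb)) (aef p)"
    by (intro aef_ball_countable) (simp_all add: countable_finite)
  ultimately show ?thesis by eventually_elim blast
qed

text \<open>Each formula about a measure chooses its own list, and the choice varies with the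
  condition. A quantity respecting forced equality of points and weights can be moved to one fixed
  list: pointwise, equality of points is a bijection between the two lists, since the points of each
  list are pairwise different.\<close>

lemma measure_list_sums_agree:
  fixes g :: "('i, 'k random) name \<times> ('i, 'k random) name \<Rightarrow> ('k \<Rightarrow> bool) \<Rightarrow> real"
  assumes l: "is_measure_list e m l p" and l': "is_measure_list e m' l' p" and m: "(m \<^bold>= m') p"
    and g: "\<And>xa yb. eventually (\<lambda>w. w \<in> tv (fst xa \<^bold>= fst yb) \<longrightarrow> w \<in> tv (snd xa \<^bold>= snd yb) \<longrightarrow> g xa w = g yb w) (aef p)"
  shows "eventually (\<lambda>w. (\<Sum>xa\<leftarrow>l. g xa w) = (\<Sum>xa\<leftarrow>l'. g xa w)) (aef p)"
proof -
  note wl = measure_list_weight[OF l] and wl' = measure_list_weight[OF l']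
  have iff: "is_pair_in z l q \<longleftrightarrow> is_pair_in z l' q" if "q \<le> p" for z q
    using measure_list_mem[OF l that] measure_list_mem[OF l' that] mem_cong2_iff[OF eq_mono[OF m that]] by blast
  have fin: "countable (set l)" "countable (set l')" by (simp_all add: countable_finite)
  have A: "eventually (\<lambda>w. \<forall>xa\<in>set l. \<exists>yb\<in>set l'. w \<in> tv (fst xa \<^bold>= fst yb) \<and> w \<in> tv (snd xa \<^bold>= snd yb)) (aef p)"
    by (rule aef_ball_countable[OF fin(1) measure_lists_match[OF iff[THEN iffD1]]])
  have B: "eventually (\<lambda>w. \<forall>yb\<in>set l'. \<exists>xa\<in>set l. w \<in> tv (fst yb \<^bold>= fst xa) \<and> w \<in> tv (snd yb \<^bold>= snd xa)) (aef p)"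
    by (rule aef_ball_countable[OF fin(2) measure_lists_match[OF iff[THEN iffD2]]])
  have neq: "eventually (\<lambda>w. \<forall>xa\<in>set l. \<forall>yb\<in>set l. xa \<noteq> yb \<longrightarrow> w \<notin> tv (fst xa \<^bold>= fst yb)) (aef p)"
    if "is_weight_list e l p" for l
  proof (intro aef_ball_countable)
    fix xa yb assume "xa \<in> set l" "yb \<in> set l"
    then show "eventually (\<lambda>w. xa \<noteq> yb \<longrightarrow> w \<notin> tv (fst xa \<^bold>= fst yb)) (aef p)"
      using weight_list_neq[OF that] semD[OF sem_not[OF sem_self[OF reg_eq]], of "fst xa" "fst yb" p]
      by (cases "xa = yb") auto
  qed (simp_all add: countable_finite)
  have sym: "eventually (\<lambda>w. \<forall>xa\<in>set l. \<forall>yb\<in>set l'. w \<in> tv (fst yb \<^bold>= fst xa) \<longrightarrow> w \<in> tv (fst xa \<^bold>= fst yb)) (aef p)"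
  proof (intro aef_ball_countable fin aef_impI[OF reg_eq])
    fix xa yb :: "('i, 'k random) name \<times> ('i, 'k random) name" and q assume "(fst yb \<^bold>= fst xa) q"
    then show "eventually (\<lambda>w. w \<in> tv (fst xa \<^bold>= fst yb)) (aef q)" using tv_iff[OF reg_eq] eq_sym by blast
  qed
  have join1: "eventually (\<lambda>w. \<forall>xa\<in>set l. \<forall>xa'\<in>set l. \<forall>yb\<in>set l'.
      w \<in> tv (fst xa \<^bold>= fst yb) \<longrightarrow> w \<in> tv (fst xa' \<^bold>= fst yb) \<longrightarrow> w \<in> tv (fst xa \<^bold>= fst xa')) (aef p)"
    by (intro aef_ball_countable fin tv_imp2 reg_eq) (rule eq_trans[OF _ eq_sym])
  have join2: "eventually (\<lambda>w. \<forall>xa\<in>set l. \<forall>yb\<in>set l'. \<forall>yb'\<in>set l'.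
      w \<in> tv (fst xa \<^bold>= fst yb) \<longrightarrow> w \<in> tv (fst xa \<^bold>= fst yb') \<longrightarrow> w \<in> tv (fst yb \<^bold>= fst yb')) (aef p)"
    by (intro aef_ball_countable fin tv_imp2 reg_eq) (rule eq_trans[OF eq_sym])
  have gg: "eventually (\<lambda>w. \<forall>xa\<in>set l. \<forall>yb\<in>set l'. w \<in> tv (fst xa \<^bold>= fst yb) \<longrightarrow> w \<in> tv (snd xa \<^bold>= snd yb) \<longrightarrow>
      g xa w = g yb w) (aef p)"
    by (intro aef_ball_countable fin g)
  from A B neq[OF wl] neq[OF wl'] sym join1 join2 gg show ?thesis
  proof eventually_elim
    case (elim w)
    have "(\<Sum>xa\<in>set l. g xa w) = (\<Sum>yb\<in>set l'. g yb w)"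
    proof (rule sum_matching[where R = "\<lambda>xa yb. w \<in> tv (fst xa \<^bold>= fst yb)"])
      fix xa assume "xa \<in> set l"
      then show "\<exists>yb\<in>set l'. w \<in> tv (fst xa \<^bold>= fst yb) \<and> g xa w = g yb w" using elim(1,8) by meson
    next
      fix yb assume "yb \<in> set l'"
      then show "\<exists>xa\<in>set l. w \<in> tv (fst xa \<^bold>= fst yb)" using elim(2,5) by meson
    next
      fix xa yb yb' assume "xa \<in> set l" "yb \<in> set l'" "yb' \<in> set l'" "w \<in> tv (fst xa \<^bold>= fst yb)" "w \<in> tv (fst xa \<^bold>= fst yb')"
      then show "yb = yb'" using elim(4,7) by meson
    next
      fix xa xa' yb assume "xa \<in> set l" "xa' \<in> set l" "yb \<in> set l'" "w \<in> tv (fst xa \<^bold>= fst yb)" "w \<in> tv (fst xa' \<^bold>= fst yb)"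
      then show "xa = xa'" using elim(3,6) by meson
    qed
    then show ?case
      using weight_list_distinct[OF wl] weight_list_distinct[OF wl'] by (simp add: sum_list_distinct_conv_sum_set)
  qed
qed

text \<open>Ultrafilters forced to differ are separated by some element, but which one is decided
  only densely below \<open>p\<close>. A cover of \<open>p\<close> by countably many deciding
  conditions brings the elements needed down to countably many.\<close>

lemma points_separated:
  assumes x: "is_point e x p" and y: "is_point e y p" and neq: "(\<^bold>\<not> (x \<^bold>= y)) p"
  shows "\<exists>C. countable C \<and> eventually (\<lambda>w. \<exists>a\<in>C. w \<in> tv (e a \<^bold>\<in> x) \<longleftrightarrow> w \<notin> tv (e a \<^bold>\<in> y)) (aef p)"
proof -
  define P where "P r a \<longleftrightarrow> ((e a \<^bold>\<in> x) r \<and> (\<^bold>\<not> (e a \<^bold>\<in> y)) r) \<or> ((\<^bold>\<not> (e a \<^bold>\<in> x)) r \<and> (e a \<^bold>\<in> y) r)" for r a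
  have sub: "(w \<^bold>\<in> V) s"
    if U: "is_point e U q" and none: "\<And>r a. r \<le> q \<Longrightarrow> \<not> ((e a \<^bold>\<in> U) r \<and> (\<^bold>\<not> (e a \<^bold>\<in> V)) r)"
      and s: "s \<le> q" "(w \<^bold>\<in> U) s" for U V q s w
  proof (rule reg_dense[OF reg_mem])
    fix t assume t: "t \<le> s"
    obtain r a where r: "r \<le> t" "(w \<^bold>= e a) r"
      using point_elem[OF reg_mono[OF reg_is_point U order_trans[OF t s(1)]] reg_mono[OF reg_mem s(2) t]] by blast
    have rs: "r \<le> s" using r(1) t by (rule order_trans)
    have a: "(e a \<^bold>\<in> U) r" using mem_cong1[OF r(2) reg_mono[OF reg_mem s(2) rs]] .
    have "\<not> (\<^bold>\<not> (e a \<^bold>\<in> V)) r" using none[OF order_trans[OF rs s(1)]] a by blast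
    then obtain r' where r': "r' \<le> r" "(e a \<^bold>\<in> V) r'" by (auto simp: not_iff)
    have "(w \<^bold>\<in> V) r'" using mem_cong1[OF eq_sym[OF eq_mono[OF r(2) r'(1)]] r'(2)] .
    then show "\<exists>r\<le>t. (w \<^bold>\<in> V) r" using order_trans[OF r'(1) r(1)] by blast
  qed
  have "\<exists>r\<le>q. \<exists>a. P r a" if q: "q \<le> p" for q
  proof (rule ccontr)
    assume "\<not> ?thesis"
    then have n: "\<And>r a. r \<le> q \<Longrightarrow> \<not> P r a" by blast
    have "(x \<^bold>= y) q"
    proof (rule eq_ext)
      fix w s assume s: "s \<le> q"
      show "(w \<^bold>\<in> x) s \<longleftrightarrow> (w \<^bold>\<in> y) s"
        using sub[OF reg_mono[OF reg_is_point x q] _ s] sub[OF reg_mono[OF reg_is_point y q] _ s] n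
        unfolding P_def by blast
    qed
    then show False using neq q by (auto simp: not_iff)
  qed
  then obtain J where J: "countable J" "\<And>r. r \<in> J \<Longrightarrow> r \<le> p \<and> (\<exists>a. P r a)" "eventually (\<lambda>w. \<exists>r\<in>J. w \<in> rep r) (aef p)"
    using countable_cover[of p "\<lambda>r. \<exists>a. P r a"] by blast
  obtain a where a: "\<And>r. r \<in> J \<Longrightarrow> P r (a r)" using J(2) by metis
  have ev: "eventually (\<lambda>w. w \<in> tv (e (a r) \<^bold>\<in> x) \<longleftrightarrow> w \<notin> tv (e (a r) \<^bold>\<in> y)) (aef r)" if r: "r \<in> J" for r
  proof -
    have s: "(e b \<^bold>\<in> z) r \<Longrightarrow> eventually (\<lambda>w. w \<in> tv (e b \<^bold>\<in> z)) (aef r)"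
      "(\<^bold>\<not> (e b \<^bold>\<in> z)) r \<Longrightarrow> eventually (\<lambda>w. w \<notin> tv (e b \<^bold>\<in> z)) (aef r)" for b z
      using tv_iff[OF reg_mem] semD[OF sem_not[OF sem_self[OF reg_mem]]] by blast+
    from a[OF r] show ?thesis unfolding P_def
    proof
      assume *: "(e (a r) \<^bold>\<in> x) r \<and> (\<^bold>\<not> (e (a r) \<^bold>\<in> y)) r"
      from s(1)[OF conjunct1[OF *]] s(2)[OF conjunct2[OF *]] show ?thesis by eventually_elim blast
    next
      assume *: "(\<^bold>\<not> (e (a r) \<^bold>\<in> x)) r \<and> (e (a r) \<^bold>\<in> y) r"
      from s(2)[OF conjunct1[OF *]] s(1)[OF conjunct2[OF *]] show ?thesis by eventually_elim blast
    qed
  qed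
  have "coin_null (\<Union>r\<in>J. {w \<in> rep r. \<not> (w \<in> tv (e (a r) \<^bold>\<in> x) \<longleftrightarrow> w \<notin> tv (e (a r) \<^bold>\<in> y))})"
    using J(1) ev by (intro coin_null_UN) (auto simp: eventually_aef)
  with J(3) have "eventually (\<lambda>w. \<exists>b\<in>a ` J. w \<in> tv (e b \<^bold>\<in> x) \<longleftrightarrow> w \<notin> tv (e b \<^bold>\<in> y)) (aef p)"
    unfolding eventually_aef by (rule coin_null_subset2) blast
  then show ?thesis using J(1) by (intro exI[of _ "a ` J"]) simp
qed

end

section \<open>From the forcing extension to random measures\<close>

lemma forced_at_allD: "forced_at (\<^bold>\<forall>x. \<phi> x) p \<Longrightarrow> forced_at (\<phi> x) p"
  by (simp add: forced_at_def forces_all_def)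

lemma forced_at_impD:
  "forced_at (\<phi> \<^bold>\<longrightarrow> \<psi>) p \<Longrightarrow> reg \<phi> \<Longrightarrow> reg \<psi> \<Longrightarrow> q \<le> p \<Longrightarrow> \<phi> q \<Longrightarrow> \<psi> q"
  unfolding forced_at_def using imp_iff by blast

lemma forced_at_exD: "forced_at (\<^bold>\<exists>x. \<phi> x) p \<Longrightarrow> q \<le> p \<Longrightarrow> \<exists>r\<le>q. \<exists>x. \<phi> x r"
  unfolding forced_at_def ex_iff by blast

lemma reg_is_norm: "reg (is_norm e m r)"
  unfolding is_norm_def by (intro reg_intros reg_is_measure_list reg_is_abs_sum)

context big_names
begin

abbreviation list_norm :: "(('i, 'k random) name \<times> ('i, 'k random) name) list \<Rightarrow> ('k \<Rightarrow> bool) \<Rightarrow> real" where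
  "list_norm l w \<equiv> \<Sum>xa\<leftarrow>l. \<bar>val (snd xa) w\<bar>"

abbreviation list_measure :: "'a \<Rightarrow> (('i, 'k random) name \<times> ('i, 'k random) name) list \<Rightarrow> ('k \<Rightarrow> bool) \<Rightarrow> real" where
  "list_measure a l w \<equiv> \<Sum>xa\<leftarrow>l. val (snd xa) w * of_bool (w \<in> tv (e a \<^bold>\<in> fst xa))"

lemma list_norm_agree:
  assumes "is_measure_list e m l p" "is_measure_list e m' l' p" "(m \<^bold>= m') p"
  shows "eventually (\<lambda>w. list_norm l w = list_norm l' w) (aef p)"
  using assms
proof (rule measure_list_sums_agree)
  fix xa yb :: "('i, 'k random) name \<times> ('i, 'k random) name"
  show "eventually (\<lambda>w. w \<in> tv (fst xa \<^bold>= fst yb) \<longrightarrow> w \<in> tv (snd xa \<^bold>= snd yb) \<longrightarrow>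
      \<bar>val (snd xa) w\<bar> = \<bar>val (snd yb) w\<bar>) (aef p)"
    using tv_eq_val[of "snd xa" "snd yb"] by eventually_elim simp
qed

lemma list_measure_agree:
  assumes "is_measure_list e m l p" "is_measure_list e m' l' p" "(m \<^bold>= m') p"
  shows "eventually (\<lambda>w. list_measure a l w = list_measure a l' w) (aef p)"
  using assms
proof (rule measure_list_sums_agree)
  fix xa yb :: "('i, 'k random) name \<times> ('i, 'k random) name"
  show "eventually (\<lambda>w. w \<in> tv (fst xa \<^bold>= fst yb) \<longrightarrow> w \<in> tv (snd xa \<^bold>= snd yb) \<longrightarrow>
      val (snd xa) w * of_bool (w \<in> tv (e a \<^bold>\<in> fst xa)) = val (snd yb) w * of_bool (w \<in> tv (e a \<^bold>\<in> fst yb))) (aef p)"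
    using tv_eq_val[of "snd xa" "snd yb"] tv_eq_mem[of "fst xa" "fst yb" "e a"] by eventually_elim simp
qed

text \<open>The inner existential quantifiers range over names. Isolated as one formula, they leave
  only quantifiers over natural numbers, which \<open>weak_star_null_small_integral\<close>
  evaluates pointwise.\<close>

definition small_integral :: "('i, 'k random) name \<Rightarrow> 'a \<Rightarrow> rat \<Rightarrow> nat \<Rightarrow> 'k random formula" where
  "small_integral \<mu> a \<epsilon> n = (\<^bold>\<exists>m r s. app \<mu> (nat_name n) m \<^bold>\<and> is_integral e (char_name a) m r \<^bold>\<and> is_abs s r \<^bold>\<and> less_rat s \<epsilon>)"

lemma reg_small_integral: "reg (small_integral \<mu> a \<epsilon> n)"
  unfolding small_integral_def by (intro reg_intros reg_app reg_is_integral reg_is_abs reg_less_rat)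

lemma weak_star_null_small_integral:
  assumes "weak_star_null e \<mu> p" "0 < \<epsilon>"
  shows "eventually (\<lambda>w. \<exists>N. \<forall>n. N \<le> n \<longrightarrow> w \<in> tv (small_integral \<mu> a \<epsilon> n)) (aef p)"
proof -
  have rg: "reg (\<^bold>\<exists>N. \<^bold>\<forall>n. ground (N \<le> n) \<^bold>\<longrightarrow> small_integral \<mu> a \<epsilon> n)"
    by (intro reg_intros reg_small_integral)
  have rc: "reg (is_continuous e (char_name a) \<^bold>\<and> ground (0 < \<epsilon>))"
    unfolding is_continuous_def is_function_def
    by (intro reg_intros reg_is_point reg_is_real reg_is_pair reg_app reg_mem reg_eq reg_dist_less)
  have "forced_at (is_continuous e (char_name a) \<^bold>\<and> ground (0 < \<epsilon>) \<^bold>\<longrightarrow>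
      (\<^bold>\<exists>N. \<^bold>\<forall>n. ground (N \<le> n) \<^bold>\<longrightarrow> small_integral \<mu> a \<epsilon> n)) p"
    using forced_atI[of "weak_star_null e \<mu>", OF assms(1), unfolded weak_star_null_def,
      THEN forced_at_allD[of _ _ "char_name a"], THEN forced_at_allD[of _ _ \<epsilon>]]
    unfolding small_integral_def .
  from forced_at_impD[OF this rc rg order_refl]
  have "forced_at (\<^bold>\<exists>N. \<^bold>\<forall>n. ground (N \<le> n) \<^bold>\<longrightarrow> small_integral \<mu> a \<epsilon> n) p"
    unfolding forced_at_def using char_name_continuous assms(2) by (simp add: and_iff ground_iff)
  then show ?thesis
    by (rule semE) (intro sem_intros sem_self[OF reg_small_integral])
qed

text \<open>The integral is witnessed by another name of the measure of index \<open>n\<close> and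
  by another list. Uniqueness of the value of the sequence and \<open>list_measure_agree\<close>
  move the estimate to the given list \<open>l\<close>.\<close>

lemma small_integral_list_measure:
  assumes uniq: "\<And>q x y y'. q \<le> p \<Longrightarrow> app \<mu> x y q \<Longrightarrow> app \<mu> x y' q \<Longrightarrow> (y \<^bold>= y') q"
    and m: "app \<mu> (nat_name n) m p" "is_measure_list e m l p"
  shows "eventually (\<lambda>w. w \<in> tv (small_integral \<mu> a \<epsilon> n) \<longrightarrow> \<bar>list_measure a l w\<bar> < of_rat \<epsilon>) (aef p)"
proof (rule aef_impI[OF reg_small_integral], rule aef_dense)
  fix q q' assume q: "q \<le> p" "small_integral \<mu> a \<epsilon> n q" "q' \<le> q"
  let ?\<phi> = "\<lambda>m r s. app \<mu> (nat_name n) m \<^bold>\<and> is_integral e (char_name a) m r \<^bold>\<and> is_abs s r \<^bold>\<and> less_rat s \<epsilon>"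
  have "(\<^bold>\<exists>m r s. ?\<phi> m r s) q'" using reg_mono[OF reg_small_integral q(2,3)] by (simp add: small_integral_def)
  then obtain t m' r s where "t \<le> q'" "?\<phi> m' r s t" using ex3D[of ?\<phi> q'] by blast
  then have t: "t \<le> q'" "app \<mu> (nat_name n) m' t" "is_integral e (char_name a) m' r t" "is_abs s r t" "less_rat s \<epsilon> t"
    by (simp_all add: and_iff)
  then obtain t' l' where t': "t' \<le> t" "(is_measure_list e m' l' \<^bold>\<and> is_weighted_sum (char_name a) l' r) t'"
    unfolding is_integral_def ex_iff by blast
  have tp: "t' \<le> p" using t'(1) t(1) q(3) q(1) by order
  have l': "is_measure_list e m' l' t'" "is_weighted_sum (char_name a) l' r t'" using t'(2) by (simp_all add: and_iff)
  have "(m \<^bold>= m') t'" using uniq[OF tp reg_mono[OF reg_app m(1) tp] reg_mono[OF reg_app t(2) t'(1)]] .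
  from list_measure_agree[OF reg_mono[OF reg_is_measure_list m(2) tp] l'(1) this, of a]
    weighted_sum_denotes[OF l'(2) measure_list_weight[OF l'(1)]]
    is_abs_denotes[OF reg_mono[OF reg_is_abs t(4) t'(1)]] less_rat_denotes[OF reg_mono[OF reg_less_rat t(5) t'(1)]]
  have "eventually (\<lambda>w. \<bar>list_measure a l w\<bar> < of_rat \<epsilon>) (aef t')" by eventually_elim simp
  then show "\<exists>r\<le>q'. eventually (\<lambda>w. \<bar>list_measure a l w\<bar> < of_rat \<epsilon>) (aef r)"
    using order_trans[OF t'(1) t(1)] by blast
qed

lemma norm_one_list_norm:
  assumes uniq: "\<And>q x y y'. q \<le> p \<Longrightarrow> app \<mu> x y q \<Longrightarrow> app \<mu> x y' q \<Longrightarrow> (y \<^bold>= y') q"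
    and m: "app \<mu> (nat_name n) m p" "is_measure_list e m l p"
    and norm: "all_norm_one e \<mu> p"
  shows "eventually (\<lambda>w. list_norm l w = 1) (aef p)"
proof (rule aef_dense)
  fix q assume q: "q \<le> p"
  let ?\<phi> = "\<lambda>m r. app \<mu> (nat_name n) m \<^bold>\<and> is_norm e m r \<^bold>\<and> eq_rat r 1"
  have "forced_at (\<^bold>\<exists>m r. ?\<phi> m r) p"
    by (rule forced_atI[of "all_norm_one e \<mu>", OF norm, unfolded all_norm_one_def, THEN forced_at_allD])
  moreover have "reg (\<^bold>\<exists>m r. ?\<phi> m r)" by (intro reg_intros reg_app reg_is_norm reg_eq_rat)
  ultimately have "(\<^bold>\<exists>m r. ?\<phi> m r) q" unfolding forced_at_def using reg_mono q by blast
  then obtain t m' r where "t \<le> q" "?\<phi> m' r t" using ex2D[of ?\<phi> q] by blast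
  then have t: "t \<le> q" "app \<mu> (nat_name n) m' t" "is_norm e m' r t" "eq_rat r 1 t"
    by (simp_all add: and_iff)
  then obtain t' l' where t': "t' \<le> t" "(is_measure_list e m' l' \<^bold>\<and> is_abs_sum l' r) t'"
    unfolding is_norm_def ex_iff by blast
  have tp: "t' \<le> p" using t'(1) t(1) q by order
  have l': "is_measure_list e m' l' t'" "is_abs_sum l' r t'" using t'(2) by (simp_all add: and_iff)
  have "(m \<^bold>= m') t'" using uniq[OF tp reg_mono[OF reg_app m(1) tp] reg_mono[OF reg_app t(2) t'(1)]] .
  from list_norm_agree[OF reg_mono[OF reg_is_measure_list m(2) tp] l'(1) this]
    abs_sum_denotes[OF l'(2) measure_list_weight[OF l'(1)]] eq_rat_denotes[OF reg_mono[OF reg_eq_rat t(4) t'(1)]]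
  have "eventually (\<lambda>w. list_norm l w = 1) (aef t')"
  proof eventually_elim
    case (elim w)
    show ?case using denotes_unique[OF elim(2,3)] elim(1) by simp
  qed
  then show "\<exists>r\<le>q. eventually (\<lambda>w. list_norm l w = 1) (aef r)" using order_trans[OF t'(1) t(1)] by blast
qed

lemma measure_seq_unique:
  assumes "is_measure_seq e \<mu> p" "q \<le> p" "app \<mu> x y q" "app \<mu> x y' q"
  shows "(y \<^bold>= y') q"
proof -
  have "forced_at (app \<mu> x y \<^bold>\<and> app \<mu> x y' \<^bold>\<longrightarrow> y \<^bold>= y') p"
    by (rule forced_atI[of "is_measure_seq e \<mu>", OF assms(1), unfolded is_measure_seq_def is_function_def,
      THEN andD2, THEN andD2, THEN forced_at_allD, THEN forced_at_allD, THEN forced_at_allD])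
  from forced_at_impD[OF this reg_and[OF reg_app reg_app] reg_eq assms(2)] show ?thesis
    using assms(3,4) by (simp add: and_iff)
qed

section \<open>Assembling the random measures from a forced counterexample\<close>

lemma no_bounded_weak_star_null_sequence:
  assumes sc: "sigma_complete TYPE('a)"
    and seq: "is_measure_seq e \<mu> p" and null: "weak_star_null e \<mu> p" and norm: "all_norm_one e \<mu> p"
    and supp: "\<And>n. forced_at (\<^bold>\<exists>m. app \<mu> (nat_name n) m \<^bold>\<and> supp_card_le e m M) p"
  shows False
proof -
  \<comment> \<open>A name and a list for the measure of index \<open>n\<close> can be fixed only
    below some condition, so they are chosen for each member of a countable cover \<open>J n\<close>
    of \<open>p\<close>.\<close>
  define good where "good n r m l \<longleftrightarrow> app \<mu> (nat_name n) m r \<and> is_measure_list e m l r \<and> length l \<le> M" for n r m l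
  have cover: "\<exists>r\<le>q. \<exists>m l. good n r m l" if q: "q \<le> p" for n q
  proof -
    obtain r m where r: "r \<le> q" "(app \<mu> (nat_name n) m \<^bold>\<and> supp_card_le e m M) r"
      using forced_at_exD[OF supp q] by blast
    then have r': "app \<mu> (nat_name n) m r" "supp_card_le e m M r" by (simp_all add: and_iff)
    obtain s l where s: "s \<le> r" "(is_measure_list e m l \<^bold>\<and> ground (length l \<le> M)) s"
      using r'(2) unfolding supp_card_le_def ex_iff by blast
    then have "good n s m l" using reg_mono[OF reg_app r'(1)] by (simp add: good_def and_iff ground_iff)
    then show ?thesis using order_trans[OF s(1) r(1)] by blast
  qed
  have "\<exists>J. countable J \<and> (\<forall>r\<in>J. r \<le> p \<and> (\<exists>m l. good n r m l)) \<and> eventually (\<lambda>w. \<exists>r\<in>J. w \<in> rep r) (aef p)" for n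
  proof (rule countable_cover[of p "\<lambda>r. \<exists>m l. good n r m l", OF cover])
    fix J
    assume "countable J" "\<And>r. r \<in> J \<Longrightarrow> r \<le> p \<and> (\<exists>m l. good n r m l)"
      "eventually (\<lambda>w. \<exists>r\<in>J. w \<in> rep r) (aef p)"
    then show ?thesis by blast
  qed
  from choice[OF allI, OF this] obtain J where "\<forall>n. countable (J n) \<and> (\<forall>r\<in>J n. r \<le> p \<and> (\<exists>m l. good n r m l)) \<and>
      eventually (\<lambda>w. \<exists>r\<in>J n. w \<in> rep r) (aef p)" ..
  then have J: "\<And>n. countable (J n)" "\<And>n r. r \<in> J n \<Longrightarrow> r \<le> p" "\<And>n r. r \<in> J n \<Longrightarrow> \<exists>m l. good n r m l"
    "\<And>n. eventually (\<lambda>w. \<exists>r\<in>J n. w \<in> rep r) (aef p)" by blast+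
  define m where "m n r = (SOME m. \<exists>l. good n r m l)" for n r
  define l where "l n r = (SOME l. good n r (m n r) l)" for n r
  have ml: "good n r (m n r) (l n r)" if "r \<in> J n" for n r
    unfolding l_def by (rule someI_ex, unfold m_def, rule someI_ex) (rule J(3)[OF that])
  have Jne: "J n \<noteq> {}" for n using J(4)[of n] by auto
  have uniq: "(y \<^bold>= y') q" if "r \<in> J n" "q \<le> r" "app \<mu> x y q" "app \<mu> x y' q" for n r q x y y'
    using measure_seq_unique[OF seq order_trans[OF that(2) J(2)[OF that(1)]] that(3,4)] .
  have app: "app \<mu> (nat_name n) (m n r) r" and ml': "is_measure_list e (m n r) (l n r) r" and len: "length (l n r) \<le> M"
    if "r \<in> J n" for n r using ml[OF that] by (simp_all add: good_def)
  have rn: "reg (all_norm_one e \<mu>)"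
    unfolding all_norm_one_def by (intro reg_intros reg_app reg_is_norm reg_eq_rat)
  have norm1: "eventually (\<lambda>w. list_norm (l n r) w = 1) (aef r)" if "r \<in> J n" for n r
    using norm_one_list_norm[OF uniq[OF that] app[OF that] ml'[OF that] reg_mono[OF rn norm J(2)[OF that]]] .
  have lne: "l n r \<noteq> []" if "r \<in> J n" for n r using norm1[OF that] by auto
  have wl: "is_weight_list e (l n r) r" if "r \<in> J n" for n r using measure_list_weight[OF ml'[OF that]] .
  \<comment> \<open>Indices beyond the length of the list repeat the first point, with weight zero.
    Every index then gives a genuine point, as \<open>X_inf\<close> and \<open>X_compl\<close>
    require.\<close>
  define ix where "ix n r i = (if i < length (l n r) then i else 0)" for n r i
  define pnt where "pnt n r i = fst (l n r ! ix n r i)" for n r i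
  have ix: "l n r ! ix n r i \<in> set (l n r)" if "r \<in> J n" for n r i
    using lne[OF that] by (auto simp: ix_def)
  have pnt: "is_point e (pnt n r i) r" if "r \<in> J n" for n r i
    unfolding pnt_def by (rule weight_list_point[OF wl[OF that] ix[OF that]])

  \<comment> \<open>The first condition of the cover that contains the sample point decides which
    list is used; enumerating the cover makes the choice measurable. Where no condition contains the
    point, which within \<open>p\<close> happens on a null set, some member of \<open>J n\<close> is
    still selected.\<close>
  define kk where "kk n w = (LEAST k. w \<in> rep (from_nat_into (J n) k))" for n w
  define R where "R n w = from_nat_into (J n) (kk n w)" for n w
  define X where "X n i a = {w. w \<in> tv (e a \<^bold>\<in> pnt n (R n w) i)}" for n i a
  define \<alpha> where "\<alpha> n i w = (if i < length (l n (R n w)) then val (snd (l n (R n w) ! i)) w else 0)" for n i w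
  define N where "N = (completion coin_space :: ('k \<Rightarrow> bool) measure)"
  \<comment> \<open>The coin measure conditioned on \<open>p\<close>, because \<open>p\<close> is
    what forces the sequence to be a counterexample.\<close>
  define M' where "M' = uniform_measure N (rep p)"
  have spN: "space N = UNIV" by (simp add: N_def)
  have borelN: "A \<in> sets borel \<Longrightarrow> A \<in> sets N" for A unfolding N_def by (rule borel_in_completion_coin)
  interpret N: prob_space N unfolding N_def by (rule prob_space.prob_space_completion[OF prob_space_coin])
  have M'_space: "space M' = UNIV" and M'_sets: "sets M' = sets N" by (simp_all add: M'_def spN)
  have borelM': "A \<in> sets borel \<Longrightarrow> A \<in> sets M'" for A using borelN M'_sets by simp
  have measM': "f \<in> borel_measurable M'" if "f \<in> borel_measurable borel" for f :: "('k \<Rightarrow> bool) \<Rightarrow> real"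
    by (rule measurableI) (use measurable_sets[OF that] borelM' in \<open>auto simp: M'_space\<close>)
  have "emeasure N (rep p) \<noteq> 0"
    using rep_not_null[of p] borelN[OF rep_borel[of p]] by (auto simp: N_def null_sets_def)
  then interpret M': prob_space M' unfolding M'_def by (rule prob_space_uniform_measure) simp

  have AEp: "AE w in M'. Q w" if "eventually Q (aef p)" for Q
  proof -
    have "AE w in N. w \<in> rep p \<longrightarrow> Q w"
      by (rule AE_I'[of "{w \<in> rep p. \<not> Q w}"]) (use that in \<open>auto simp: eventually_aef N_def\<close>)
    then show ?thesis unfolding M'_def by (intro AE_uniform_measureI borelN[OF rep_borel])
  qed
  \<comment> \<open>A property almost sure on each condition of the cover holds almost surely along
    the random choice \<open>R n\<close>, because only countably many exceptional null sets are
    discarded.\<close>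
  have AEJ: "AE w in M'. Q (R n w) w" if Q: "\<And>r. r \<in> J n \<Longrightarrow> eventually (Q r) (aef r)" for n Q
  proof (rule AEp)
    have "coin_null (\<Union>r\<in>J n. {w \<in> rep r. \<not> Q r w})"
      using J(1) Q by (intro coin_null_UN) (auto simp: eventually_aef)
    with J(4)[of n] show "eventually (\<lambda>w. Q (R n w) w) (aef p)"
      unfolding eventually_aef
    proof (rule coin_null_subset2)
      show "{w \<in> rep p. \<not> Q (R n w) w} \<subseteq> {w \<in> rep p. \<not> (\<exists>r\<in>J n. w \<in> rep r)} \<union> (\<Union>r\<in>J n. {w \<in> rep r. \<not> Q r w})"
      proof
        fix w assume w: "w \<in> {w \<in> rep p. \<not> Q (R n w) w}"
        show "w \<in> {w \<in> rep p. \<not> (\<exists>r\<in>J n. w \<in> rep r)} \<union> (\<Union>r\<in>J n. {w \<in> rep r. \<not> Q r w})"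
        proof (cases "\<exists>r\<in>J n. w \<in> rep r")
          case True
          then have "\<exists>k. w \<in> rep (from_nat_into (J n) k)"
            using from_nat_into_surj[OF J(1)] by metis
          then have "w \<in> rep (R n w)" unfolding R_def kk_def by (rule LeastI_ex)
          moreover have "R n w \<in> J n" unfolding R_def by (rule from_nat_into[OF Jne])
          ultimately show ?thesis using w by blast
        qed (use w in blast)
      qed
    qed
  qed

  have [measurable]: "kk n \<in> measurable M' (count_space UNIV)" for n
  proof -
    have [measurable]: "Measurable.pred M' (\<lambda>w. w \<in> rep (from_nat_into (J n) k))" for k
      unfolding pred_def using borelM'[OF rep_borel] by (simp add: M'_space)
    show ?thesis unfolding kk_def by measurable
  qed
  have X_sets: "X n i a \<in> sets M'" for n i a
  proof -
    have [measurable]: "Measurable.pred M' (\<lambda>w. w \<in> tv (e a \<^bold>\<in> pnt n r i))" for r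
      unfolding pred_def using borelM'[OF tv_borel[OF reg_mem]] by (simp add: M'_space)
    have "Measurable.pred M' (\<lambda>w. w \<in> tv (e a \<^bold>\<in> pnt n (R n w) i))"
      unfolding R_def by (rule measurable_compose_countable) measurable
    then show ?thesis by (simp add: X_def pred_def M'_space)
  qed
  have \<alpha>_meas: "\<alpha> n i \<in> borel_measurable M'" for n i
  proof -
    have [measurable]: "val x \<in> borel_measurable M'" for x :: "('i, 'k random) name" by (rule measM'[OF measurable_val])
    show ?thesis unfolding \<alpha>_def R_def
      by (rule measurable_compose_countable[where g = "kk n"]) measurable
  qed
  \<comment> \<open>Kept general in \<open>h\<close> to serve both the norm and the integral of
    \<open>a\<close>; that \<open>h\<close> vanishes at weight zero makes the padding
    invisible.\<close>
  have sum_\<alpha>: "(\<Sum>i<M. h (\<alpha> n i w) (X n i a)) = (\<Sum>xa\<leftarrow>l n (R n w). h (val (snd xa) w) {w'. w' \<in> tv (e a \<^bold>\<in> fst xa)})"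
    if "R n w \<in> J n" "\<And>A. h 0 A = 0" "\<And>v A B. (w \<in> A \<longleftrightarrow> w \<in> B) \<Longrightarrow> h v A = h v B"
    for n w a and h :: "real \<Rightarrow> ('k \<Rightarrow> bool) set \<Rightarrow> real"
  proof -
    let ?l = "l n (R n w)"
    have "(\<Sum>i<M. h (\<alpha> n i w) (X n i a)) = (\<Sum>i<length ?l. h (\<alpha> n i w) (X n i a))"
      using len[OF that(1)] by (intro sum.mono_neutral_right) (auto simp: \<alpha>_def that(2))
    also have "\<dots> = (\<Sum>i<length ?l. h (val (snd (?l ! i)) w) {w'. w' \<in> tv (e a \<^bold>\<in> fst (?l ! i))})"
      by (intro sum.cong refl) (auto simp: \<alpha>_def X_def pnt_def ix_def intro!: that(3))
    also have "\<dots> = (\<Sum>xa\<leftarrow>?l. h (val (snd xa) w) {w'. w' \<in> tv (e a \<^bold>\<in> fst xa)})"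
      by (simp add: sum_list_sum_nth atLeast0LessThan)
    finally show ?thesis .
  qed
  have RJ: "R n w \<in> J n" for n w unfolding R_def by (rule from_nat_into[OF Jne])

  define sep where "sep n r i j C \<longleftrightarrow> countable C \<and> (r \<in> J n \<longrightarrow> i < length (l n r) \<longrightarrow> j < length (l n r) \<longrightarrow> i \<noteq> j \<longrightarrow>
      eventually (\<lambda>w. \<exists>a\<in>C. w \<in> tv (e a \<^bold>\<in> fst (l n r ! i)) \<longleftrightarrow> w \<notin> tv (e a \<^bold>\<in> fst (l n r ! j))) (aef r))" for n r i j C
  define Cs where "Cs n r i j = (SOME C. sep n r i j C)" for n r i j
  have "\<exists>C. sep n r i j C" for n r i j
  proof (cases "r \<in> J n \<and> i < length (l n r) \<and> j < length (l n r) \<and> i \<noteq> j")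
    case True
    then have r: "r \<in> J n" and ij: "l n r ! i \<in> set (l n r)" "l n r ! j \<in> set (l n r)" by simp_all
    have "l n r ! i \<noteq> l n r ! j" using True weight_list_distinct[OF wl[OF r]] by (simp add: nth_eq_iff_index_eq)
    from points_separated[OF weight_list_point[OF wl[OF r] ij(1)] weight_list_point[OF wl[OF r] ij(2)] weight_list_neq[OF wl[OF r] ij this]]
    show ?thesis unfolding sep_def by blast
  next
    case False
    then have "sep n r i j {}" by (auto simp: sep_def)
    then show ?thesis by blast
  qed
  then have "sep n r i j (Cs n r i j)" for n r i j unfolding Cs_def by (rule someI_ex)
  then have Cs: "\<And>n r i j. countable (Cs n r i j)"
    "\<And>n r i j. r \<in> J n \<Longrightarrow> i < length (l n r) \<Longrightarrow> j < length (l n r) \<Longrightarrow> i \<noteq> j \<Longrightarrow>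
      eventually (\<lambda>w. \<exists>a\<in>Cs n r i j. w \<in> tv (e a \<^bold>\<in> fst (l n r ! i)) \<longleftrightarrow> w \<notin> tv (e a \<^bold>\<in> fst (l n r ! j))) (aef r)"
    unfolding sep_def by blast+
  \<comment> \<open>One countable family separates the atoms of all lists at once. Inserting
    \<open>bot\<close> keeps it nonempty, so that it can be enumerated.\<close>
  define C where "C = insert bot (\<Union>n. \<Union>r\<in>J n. \<Union>i. \<Union>j. Cs n r i j)"
  have C: "countable C" "C \<noteq> {}" unfolding C_def using J(1) Cs(1) by auto
  define c where "c = from_nat_into C"
  have range_c: "range c = C" unfolding c_def using C by (rule range_from_nat_into[rotated])

  interpret random_measures M' X \<alpha> M c
  proof
    fix n i j and a b :: 'a
    show "X n i a \<in> sets M'" by (rule X_sets)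
    show "\<alpha> n i \<in> borel_measurable M'" by (rule \<alpha>_meas)
    show "AE w in M'. w \<in> X n i (inf a b) \<longleftrightarrow> w \<in> X n i a \<and> w \<in> X n i b"
      using AEJ[of n "\<lambda>r w. w \<in> tv (e (inf a b) \<^bold>\<in> pnt n r i) \<longleftrightarrow> w \<in> tv (e a \<^bold>\<in> pnt n r i) \<and> w \<in> tv (e b \<^bold>\<in> pnt n r i)"]
        tv_point_inf[OF pnt] by (simp add: X_def)
    show "AE w in M'. w \<in> X n i (- a) \<longleftrightarrow> w \<notin> X n i a"
      using AEJ[of n "\<lambda>r w. w \<in> tv (e (- a) \<^bold>\<in> pnt n r i) \<longleftrightarrow> w \<notin> tv (e a \<^bold>\<in> pnt n r i)"]
        tv_point_compl[OF pnt] by (simp add: X_def)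
    show "AE w in M'. (\<Sum>i<M. \<bar>\<alpha> n i w\<bar>) = 1"
      using AEJ[of n "\<lambda>r w. list_norm (l n r) w = 1"] norm1 sum_\<alpha>[of n _ "\<lambda>v _. \<bar>v\<bar>", OF RJ] by simp
    show "AE w in M'. \<alpha> n i w \<noteq> 0 \<longrightarrow> \<alpha> n j w \<noteq> 0 \<longrightarrow> (\<exists>k. w \<in> X n i (c k) \<longleftrightarrow> w \<notin> X n j (c k))" if "i \<noteq> j"
    proof -
      have "AE w in M'. i < length (l n (R n w)) \<longrightarrow> j < length (l n (R n w)) \<longrightarrow>
          (\<exists>a\<in>C. w \<in> tv (e a \<^bold>\<in> fst (l n (R n w) ! i)) \<longleftrightarrow> w \<notin> tv (e a \<^bold>\<in> fst (l n (R n w) ! j)))"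
      proof (rule AEJ[of n "\<lambda>r w. i < length (l n r) \<longrightarrow> j < length (l n r) \<longrightarrow>
          (\<exists>a\<in>C. w \<in> tv (e a \<^bold>\<in> fst (l n r ! i)) \<longleftrightarrow> w \<notin> tv (e a \<^bold>\<in> fst (l n r ! j)))"])
        fix r assume r: "r \<in> J n"
        show "eventually (\<lambda>w. i < length (l n r) \<longrightarrow> j < length (l n r) \<longrightarrow>
          (\<exists>a\<in>C. w \<in> tv (e a \<^bold>\<in> fst (l n r ! i)) \<longleftrightarrow> w \<notin> tv (e a \<^bold>\<in> fst (l n r ! j)))) (aef r)"
        proof (cases "i < length (l n r) \<and> j < length (l n r)")
          case True
          then have "eventually (\<lambda>w. \<exists>a\<in>Cs n r i j. w \<in> tv (e a \<^bold>\<in> fst (l n r ! i)) \<longleftrightarrow> w \<notin> tv (e a \<^bold>\<in> fst (l n r ! j))) (aef r)"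
            using Cs(2)[OF r _ _ \<open>i \<noteq> j\<close>] by blast
          then show ?thesis by eventually_elim (use r in \<open>unfold C_def, blast\<close>)
        qed simp
      qed
      then show ?thesis
      proof eventually_elim
        case (elim w)
        show ?case
        proof (intro impI)
          assume "\<alpha> n i w \<noteq> 0" "\<alpha> n j w \<noteq> 0"
          then have ij: "i < length (l n (R n w))" "j < length (l n (R n w))" by (auto simp: \<alpha>_def split: if_splits)
          then obtain a where "a \<in> C" "w \<in> tv (e a \<^bold>\<in> fst (l n (R n w) ! i)) \<longleftrightarrow> w \<notin> tv (e a \<^bold>\<in> fst (l n (R n w) ! j))"
            using elim by blast
          moreover then obtain k where "a = c k" using range_c by blast
          ultimately show "\<exists>k. w \<in> X n i (c k) \<longleftrightarrow> w \<notin> X n j (c k)"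
            using ij by (intro exI[of _ k]) (simp add: X_def pnt_def ix_def)
        qed
      qed
    qed
    show "AE w in M'. (\<lambda>n. \<Sum>i<M. \<alpha> n i w * indicat_real (X n i a) w) \<longlonglongrightarrow> 0"
    proof -
      \<comment> \<open>Smallness is forced for one rational bound at a time; a sequence of bounds
        tending to zero keeps the null sets countable in number.\<close>
      let ?\<epsilon> = "\<lambda>k::nat. 1 / of_nat (Suc k) :: rat"
      have "AE w in M'. \<forall>k. \<exists>N. \<forall>n. N \<le> n \<longrightarrow> w \<in> tv (small_integral \<mu> a (?\<epsilon> k) n)"
        unfolding AE_all_countable by (intro allI AEp weak_star_null_small_integral[OF null]) simp
      moreover have "AE w in M'. \<forall>k n. w \<in> tv (small_integral \<mu> a (?\<epsilon> k) n) \<longrightarrow> \<bar>list_measure a (l n (R n w)) w\<bar> < of_rat (?\<epsilon> k)"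
        unfolding AE_all_countable
      proof (intro allI)
        fix k n
        show "AE w in M'. w \<in> tv (small_integral \<mu> a (?\<epsilon> k) n) \<longrightarrow> \<bar>list_measure a (l n (R n w)) w\<bar> < of_rat (?\<epsilon> k)"
          using AEJ[of n "\<lambda>r w. w \<in> tv (small_integral \<mu> a (?\<epsilon> k) n) \<longrightarrow> \<bar>list_measure a (l n r) w\<bar> < of_rat (?\<epsilon> k)"]
            small_integral_list_measure[OF uniq app ml'] by simp
      qed
      ultimately show ?thesis
      proof eventually_elim
        case (elim w)
        have eq: "(\<Sum>i<M. \<alpha> n i w * indicat_real (X n i a) w) = list_measure a (l n (R n w)) w" for n
          using sum_\<alpha>[of n w "\<lambda>v A. v * indicat_real A w" a, OF RJ] by (simp add: indicator_def of_bool_def)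
        show ?case unfolding eq
        proof (rule LIMSEQ_I)
          fix \<delta> :: real assume "\<delta> > 0"
          then obtain k where k: "1 / real (Suc k) < \<delta>" using nat_approx_posE by blast
          have \<epsilon>k: "(of_rat (?\<epsilon> k) :: real) = 1 / real (Suc k)" by (simp add: of_rat_divide of_rat_add)
          obtain N where N: "\<forall>n. N \<le> n \<longrightarrow> w \<in> tv (small_integral \<mu> a (?\<epsilon> k) n)" using elim(1) by blast
          have "\<bar>list_measure a (l n (R n w)) w\<bar> < \<delta>" if "n \<ge> N" for n
          proof -
            have "\<bar>list_measure a (l n (R n w)) w\<bar> < of_rat (?\<epsilon> k)" using elim(2) N that by blast
            then show ?thesis unfolding \<epsilon>k using k by (rule order_less_trans)
          qed
          then show "\<exists>N. \<forall>n\<ge>N. norm (list_measure a (l n (R n w)) w - 0) < \<delta>" by auto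
        qed
      qed
    qed
  qed
  show False by (rule no_bounded_weak_null_sequence[OF sc])
qed

end

theorem theorem4p7:
  fixes e :: "'a::boolean_algebra \<Rightarrow> ('i, 'k random) name"
  assumes "infinite (UNIV :: 'k set)"
    and "infinite (UNIV :: 'a set)"
    and "sigma_complete TYPE('a)"
    and "\<exists>h :: ('a \<times> 'k random) set set \<Rightarrow> 'i. inj h"
    and "ground_coding e"
  shows "forced (\<^bold>\<not> (\<^bold>\<exists>\<mu>. is_measure_seq e \<mu> \<^bold>\<and> weak_star_null e \<mu> \<^bold>\<and>
           all_norm_one e \<mu> \<^bold>\<and> bounded_supports e \<mu>))"
  unfolding forced_def
proof (intro allI forces_not_def[THEN iffD2] impI notI)
  interpret big_names e by unfold_locales (fact assms(2), fact assms(4))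
  fix p q :: "'k random"
  assume "(\<^bold>\<exists>\<mu>. is_measure_seq e \<mu> \<^bold>\<and> weak_star_null e \<mu> \<^bold>\<and> all_norm_one e \<mu> \<^bold>\<and> bounded_supports e \<mu>) q"
  then have "forced_at (\<^bold>\<exists>\<mu>. is_measure_seq e \<mu> \<^bold>\<and> weak_star_null e \<mu> \<^bold>\<and> all_norm_one e \<mu> \<^bold>\<and> bounded_supports e \<mu>) q"
    unfolding forced_at_def .
  from forced_at_exD[OF this order_refl]
  obtain r \<mu> where "(is_measure_seq e \<mu> \<^bold>\<and> weak_star_null e \<mu> \<^bold>\<and> all_norm_one e \<mu> \<^bold>\<and> bounded_supports e \<mu>) r" by blast
  then have r: "is_measure_seq e \<mu> r" "weak_star_null e \<mu> r" "all_norm_one e \<mu> r" "bounded_supports e \<mu> r"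
    by (simp_all add: and_iff)
  \<comment> \<open>The bound on the supports is an existential statement of the forcing language,
    so it becomes a number of the ground model only below a stronger condition.\<close>
  obtain s M where s: "s \<le> r" "forced_at (\<^bold>\<forall>n. \<^bold>\<exists>m. app \<mu> (nat_name n) m \<^bold>\<and> supp_card_le e m M) s"
    using forced_at_exD[OF forced_atI[of "bounded_supports e \<mu>", OF r(4), unfolded bounded_supports_def] order_refl]
    unfolding forced_at_def by blast
  have reg: "reg (is_measure_seq e \<mu>)" "reg (weak_star_null e \<mu>)" "reg (all_norm_one e \<mu>)"
    unfolding is_measure_seq_def is_fs_measure_def is_nat_def weak_star_null_def is_continuous_def is_function_def all_norm_one_def
    by (intro reg_intros reg_is_point reg_is_real reg_is_pair reg_app reg_mem reg_eq reg_dist_less reg_is_integral reg_is_abs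
      reg_less_rat reg_is_norm reg_eq_rat reg_is_measure_list)+
  show False
  proof (rule no_bounded_weak_star_null_sequence[OF assms(3)])
    show "is_measure_seq e \<mu> s" "weak_star_null e \<mu> s" "all_norm_one e \<mu> s"
      using reg[THEN reg_mono] r(1-3) s(1) by blast+
    show "forced_at (\<^bold>\<exists>m. app \<mu> (nat_name n) m \<^bold>\<and> supp_card_le e m M) s" for n
      by (rule forced_at_allD[OF s(2)])
  qed
qed

end
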